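(* Let $n\ge 1$ and let $s>t\ge 1$ be integers. For a positive integer $m$ with $m(s-t)\ge n$, let $V$ be the kernel bundle of a general map, defined by $$0\to V\to \mathcal{O}_{\mathbb{P}^n}^{ms}\to\mathcal{O}_{\mathbb{P}^n}(1)^{mt}\to 0.$$ (a) If $m\gg 0$ (that is, for all $m\ge m_0$ for some $m_0$ depending on $n,s,t$), then $V$ has natural cohomology. (b) If the rank of $V$ is divisible by $n$, then $V$ has natural cohomology.
   Context: $\mathbb{P}^n$ is projective space over $\mathbb{C}$. A vector bundle $V$ on $\mathbb{P}^n$ has natural cohomology if for every integer $a$ the twist $V(a)$ has at most one nonvanishing cohomology group $H^i(\mathbb{P}^n,V(a))$. "General" means: for every map in some nonempty Zariski open subset of $\operatorname{Hom}(\mathcal{O}_{\mathbb{P}^n}^{ms},\mathcal{O}_{\mathbb{P}^n}(1)^{mt})$. The condition $m(s-t)\ge n$ ensures that the general such map is surjective, so that its kernel is a vector bundle. *)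

theory Defs
  imports Complex_Main
begin

section \<open>Polynomial functions and the Zariski topology\<close>

text \<open>Affine space \<open>\<complex>\<^sup>J\<close> over a finite index set \<open>J\<close> consists of the functions that
  vanish outside \<open>J\<close>. Since \<open>\<complex>\<close> is infinite, polynomials and polynomial functions agree.\<close>

definition affine_space :: "'i set \<Rightarrow> ('i \<Rightarrow> complex) set" where
  "affine_space J = {x. \<forall>i. i \<notin> J \<longrightarrow> x i = 0}"

inductive_set polyfun :: "'i set \<Rightarrow> (('i \<Rightarrow> complex) \<Rightarrow> complex) set" for J where
  const: "(\<lambda>x. c) \<in> polyfun J"
| coord: "i \<in> J \<Longrightarrow> (\<lambda>x. x i) \<in> polyfun J"
| add: "f \<in> polyfun J \<Longrightarrow> g \<in> polyfun J \<Longrightarrow> (\<lambda>x. f x + g x) \<in> polyfun J"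
| mult: "f \<in> polyfun J \<Longrightarrow> g \<in> polyfun J \<Longrightarrow> (\<lambda>x. f x * g x) \<in> polyfun J"

definition zariski_open :: "'i set \<Rightarrow> ('i \<Rightarrow> complex) set \<Rightarrow> bool" where
  "zariski_open J W \<longleftrightarrow>
     (\<exists>P \<subseteq> polyfun J. W = {x \<in> affine_space J. \<exists>p\<in>P. p x \<noteq> 0})"


section \<open>Projective space and the sheaves \<open>\<O>(a)\<close>\<close>

type_synonym point = "nat \<Rightarrow> complex"

text \<open>Subsets of \<open>\<P>\<^sup>n\<close> are represented by their preimages in \<open>\<complex>\<^sup>n\<^sup>+\<^sup>1 - {0}\<close>, that is, by sets of
  homogeneous coordinate vectors \<open>(x\<^sub>0,\<dots>,x\<^sub>n)\<close>; \<open>proj_space n\<close> is \<open>\<P>\<^sup>n\<close> itself.\<close>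

definition proj_space :: "nat \<Rightarrow> point set" where
  "proj_space n = affine_space {..n} - {\<lambda>_. 0}"

definition hom_poly :: "nat \<Rightarrow> nat \<Rightarrow> (point \<Rightarrow> complex) \<Rightarrow> bool" where
  "hom_poly n d p \<longleftrightarrow> p \<in> polyfun {..n} \<and> (\<forall>c x. p (\<lambda>i. c * x i) = c ^ d * p x)"

definition proj_open :: "nat \<Rightarrow> point set \<Rightarrow> bool" where
  "proj_open n U \<longleftrightarrow>
     (\<exists>P. (\<forall>p\<in>P. \<exists>d. hom_poly n d p) \<and> U = {x \<in> proj_space n. \<exists>p\<in>P. p x \<noteq> 0})"

text \<open>A section of \<open>\<O>(a)\<close> over \<open>U\<close> is a function on the preimage of \<open>U\<close> that is locally, in the
  Zariski topology, a quotient of homogeneous polynomials with difference of degrees \<open>a\<close> (so it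
  is homogeneous of degree \<open>a\<close>). Sections are extended by \<open>0\<close> outside \<open>U\<close>, which makes equality
  of sections equality of functions.\<close>

definition O_sections :: "nat \<Rightarrow> int \<Rightarrow> point set \<Rightarrow> (point \<Rightarrow> complex) set" where
  "O_sections n a U = {f. (\<forall>x. x \<notin> U \<longrightarrow> f x = 0) \<and>
     (\<forall>x\<in>U. \<exists>W g h d e. proj_open n W \<and> x \<in> W \<and> W \<subseteq> U \<and>
        hom_poly n d g \<and> hom_poly n e h \<and> int d - int e = a \<and>
        (\<forall>y\<in>W. h y \<noteq> 0 \<and> f y = g y / h y))}"

text \<open>All other sheaves below are subsheaves of some \<open>\<O>(a)\<^sup>r\<close>: a section is a family \<open>v\<close> whose
  components \<open>v j\<close> with \<open>j < r\<close> are sections of \<open>\<O>(a)\<close> and whose other components are \<open>0\<close>.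
  Restriction to a smaller open set is restriction of functions.\<close>

type_synonym vec_section = "nat \<Rightarrow> point \<Rightarrow> complex"
type_synonym sheaf = "point set \<Rightarrow> vec_section set"

definition O_sum :: "nat \<Rightarrow> int \<Rightarrow> nat \<Rightarrow> sheaf" where
  "O_sum n a r U = {v. (\<forall>j<r. v j \<in> O_sections n a U) \<and> (\<forall>j\<ge>r. v j = (\<lambda>_. 0))}"

definition restr :: "point set \<Rightarrow> vec_section \<Rightarrow> vec_section" where
  "restr W v = (\<lambda>j x. if x \<in> W then v j x else 0)"

text \<open>Locally free of rank \<open>r\<close>: around every point there is a frame \<open>e\<^sub>0,\<dots>,e\<^sub>r\<^sub>-\<^sub>1\<close> inducing an
  isomorphism of sheaves \<open>\<O>\<^sup>r \<cong> F\<close>.\<close>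

definition vector_bundle :: "nat \<Rightarrow> nat \<Rightarrow> sheaf \<Rightarrow> bool" where
  "vector_bundle n r F \<longleftrightarrow>
     (\<forall>x\<in>proj_space n. \<exists>W. proj_open n W \<and> x \<in> W \<and>
        (\<exists>e :: nat \<Rightarrow> vec_section. \<forall>U. proj_open n U \<and> U \<subseteq> W \<longrightarrow>
           bij_betw (\<lambda>c j y. \<Sum>l<r. c l y * e l j y) (O_sum n 0 r U) (F U)))"


section \<open>Maps \<open>\<O>\<^sup>q \<rightarrow> \<O>(1)\<^sup>p\<close> and their kernels\<close>

text \<open>A map \<open>\<O>\<^sup>q \<rightarrow> \<O>(1)\<^sup>p\<close> is a \<open>p \<times> q\<close> matrix of linear forms; \<open>A (k, j, i)\<close> is the coefficient
  of \<open>x\<^sub>i\<close> in the entry in row \<open>k\<close> and column \<open>j\<close>. So the vector space of all these maps is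
  \<open>affine_space (hom_index n q p)\<close>.\<close>

type_synonym lin_matrix = "nat \<times> nat \<times> nat \<Rightarrow> complex"

definition hom_index :: "nat \<Rightarrow> nat \<Rightarrow> nat \<Rightarrow> (nat \<times> nat \<times> nat) set" where
  "hom_index n q p = {..<p} \<times> {..<q} \<times> {..n}"

text \<open>The same matrix gives the twisted maps \<open>\<O>(a)\<^sup>q \<rightarrow> \<O>(a+1)\<^sup>p\<close> for all \<open>a\<close>.\<close>

definition apply_map :: "nat \<Rightarrow> nat \<Rightarrow> nat \<Rightarrow> lin_matrix \<Rightarrow> vec_section \<Rightarrow> vec_section" where
  "apply_map n q p A v =
     (\<lambda>k x. if k < p then \<Sum>j<q. (\<Sum>i\<le>n. A (k, j, i) * x i) * v j x else 0)"

text \<open>Surjectivity as a map of sheaves: sections of \<open>\<O>(1)\<^sup>p\<close> lift locally.\<close>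

definition surjective_map :: "nat \<Rightarrow> nat \<Rightarrow> nat \<Rightarrow> lin_matrix \<Rightarrow> bool" where
  "surjective_map n q p A \<longleftrightarrow>
     (\<forall>U. proj_open n U \<longrightarrow> (\<forall>w \<in> O_sum n 1 p U. \<forall>x\<in>U.
        \<exists>W. proj_open n W \<and> x \<in> W \<and> W \<subseteq> U \<and>
          (\<exists>v \<in> O_sum n 0 q W. apply_map n q p A v = restr W w)))"

text \<open>The twist \<open>V(a)\<close> of the kernel \<open>V\<close>: as \<open>\<O>(a)\<close> is invertible, it is the kernel of
  \<open>\<O>(a)\<^sup>q \<rightarrow> \<O>(a+1)\<^sup>p\<close>. The bundle \<open>V\<close> is the case \<open>a = 0\<close>.\<close>

definition kernel_sheaf :: "nat \<Rightarrow> nat \<Rightarrow> nat \<Rightarrow> lin_matrix \<Rightarrow> int \<Rightarrow> sheaf" where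
  "kernel_sheaf n q p A a U = {v \<in> O_sum n a q U. apply_map n q p A v = (\<lambda>_ _. 0)}"

definition for_general_map :: "nat \<Rightarrow> nat \<Rightarrow> nat \<Rightarrow> (lin_matrix \<Rightarrow> bool) \<Rightarrow> bool" where
  "for_general_map n q p Q \<longleftrightarrow>
     (\<exists>W. zariski_open (hom_index n q p) W \<and> W \<noteq> {} \<and> (\<forall>A\<in>W. Q A))"


section \<open>Cohomology\<close>

text \<open>The cohomology of a coherent sheaf on \<open>\<P>\<^sup>n\<close> is its Cech cohomology with respect to the
  affine cover by the sets \<open>x\<^sub>i \<noteq> 0\<close>. A \<open>p\<close>-cochain assigns to each set
  \<open>I = {i\<^sub>0 < \<dots> < i\<^sub>p} \<subseteq> {0,\<dots>,n}\<close> a section over the intersection \<open>chart n I\<close>; the value on any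
  other set is \<open>0\<close>.\<close>

definition chart :: "nat \<Rightarrow> nat set \<Rightarrow> point set" where
  "chart n I = {x \<in> proj_space n. \<forall>i\<in>I. x i \<noteq> 0}"

type_synonym cochain = "nat set \<Rightarrow> vec_section"

definition simplices :: "nat \<Rightarrow> nat \<Rightarrow> nat set set" where
  "simplices n p = {I. I \<subseteq> {..n} \<and> card I = Suc p}"

definition cochains :: "nat \<Rightarrow> sheaf \<Rightarrow> nat \<Rightarrow> cochain set" where
  "cochains n F p = {s. (\<forall>I \<in> simplices n p. s I \<in> F (chart n I)) \<and>
                        (\<forall>I. I \<notin> simplices n p \<longrightarrow> s I = (\<lambda>_ _. 0))}"

text \<open>The exponent \<open>card {i' \<in> I. i' < i}\<close> is the position of \<open>i\<close> in the increasing enumeration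
  of \<open>I\<close>, so this is the usual alternating sum.\<close>

definition coboundary_map :: "nat \<Rightarrow> nat \<Rightarrow> cochain \<Rightarrow> cochain" where
  "coboundary_map n p s = (\<lambda>I j x. if I \<in> simplices n (Suc p) then
     (\<Sum>i\<in>I. (-1) ^ card {i' \<in> I. i' < i} * restr (chart n I) (s (I - {i})) j x) else 0)"

definition cocycles :: "nat \<Rightarrow> sheaf \<Rightarrow> nat \<Rightarrow> cochain set" where
  "cocycles n F p = {s \<in> cochains n F p. coboundary_map n p s = (\<lambda>_ _ _. 0)}"

definition coboundaries :: "nat \<Rightarrow> sheaf \<Rightarrow> nat \<Rightarrow> cochain set" where
  "coboundaries n F p =
     (case p of 0 \<Rightarrow> {\<lambda>_ _ _. 0} | Suc q \<Rightarrow> coboundary_map n q ` cochains n F q)"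

text \<open>\<open>H\<^sup>p(\<P>\<^sup>n, F) = 0\<close>, where \<open>H\<^sup>p\<close> is the quotient of the cocycles by the coboundaries.\<close>

definition cohomology_vanishes :: "nat \<Rightarrow> sheaf \<Rightarrow> nat \<Rightarrow> bool" where
  "cohomology_vanishes n F p \<longleftrightarrow> cocycles n F p = coboundaries n F p"

text \<open>The argument is the family of twists \<open>a \<mapsto> V(a)\<close>.\<close>

definition natural_cohomology :: "nat \<Rightarrow> (int \<Rightarrow> sheaf) \<Rightarrow> bool" where
  "natural_cohomology n V \<longleftrightarrow> (\<forall>a. \<exists>\<^sub>\<le>\<^sub>1 i. \<not> cohomology_vanishes n (V a) i)"

end

theory Submission
  imports Defs "Jordan_Normal_Form.Determinant" "HOL-Computational_Algebra.Fundamental_Theorem_Algebra"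
    "HOL-Library.Cardinality"
begin

text \<open>The long exact sequence reduces natural cohomology of the kernel of \<open>\<O>\<^sup>q \<rightarrow> \<O>(1)\<^sup>p\<close> to maximal rank
  of the multiplication maps \<open>S\<^sub>d\<^sup>q \<rightarrow> S\<^sub>d\<^sub>+\<^sub>1\<^sup>p\<close>. With \<open>r = q - p\<close>, injectivity is expected for
  \<open>r (d + 1) \<le> n p\<close> and surjectivity for \<open>r (d + 1) \<ge> n p\<close>; both conditions are open in the map, the
  first is inherited by smaller and the second by larger degrees, so one map of each kind, in two
  consecutive degrees, suffices.

  For \<open>r = n\<close> the \<open>p \<times> (n + p)\<close> Toeplitz matrix with bands \<open>x\<^sub>0, \<dots>, x\<^sub>n\<close> works: over \<open>S[T]\<close> its
  relations say that \<open>(\<Sum> x\<^sub>i T\<^sup>i) (\<Sum> e\<^sub>k T\<^sup>k) = 0\<close> in the cokernel, which is therefore killed by all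
  monomials of degree \<open>p\<close> (Dedekind--Mertens). Direct sums of such blocks settle the case \<open>n dvd r\<close>,
  and, for large \<open>m\<close>, every degree with a strict inequality.

  There remains, for large \<open>m\<close>, the case \<open>r (d + 1) = n p\<close>, where the map is square. A first moment
  count over the field with three elements shows that some matrix is injective: the expected
  number of nonzero kernel vectors is less than two, because a subspace of \<open>S\<^sub>d\<close> that is neither
  zero nor everything generates in degree \<open>d + 1\<close> a subspace of more than the proportional
  dimension.\<close>

section \<open>Determinants over finite index sets and polynomial functions\<close>

text \<open>The threshold comes from dim S_(d+1) = dim S_d (d+1+n)/(d+1): it turns q dim S_d \<le> p
  dim S_(d+1) into r (d+1) \<le> n p. A Toeplitz block has r = n, so block sums reach only multiples
  of n; for other r one rounds, at a bounded cost. A strict inequality multiplied by m pays for the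
  rounding, an equality leaves nothing to pay with, hence the separate argument for the square case.
  There the determinant has integer coefficients, so nonvanishing modulo 3 at one matrix suffices.
  The field has three elements rather than two because a singular matrix then has at least two
  nonzero kernel vectors, one being a scalar multiple of the other. In the expected number, vectors
  whose entries span all of S_d contribute at most 1, and all others together less than 1: choosing
  a basis of their span costs a power of 3 that does not depend on m, while the excess growth of the
  span saves a power that increases with m. On the sheaf side, sections are only locally fractions;
  the bridge to coefficients is that over a chart they are Laurent polynomials.\<close>

definition enumf :: "'x set \<Rightarrow> nat \<Rightarrow> 'x" where
  "enumf X = (SOME h. bij_betw h {..<card X} X)"

lemma enumf_bij: "finite X \<Longrightarrow> bij_betw (enumf X) {..<card X} X"
  unfolding enumf_def using ex_bij_betw_nat_finite[of X]
  by (intro someI_ex[of "\<lambda>h. bij_betw h {..<card X} X"]) (simp add: atLeast0LessThan)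

definition fmat :: "'x set \<Rightarrow> ('x \<Rightarrow> 'x \<Rightarrow> 'a) \<Rightarrow> 'a mat" where
  "fmat X M = mat (card X) (card X) (\<lambda>(i, j). M (enumf X i) (enumf X j))"

text \<open>Rows and columns are numbered by the same enumeration, so the value does not depend on
  the choice made in \<open>enumf\<close>. Sets of pairs (component, monomial) can then index a
  determinant directly.\<close>

definition fdet :: "'x set \<Rightarrow> ('x \<Rightarrow> 'x \<Rightarrow> 'a :: comm_ring_1) \<Rightarrow> 'a" where
  "fdet X M = det (fmat X M)"

lemma fmat_carrier [simp]: "fmat X M \<in> carrier_mat (card X) (card X)"
  by (simp add: fmat_def)

lemma sum_enumf:
  assumes "finite X"
  shows "(\<Sum>i<card X. f (enumf X i)) = sum f X"
  using sum.reindex_bij_betw[OF enumf_bij[OF assms]] .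

lemma fmat_mult_vec:
  assumes "finite X" "i < card X"
  shows "(fmat X M *\<^sub>v vec (card X) (\<lambda>j. v (enumf X j))) $ i = (\<Sum>y\<in>X. M (enumf X i) y * v y)"
  using assms(2) by (simp add: fmat_def scalar_prod_def sum_enumf[OF assms(1), symmetric] atLeast0LessThan)

lemma all_enumf: "finite X \<Longrightarrow> (\<forall>i<card X. P (enumf X i)) \<longleftrightarrow> (\<forall>x\<in>X. P x)"
  using enumf_bij[of X] by (force simp: bij_betw_def)

text \<open>Cramer's rule: the adjugate applied to the right-hand side and divided by the
  determinant is a solution.\<close>

lemma fdet_nonzero_imp_solvable:
  fixes M :: "'x \<Rightarrow> 'x \<Rightarrow> 'a :: field"
  assumes "finite X" "fdet X M \<noteq> 0"
  shows "\<exists>z. \<forall>x\<in>X. (\<Sum>y\<in>X. M x y * z y) = w x"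
proof -
  let ?N = "card X" and ?F = "fmat X M"
  let ?A = "adj_mat ?F"
  have A: "?A \<in> carrier_mat ?N ?N" "?F * ?A = det ?F \<cdot>\<^sub>m 1\<^sub>m ?N"
    using adj_mat[of ?F ?N] by auto
  define wv where "wv = vec ?N (\<lambda>i. w (enumf X i))"
  define zv where "zv = (1 / det ?F) \<cdot>\<^sub>v (?A *\<^sub>v wv)"
  have wv: "wv \<in> carrier_vec ?N" by (simp add: wv_def)
  have zv: "zv \<in> carrier_vec ?N" using A by (simp add: zv_def wv)
  have Fz: "?F *\<^sub>v zv = wv"
  proof -
    have "?F *\<^sub>v zv = (1 / det ?F) \<cdot>\<^sub>v (?F *\<^sub>v (?A *\<^sub>v wv))"
      unfolding zv_def using A wv
      by (intro mult_mat_vec[of _ "card X" "card X"]) auto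
    also have "?F *\<^sub>v (?A *\<^sub>v wv) = (?F * ?A) *\<^sub>v wv"
      using A wv by (intro assoc_mult_mat_vec[symmetric, of _ ?N ?N _ ?N]) auto
    also have "\<dots> = det ?F \<cdot>\<^sub>v wv"
      using A(2) wv by (auto intro!: eq_vecI simp: scalar_prod_def row_def one_mat_def
        if_distrib if_distribR sum.delta cong: if_cong)
    finally show ?thesis using assms wv by (auto simp: fdet_def smult_smult_assoc)
  qed
  define z where "z x = zv $ (inv_into {..<?N} (enumf X) x)" for x
  have zz: "zv = vec ?N (\<lambda>j. z (enumf X j))"
    using zv enumf_bij[OF assms(1)] by (intro eq_vecI) (auto simp: z_def bij_betw_def)
  have "\<forall>i<?N. (\<Sum>y\<in>X. M (enumf X i) y * z y) = w (enumf X i)"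
  proof (intro allI impI)
    fix i assume i: "i < ?N"
    have "(\<Sum>y\<in>X. M (enumf X i) y * z y) = (?F *\<^sub>v zv) $ i"
      unfolding zz using fmat_mult_vec[OF assms(1) i, of M z] by simp
    then show "(\<Sum>y\<in>X. M (enumf X i) y * z y) = w (enumf X i)"
      using i by (simp add: Fz wv_def)
  qed
  then have "\<forall>x\<in>X. (\<Sum>y\<in>X. M x y * z y) = w x"
    using all_enumf[OF assms(1), of "\<lambda>x. (\<Sum>y\<in>X. M x y * z y) = w x"] by simp
  then show ?thesis by blast
qed

lemma fdet_zero_iff:
  fixes M :: "'x \<Rightarrow> 'x \<Rightarrow> 'a :: field"
  assumes X: "finite X"
  shows "fdet X M = 0 \<longleftrightarrow> (\<exists>v. (\<exists>x\<in>X. v x \<noteq> 0) \<and> (\<forall>x\<in>X. (\<Sum>y\<in>X. M x y * v y) = 0))"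
    (is "_ \<longleftrightarrow> ?R")
proof -
  let ?N = "card X" and ?F = "fmat X M"
  have "fdet X M = 0 \<longleftrightarrow> (\<exists>v. v \<in> carrier_vec ?N \<and> v \<noteq> 0\<^sub>v ?N \<and> ?F *\<^sub>v v = 0\<^sub>v ?N)"
    unfolding fdet_def by (rule det_0_iff_vec_prod_zero_field) simp
  also have "\<dots> \<longleftrightarrow> ?R"
  proof
    assume "\<exists>v. v \<in> carrier_vec ?N \<and> v \<noteq> 0\<^sub>v ?N \<and> ?F *\<^sub>v v = 0\<^sub>v ?N"
    then obtain zv where zv: "zv \<in> carrier_vec ?N" "zv \<noteq> 0\<^sub>v ?N" "?F *\<^sub>v zv = 0\<^sub>v ?N" by blast
    define z where "z x = zv $ (inv_into {..<?N} (enumf X) x)" for x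
    have zz: "zv = vec ?N (\<lambda>j. z (enumf X j))"
      using zv enumf_bij[OF X] by (intro eq_vecI) (auto simp: z_def bij_betw_def)
    have "\<forall>i<?N. (\<Sum>y\<in>X. M (enumf X i) y * z y) = 0"
      using fmat_mult_vec[OF X, of _ M z] zv(3) unfolding zz[symmetric] by auto
    then have 1: "\<forall>x\<in>X. (\<Sum>y\<in>X. M x y * z y) = 0"
      using all_enumf[OF X, of "\<lambda>x. (\<Sum>y\<in>X. M x y * z y) = 0"] by simp
    have "\<not> (\<forall>i<?N. z (enumf X i) = 0)"
    proof
      assume "\<forall>i<?N. z (enumf X i) = 0"
      then have "zv = 0\<^sub>v ?N" by (subst zz) (auto intro!: eq_vecI)
      then show False using zv by simp
    qed
    then have "\<not> (\<forall>x\<in>X. z x = 0)"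
      using all_enumf[OF X, of "\<lambda>x. z x = 0"] by simp
    then show ?R using 1 by blast
  next
    assume ?R
    then obtain v where v: "\<exists>x\<in>X. v x \<noteq> 0" "\<forall>x\<in>X. (\<Sum>y\<in>X. M x y * v y) = 0" by blast
    let ?v = "vec ?N (\<lambda>j. v (enumf X j))"
    have "?F *\<^sub>v ?v = 0\<^sub>v ?N"
    proof (rule eq_vecI)
      fix i assume "i < dim_vec (0\<^sub>v ?N :: 'a vec)"
      then have i: "i < ?N" by simp
      then have "enumf X i \<in> X" using enumf_bij[OF X] by (auto simp: bij_betw_def)
      then show "(?F *\<^sub>v ?v) $ i = 0\<^sub>v ?N $ i"
        using fmat_mult_vec[OF X i, of M v] v(2) i by simp
    qed (simp add: fmat_def)
    moreover have "?v \<noteq> 0\<^sub>v ?N"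
    proof
      assume z: "?v = 0\<^sub>v ?N"
      have "\<forall>i<?N. v (enumf X i) = 0"
      proof (intro allI impI)
        fix i assume "i < ?N"
        then show "v (enumf X i) = 0" using arg_cong[OF z, of "\<lambda>u. u $ i"] by simp
      qed
      then show False using all_enumf[OF X, of "\<lambda>x. v x = 0"] v(1) by blast
    qed
    ultimately show "\<exists>v. v \<in> carrier_vec ?N \<and> v \<noteq> 0\<^sub>v ?N \<and> ?F *\<^sub>v v = 0\<^sub>v ?N"
      by (intro exI[of _ ?v]) auto
  qed
  finally show ?thesis .
qed

lemma fdet_mult:
  assumes "finite X"
  shows "fdet X (\<lambda>x z. \<Sum>y\<in>X. M x y * N y z) = fdet X M * fdet X N"
proof -
  have "fmat X (\<lambda>x z. \<Sum>y\<in>X. M x y * N y z) = fmat X M * fmat X N"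
    by (intro eq_matI) (auto simp: fmat_def scalar_prod_def sum_enumf[OF assms, symmetric] atLeast0LessThan)
  then show ?thesis unfolding fdet_def by (simp add: det_mult[of _ "card X"])
qed

lemma fdet_one:
  fixes M :: "'x \<Rightarrow> 'x \<Rightarrow> 'a :: comm_ring_1"
  assumes "finite X" "\<And>x y. x \<in> X \<Longrightarrow> y \<in> X \<Longrightarrow> M x y = (if x = y then 1 else 0)"
  shows "fdet X M = 1"
proof -
  have "fmat X M = 1\<^sub>m (card X)"
  proof (rule eq_matI)
    fix i j assume "i < dim_row (1\<^sub>m (card X) :: 'a mat)" "j < dim_col (1\<^sub>m (card X) :: 'a mat)"
    then show "fmat X M $$ (i, j) = 1\<^sub>m (card X) $$ (i, j)"
      using enumf_bij[OF assms(1)]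
      by (auto simp: fmat_def assms(2) bij_betwE) (auto simp: assms(2) bij_betw_def inj_on_def)
  qed (auto simp: fmat_def)
  then show ?thesis by (simp add: fdet_def)
qed

text \<open>Applied to the map from the integers to the field with three elements and to the map to
  the complex numbers, this carries a nonvanishing determinant from characteristic 3 to
  characteristic 0.\<close>

lemma fdet_of_int:
  "fdet X (\<lambda>x y. of_int (M x y) :: 'a :: comm_ring_1) = of_int (fdet X M)"
proof -
  interpret comm_ring_hom "of_int :: int \<Rightarrow> 'a" by unfold_locales auto
  have "fmat X (\<lambda>x y. of_int (M x y) :: 'a) = map_mat of_int (fmat X M)"
    by (intro eq_matI) (auto simp: fmat_def)
  then show ?thesis by (simp add: fdet_def)
qed

section \<open>Polynomial functions and square linear systems\<close>

lemma polyfun_sum: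
  assumes "\<And>s. s \<in> S \<Longrightarrow> f s \<in> polyfun J"
  shows "(\<lambda>x. \<Sum>s\<in>S. f s x) \<in> polyfun J"
  using assms by (induction S rule: infinite_finite_induct) (auto intro: polyfun.intros)

lemma polyfun_prod:
  assumes "\<And>s. s \<in> S \<Longrightarrow> f s \<in> polyfun J"
  shows "(\<lambda>x. \<Prod>s\<in>S. f s x) \<in> polyfun J"
  using assms by (induction S rule: infinite_finite_induct) (auto intro: polyfun.intros)

lemma polyfun_det:
  assumes "\<And>i j. i < N \<Longrightarrow> j < N \<Longrightarrow> (\<lambda>A. M A (i, j)) \<in> polyfun J"
  shows "(\<lambda>A. det (mat N N (M A))) \<in> polyfun J"
proof -
  have "(\<lambda>A. det (mat N N (M A)))
      = (\<lambda>A. \<Sum>p\<in>{p. p permutes {0..<N}}. signof p * (\<Prod>i=0..<N. M A (i, p i)))"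
    by (auto simp: det_def permutes_in_image intro!: sum.cong prod.cong ext)
  also have "\<dots> \<in> polyfun J"
    using assms by (intro polyfun_sum polyfun.intros polyfun_prod) (auto simp: permutes_in_image)
  finally show ?thesis .
qed

lemma polyfun_fdet:
  assumes "finite X" "\<And>x y. x \<in> X \<Longrightarrow> y \<in> X \<Longrightarrow> (\<lambda>A. M A x y) \<in> polyfun J"
  shows "(\<lambda>A. fdet X (M A)) \<in> polyfun J"
  unfolding fdet_def fmat_def
  by (rule polyfun_det) (use enumf_bij[OF assms(1)] in \<open>auto simp: bij_betw_def intro!: assms(2)\<close>)

text \<open>Preimages of the unit vectors form a right inverse; once \<open>Y\<close> is identified
  with \<open>X\<close>, multiplicativity of the determinant makes det L nonzero, so the kernel is
  trivial.\<close>

lemma square_surj_imp_inj: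
  fixes L :: "'y \<Rightarrow> 'x \<Rightarrow> 'a :: field"
  assumes fin: "finite X" "finite Y" and card: "card X = card Y"
    and sur: "\<And>w. \<exists>u. \<forall>y\<in>Y. (\<Sum>x\<in>X. L y x * u x) = w y"
    and z: "\<forall>y\<in>Y. (\<Sum>x\<in>X. L y x * v x) = 0" and x: "x \<in> X"
  shows "v x = 0"
proof -
  obtain h where h: "bij_betw h X Y" using finite_same_card_bij[OF fin card] by blast
  have "\<forall>y. \<exists>u. \<forall>y'\<in>Y. (\<Sum>x\<in>X. L y' x * u x) = (if y' = y then 1 else 0)"
    by (intro allI sur)
  then obtain R where R: "\<And>y y'. y' \<in> Y \<Longrightarrow> (\<Sum>x\<in>X. L y' x * R y x) = (if y' = y then 1 else 0)"
    by metis
  have "fdet X (\<lambda>x x'. \<Sum>x''\<in>X. L (h x) x'' * R (h x') x'') = 1"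
  proof (rule fdet_one[OF fin(1)])
    fix x y assume "x \<in> X" "y \<in> X"
    then have "h x \<in> Y" "(h x = h y) = (x = y)" using h by (auto simp: bij_betw_def inj_on_def)
    then show "(\<Sum>x''\<in>X. L (h x) x'' * R (h y) x'') = (if x = y then 1 else 0)" by (simp add: R)
  qed
  then have "fdet X (\<lambda>x x'. L (h x) x') \<noteq> 0"
    by (subst (asm) fdet_mult[OF fin(1), where N="\<lambda>y z. R (h z) y"]) auto
  moreover have "\<forall>x\<in>X. (\<Sum>y\<in>X. L (h x) y * v y) = 0"
    using z h by (auto simp: bij_betw_def)
  ultimately show ?thesis using x unfolding fdet_zero_iff[OF fin(1)] by blast
qed

lemma polyfun_line:
  assumes "f \<in> polyfun J"
  shows "\<exists>P :: complex poly. \<forall>T. f (\<lambda>i. x i + T * (y i - x i)) = poly P T"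
  using assms
proof induction
  case (const c)
  show ?case by (rule exI[of _ "[:c:]"]) simp
next
  case (coord i)
  show ?case by (rule exI[of _ "[:x i, y i - x i:]"]) simp
next
  case (add f g)
  then obtain P Q where "\<forall>T. f (\<lambda>i. x i + T * (y i - x i)) = poly P T"
     "\<forall>T. g (\<lambda>i. x i + T * (y i - x i)) = poly Q T" by blast
  then show ?case by (intro exI[of _ "P + Q"]) simp
next
  case (mult f g)
  then obtain P Q where "\<forall>T. f (\<lambda>i. x i + T * (y i - x i)) = poly P T"
     "\<forall>T. g (\<lambda>i. x i + T * (y i - x i)) = poly Q T" by blast
  then show ?case by (intro exI[of _ "P * Q"]) simp
qed

text \<open>Irreducibility of affine space. On the line through \<open>x\<close> (parameter 0) and
  \<open>y\<close> (parameter 1) both functions restrict to nonzero polynomials in one variable, and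
  so does their product.\<close>

lemma polyfun_nonzero_mult:
  assumes "f \<in> polyfun J" "g \<in> polyfun J" "x \<in> affine_space K" "f x \<noteq> 0" "y \<in> affine_space K" "g y \<noteq> 0"
  shows "\<exists>z\<in>affine_space K. f z * g z \<noteq> 0"
proof -
  obtain P where P: "\<forall>T. f (\<lambda>i. x i + T * (y i - x i)) = poly P T"
    using polyfun_line[OF assms(1)] by blast
  obtain Q where Q: "\<forall>T. g (\<lambda>i. x i + T * (y i - x i)) = poly Q T"
    using polyfun_line[OF assms(2)] by blast
  have "P \<noteq> 0" using spec[OF P, of 0] assms(4) by auto
  moreover have "Q \<noteq> 0" using spec[OF Q, of 1] assms(6) by auto
  ultimately have "P * Q \<noteq> 0" by simp
  then obtain T where "poly (P * Q) T \<noteq> 0" using poly_all_0_iff_0 by blast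
  moreover have "(\<lambda>i. x i + T * (y i - x i)) \<in> affine_space K"
    using assms by (auto simp: affine_space_def)
  ultimately show ?thesis using P Q by (intro bexI[of _ "\<lambda>i. x i + T * (y i - x i)"]) auto
qed

section \<open>Homogeneous polynomials by coefficients\<close>

definition exps :: "nat \<Rightarrow> int \<Rightarrow> (nat \<Rightarrow> int) set" where
  "exps n a = {e. (\<forall>i>n. e i = 0) \<and> (\<Sum>i\<le>n. e i) = a}"

definition mons :: "nat \<Rightarrow> int \<Rightarrow> (nat \<Rightarrow> int) set" where
  "mons n d = {e \<in> exps n d. \<forall>i. 0 \<le> e i}"

text \<open>Multiplication of a monomial by the variable with index \<open>i\<close>. Its inverse
  \<open>dn\<close> is total because exponents may be negative.\<close>

definition up :: "nat \<Rightarrow> (nat \<Rightarrow> int) \<Rightarrow> nat \<Rightarrow> int" where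
  "up i e = e(i := e i + 1)"

definition dn :: "nat \<Rightarrow> (nat \<Rightarrow> int) \<Rightarrow> nat \<Rightarrow> int" where
  "dn i e = e(i := e i - 1)"

lemma up_dn [simp]: "up i (dn i e) = e" "dn i (up i e) = e"
  by (auto simp: up_def dn_def)

lemma dn_dn: "dn i (dn j e) = dn j (dn i e)"
  by (auto simp: dn_def fun_eq_iff)

lemma up_inj [simp]: "up i e = up i e' \<longleftrightarrow> e = e'"
  by (metis up_dn)

lemma dn_eq_iff: "dn i e = e' \<longleftrightarrow> e = up i e'"
  by (metis up_dn)

lemma sum_up: "i \<le> n \<Longrightarrow> (\<Sum>y\<le>n. up i e y) = (\<Sum>y\<le>n. e y) + 1"
proof -
  assume i: "i \<le> n"
  have "(\<Sum>y\<le>n. up i e y) = (\<Sum>y\<le>n. e y + (if y = i then 1 else 0))"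
    by (rule sum.cong) (auto simp: up_def)
  then show ?thesis using i by (simp add: sum.distrib)
qed

lemma up_exps: "i \<le> n \<Longrightarrow> e \<in> exps n d \<Longrightarrow> up i e \<in> exps n (d + 1)"
  by (auto simp: exps_def sum_up) (simp add: up_def)

lemma dn_exps_iff: "i \<le> n \<Longrightarrow> dn i e \<in> exps n d \<longleftrightarrow> e \<in> exps n (d + 1)"
proof
  assume i: "i \<le> n"
  show "dn i e \<in> exps n d \<Longrightarrow> e \<in> exps n (d + 1)" using up_exps[OF i, of "dn i e" d] by simp
  assume "e \<in> exps n (d + 1)"
  then show "dn i e \<in> exps n d"
    using i sum_up[OF i, of "dn i e"] by (auto simp: exps_def) (simp add: dn_def)
qed

lemma up_mons: "i \<le> n \<Longrightarrow> e \<in> mons n d \<Longrightarrow> up i e \<in> mons n (d + 1)"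
  by (auto simp: mons_def up_exps) (auto simp: up_def)

lemma dn_mons: "i \<le> n \<Longrightarrow> dn i e \<in> mons n d \<Longrightarrow> e \<in> mons n (d + 1)"
  using up_mons[of i n "dn i e" d] by simp

lemma dn_mons_iff: "i \<le> n \<Longrightarrow> dn i e \<in> mons n d \<longleftrightarrow> e \<in> mons n (d + 1) \<and> e i > 0"
proof -
  assume i: "i \<le> n"
  have 1: "e i > 0" if "dn i e \<in> mons n d"
  proof -
    have "0 \<le> dn i e i" using that by (auto simp: mons_def)
    then show ?thesis by (simp add: dn_def)
  qed
  have 2: "dn i e \<in> mons n d" if "e \<in> mons n (d + 1)" "e i > 0"
    using that i by (auto simp: mons_def dn_exps_iff) (auto simp: dn_def)
  show ?thesis using 1 2 dn_mons[OF i] by blast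
qed

lemma mons_le:
  assumes "e \<in> mons n d" shows "e i \<le> d"
proof (cases "i \<le> n")
  case True
  have "e i \<le> (\<Sum>y\<le>n. e y)" using assms True by (intro member_le_sum) (auto simp: mons_def)
  then show ?thesis using assms by (simp add: mons_def exps_def)
next
  case False
  have "0 \<le> (\<Sum>y\<le>n. e y)" using assms by (intro sum_nonneg) (auto simp: mons_def)
  then show ?thesis using assms False by (simp add: mons_def exps_def)
qed

lemma mons_neg:
  assumes "d < 0" shows "mons n d = {}"
proof (rule equals0I)
  fix e assume e: "e \<in> mons n d"
  then have "0 \<le> e 0" by (simp add: mons_def)
  then show False using mons_le[OF e, of 0] assms by simp
qed

lemma finite_mons [simp]: "finite (mons n d)"
proof (rule finite_subset)
  show "mons n d \<subseteq> {e. \<forall>i. (i \<in> {..n} \<longrightarrow> e i \<in> {0..d}) \<and> (i \<notin> {..n} \<longrightarrow> e i = 0)}"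
    using mons_le[of _ n d] by (auto simp: mons_def exps_def)
  show "finite {e :: nat \<Rightarrow> int. \<forall>i. (i \<in> {..n} \<longrightarrow> e i \<in> {0..d}) \<and> (i \<notin> {..n} \<longrightarrow> e i = 0)}"
    by (rule finite_set_of_finite_funs) auto
qed

section \<open>Shadows: the monomials reached from a set by multiplying with one variable\<close>

definition upset :: "nat \<Rightarrow> (nat \<Rightarrow> int) set \<Rightarrow> (nat \<Rightarrow> int) set" where
  "upset n T = (\<Union>i\<le>n. up i ` T)"

lemma upset_mons: "T \<subseteq> mons n d \<Longrightarrow> upset n T \<subseteq> mons n (d + 1)"
  by (auto simp: upset_def intro!: up_mons)

text \<open>Double counting of the pairs (monomial of the shadow, variable leading back into
  \<open>T\<close>), each weighted by the exponent of that variable. A monomial of \<open>T\<close>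
  contributes the sum of its exponents, all raised by one. With these weights the bound
  \<open>d + 1\<close> per monomial of the shadow is sharp when \<open>T\<close> is everything,
  which unweighted counting would not give.\<close>

lemma upset_weight:
  assumes T: "T \<subseteq> mons n d"
  shows "(\<Sum>e\<in>upset n T. \<Sum>i\<le>n. if dn i e \<in> T then e i else 0) = (d + int n + 1) * int (card T)"
proof -
  have fT: "finite T" using T finite_subset[OF _ finite_mons] by blast
  have fW: "finite (upset n T)" using fT by (auto simp: upset_def)
  have "(\<Sum>e\<in>upset n T. \<Sum>i\<le>n. if dn i e \<in> T then e i else 0)
      = (\<Sum>i\<le>n. \<Sum>e\<in>upset n T. if dn i e \<in> T then e i else 0)" by (rule sum.swap)
  also have "\<dots> = (\<Sum>i\<le>n. \<Sum>e\<in>T. e i + 1)"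
  proof (rule sum.cong[OF refl])
    fix i assume i: "i \<in> {..n}"
    have "(\<Sum>e\<in>upset n T. if dn i e \<in> T then e i else 0) = sum (\<lambda>e. e i) {e \<in> upset n T. dn i e \<in> T}"
      using fW by (rule sum.inter_filter[symmetric])
    also have "{e \<in> upset n T. dn i e \<in> T} = up i ` T"
    proof (intro equalityI subsetI)
      fix e assume "e \<in> {e \<in> upset n T. dn i e \<in> T}"
      then show "e \<in> up i ` T" by (intro image_eqI[of _ _ "dn i e"]) auto
    next
      fix e assume "e \<in> up i ` T"
      then show "e \<in> {e \<in> upset n T. dn i e \<in> T}" using i by (auto simp: upset_def)
    qed
    also have "sum (\<lambda>e. e i) (up i ` T) = (\<Sum>e\<in>T. e i + 1)"
      by (subst sum.reindex) (simp_all add: inj_on_def, simp add: up_def)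
    finally show "(\<Sum>e\<in>upset n T. if dn i e \<in> T then e i else 0) = (\<Sum>e\<in>T. e i + 1)" .
  qed
  also have "\<dots> = (\<Sum>e\<in>T. \<Sum>i\<le>n. e i + 1)" by (rule sum.swap)
  also have "\<dots> = (\<Sum>e\<in>T. d + int n + 1)"
    using T by (intro sum.cong) (auto simp: sum.distrib mons_def exps_def)
  finally show ?thesis by simp
qed

lemma upset_weight_le:
  assumes e: "e \<in> mons n (d + 1)"
  shows "(\<Sum>i\<le>n. if dn i e \<in> T then e i else 0) \<le> d + 1"
proof -
  have "(\<Sum>i\<le>n. if dn i e \<in> T then e i else 0) \<le> (\<Sum>i\<le>n. e i)"
    using e by (intro sum_mono) (auto simp: mons_def)
  then show ?thesis using e by (simp add: mons_def exps_def)
qed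

lemma upset_mons_eq: "0 \<le> d \<Longrightarrow> upset n (mons n d) = mons n (d + 1)"
proof
  assume d: "0 \<le> d"
  show "upset n (mons n d) \<subseteq> mons n (d + 1)" by (rule upset_mons) simp
  show "mons n (d + 1) \<subseteq> upset n (mons n d)"
  proof
    fix e assume e: "e \<in> mons n (d + 1)"
    have "\<exists>i\<le>n. e i > 0"
    proof (rule ccontr)
      assume "\<not> (\<exists>i\<le>n. e i > 0)"
      then have "(\<Sum>i\<le>n. e i) \<le> 0" by (intro sum_nonpos) auto
      then show False using e d by (simp add: mons_def exps_def)
    qed
    then obtain i where "i \<le> n" "e i > 0" by blast
    then show "e \<in> upset n (mons n d)"
      using e by (auto simp: upset_def dn_mons_iff image_iff intro!: bexI[of _ i] bexI[of _ "dn i e"])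
  qed
qed

text \<open>The equality case of the weighted count gives the ratio of consecutive dimensions
  without binomial coefficients.\<close>

lemma card_mons_Suc:
  assumes "0 \<le> d"
  shows "(d + 1) * int (card (mons n (d + 1))) = (d + int n + 1) * int (card (mons n d))"
proof -
  have "(\<Sum>e\<in>mons n (d + 1). \<Sum>i\<le>n. if dn i e \<in> mons n d then e i else 0)
     = (\<Sum>e\<in>mons n (d + 1). d + 1)"
  proof (rule sum.cong[OF refl])
    fix e assume e: "e \<in> mons n (d + 1)"
    have "(\<Sum>i\<le>n. if dn i e \<in> mons n d then e i else 0) = (\<Sum>i\<le>n. e i)"
      using e by (intro sum.cong) (auto simp: dn_mons_iff not_less, auto simp: mons_def antisym)
    then show "(\<Sum>i\<le>n. if dn i e \<in> mons n d then e i else 0) = d + 1"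
      using e by (simp add: mons_def exps_def)
  qed
  then show ?thesis
    using upset_weight[of "mons n d" n d] by (simp add: upset_mons_eq[OF assms] algebra_simps)
qed

text \<open>A family \<open>u\<close> stands for the vector of polynomials with \<open>u j e\<close> the coefficient of \<open>x\<^sup>e\<close> in the \<open>j\<close>-th
  entry. Exponents are integers so that the same formula also serves for Laurent polynomials.\<close>

definition act :: "nat \<Rightarrow> nat \<Rightarrow> (nat \<times> nat \<times> nat \<Rightarrow> 'a) \<Rightarrow> (nat \<Rightarrow> (nat \<Rightarrow> int) \<Rightarrow> 'a)
    \<Rightarrow> nat \<Rightarrow> (nat \<Rightarrow> int) \<Rightarrow> 'a :: comm_ring_1" where
  "act n q A u k e = (\<Sum>j<q. \<Sum>i\<le>n. A (k, j, i) * u j (dn i e))"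

section \<open>Injectivity and surjectivity in a fixed degree\<close>

definition cvec :: "nat \<Rightarrow> nat \<Rightarrow> int \<Rightarrow> (nat \<Rightarrow> (nat \<Rightarrow> int) \<Rightarrow> 'a :: zero) set" where
  "cvec n q d = {u. \<forall>j e. u j e \<noteq> 0 \<longrightarrow> j < q \<and> e \<in> mons n d}"

definition inj_deg :: "nat \<Rightarrow> nat \<Rightarrow> nat \<Rightarrow> int \<Rightarrow> (nat \<times> nat \<times> nat \<Rightarrow> 'a :: comm_ring_1) \<Rightarrow> bool" where
  "inj_deg n q p d A \<longleftrightarrow>
     (\<forall>u\<in>cvec n q d. (\<forall>k<p. \<forall>e. act n q A u k e = 0) \<longrightarrow> (\<forall>j e. u j e = 0))"

text \<open>Only the first \<open>p\<close> components are compared, because \<open>act\<close> also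
  yields values from the rows of \<open>A\<close> beyond \<open>p\<close>.\<close>

definition in_image :: "nat \<Rightarrow> nat \<Rightarrow> nat \<Rightarrow> int \<Rightarrow> (nat \<times> nat \<times> nat \<Rightarrow> 'a :: comm_ring_1)
    \<Rightarrow> (nat \<Rightarrow> (nat \<Rightarrow> int) \<Rightarrow> 'a) \<Rightarrow> bool" where
  "in_image n q p d A w \<longleftrightarrow> (\<exists>u\<in>cvec n q d. \<forall>k<p. \<forall>e. act n q A u k e = w k e)"

definition sur_deg :: "nat \<Rightarrow> nat \<Rightarrow> nat \<Rightarrow> int \<Rightarrow> (nat \<times> nat \<times> nat \<Rightarrow> 'a :: comm_ring_1) \<Rightarrow> bool" where
  "sur_deg n q p d A \<longleftrightarrow> (\<forall>w\<in>cvec n p (d + 1). in_image n q p d A w)"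

lemma cvecD: "u \<in> cvec n q d \<Longrightarrow> \<not> (j < q \<and> e \<in> mons n d) \<Longrightarrow> u j e = 0"
  unfolding cvec_def by blast

lemma act_outside:
  assumes "u \<in> cvec n q d" "e \<notin> mons n (d + 1)"
  shows "act n q A u k e = 0"
  unfolding act_def
proof (intro sum.neutral ballI)
  fix j i assume "i \<in> {..n}"
  then have "dn i e \<notin> mons n d" using assms(2) dn_mons by blast
  then show "A (k, j, i) * u j (dn i e) = 0" using cvecD[OF assms(1)] by simp
qed

lemma act_sum: "act n q A (\<lambda>j e. \<Sum>s\<in>S. u s j e) k e = (\<Sum>s\<in>S. act n q A (u s) k e)"
proof -
  have "act n q A (\<lambda>j e. \<Sum>s\<in>S. u s j e) k e
      = (\<Sum>j<q. \<Sum>s\<in>S. \<Sum>i\<le>n. A (k, j, i) * u s j (dn i e))"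
    unfolding act_def sum_distrib_left by (intro sum.cong refl sum.swap)
  also have "\<dots> = (\<Sum>s\<in>S. act n q A (u s) k e)" unfolding act_def by (rule sum.swap)
  finally show ?thesis .
qed

lemma act_scale: "act n q A (\<lambda>j e. c * u j e) k e = c * act n q A u k e"
  by (simp add: act_def sum_distrib_left mult.left_commute)

lemma in_image_sum:
  assumes "\<And>s. s \<in> S \<Longrightarrow> in_image n q p d A (w s)"
  shows "in_image n q p d A (\<lambda>k e. \<Sum>s\<in>S. c s * w s k e)"
proof -
  from assms obtain u where u: "\<And>s. s \<in> S \<Longrightarrow> u s \<in> cvec n q d"
    "\<And>s k e. s \<in> S \<Longrightarrow> k < p \<Longrightarrow> act n q A (u s) k e = w s k e"
    unfolding in_image_def by metis
  have "(\<lambda>j e. \<Sum>s\<in>S. c s * u s j e) \<in> cvec n q d"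
    unfolding cvec_def
  proof (intro CollectI allI impI)
    fix j e assume "(\<Sum>s\<in>S. c s * u s j e) \<noteq> 0"
    then obtain s where "s \<in> S" "u s j e \<noteq> 0" by (metis (no_types, lifting) mult_zero_right sum.not_neutral_contains_not_neutral)
    then show "j < q \<and> e \<in> mons n d" using u(1)[of s] by (auto simp: cvec_def)
  qed
  moreover have "\<forall>k<p. \<forall>e. act n q A (\<lambda>j e. \<Sum>s\<in>S. c s * u s j e) k e = (\<Sum>s\<in>S. c s * w s k e)"
    by (auto simp: act_sum act_scale u intro!: sum.cong)
  ultimately show ?thesis unfolding in_image_def by blast
qed

lemma in_image_cong:
  assumes "\<And>k e. k < p \<Longrightarrow> w k e = w' k e"
  shows "in_image n q p d A w \<longleftrightarrow> in_image n q p d A w'"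
  using assms by (simp add: in_image_def)

definition unitv :: "nat \<Rightarrow> (nat \<Rightarrow> int) \<Rightarrow> nat \<Rightarrow> (nat \<Rightarrow> int) \<Rightarrow> 'a :: zero_neq_one" where
  "unitv k e k' e' = (if k' = k \<and> e' = e then 1 else 0)"

lemma cvec_expand:
  fixes w :: "nat \<Rightarrow> (nat \<Rightarrow> int) \<Rightarrow> 'a :: comm_ring_1"
  assumes "w \<in> cvec n p d"
  shows "w k e = (\<Sum>s\<in>{..<p} \<times> mons n d. w (fst s) (snd s) * unitv (fst s) (snd s) k e)"
proof -
  have "(\<Sum>s\<in>{..<p} \<times> mons n d. w (fst s) (snd s) * unitv (fst s) (snd s) k e)
     = (\<Sum>s\<in>{..<p} \<times> mons n d. if s = (k, e) then w k e else 0)"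
    by (rule sum.cong) (auto simp: unitv_def)
  also have "\<dots> = w k e" using cvecD[OF assms, of k e] by (auto simp: sum.delta)
  finally show ?thesis by simp
qed

lemma sur_deg_unitv:
  "sur_deg n q p d A \<longleftrightarrow> (\<forall>k<p. \<forall>e\<in>mons n (d + 1). in_image n q p d A (unitv k e))"
proof
  assume "sur_deg n q p d A"
  then show "\<forall>k<p. \<forall>e\<in>mons n (d + 1). in_image n q p d A (unitv k e)"
    unfolding sur_deg_def by (auto simp: cvec_def unitv_def)
next
  assume *: "\<forall>k<p. \<forall>e\<in>mons n (d + 1). in_image n q p d A (unitv k e)"
  show "sur_deg n q p d A"
    unfolding sur_deg_def
  proof
    fix w :: "nat \<Rightarrow> (nat \<Rightarrow> int) \<Rightarrow> 'a" assume w: "w \<in> cvec n p (d + 1)"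
    have "in_image n q p d A (\<lambda>k e. \<Sum>s\<in>{..<p} \<times> mons n (d + 1). w (fst s) (snd s) * unitv (fst s) (snd s) k e)"
      using * by (intro in_image_sum) auto
    then show "in_image n q p d A w"
      by (rule in_image_cong[THEN iffD1, rotated]) (rule cvec_expand[OF w, symmetric])
  qed
qed

lemma in_image_up:
  assumes "i \<le> n" "in_image n q p d A w"
  shows "in_image n q p (d + 1) A (\<lambda>k e. w k (dn i e))"
proof -
  obtain u where u: "u \<in> cvec n q d" "\<And>k e. k < p \<Longrightarrow> act n q A u k e = w k e"
    using assms(2) unfolding in_image_def by blast
  have "(\<lambda>j e. u j (dn i e)) \<in> cvec n q (d + 1)"
    using u(1) assms(1) dn_mons by (auto simp: cvec_def)
  moreover have "act n q A (\<lambda>j e. u j (dn i e)) k e = act n q A u k (dn i e)" for k e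
    by (simp add: act_def dn_dn[of i])
  ultimately show ?thesis unfolding in_image_def using u(2) by (intro bexI[of _ "\<lambda>j e. u j (dn i e)"]) auto
qed

text \<open>The target in the next degree is generated by the variables times the present target.
  This needs the present target degree to be nonnegative: constants are not multiples of
  variables.\<close>

lemma sur_deg_Suc:
  assumes "sur_deg n q p d A" "0 \<le> d + 1"
  shows "sur_deg n q p (d + 1) A"
  unfolding sur_deg_unitv
proof (intro allI impI ballI)
  fix k e assume k: "k < p" and e: "e \<in> mons n (d + 1 + 1)"
  then obtain i e' where i: "i \<le> n" "e' \<in> mons n (d + 1)" "e = up i e'"
    using upset_mons_eq[OF assms(2), of n] unfolding upset_def by blast
  have "(\<lambda>k' e''. unitv k e' k' (dn i e'')) = (unitv k e :: _ \<Rightarrow> _ \<Rightarrow> 'a)"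
    by (intro ext) (simp add: unitv_def i dn_eq_iff)
  moreover have "in_image n q p d A (unitv k e')" using assms(1) k i by (auto simp: sur_deg_unitv)
  ultimately show "in_image n q p (d + 1) A (unitv k e)" using in_image_up[OF i(1)] by metis
qed

text \<open>Multiplying a kernel vector by the variable with index 0 gives a kernel vector one
  degree higher, and loses nothing.\<close>

lemma inj_deg_pred:
  assumes "inj_deg n q p (d + 1) A"
  shows "inj_deg n q p d A"
  unfolding inj_deg_def
proof (intro ballI impI allI)
  fix u j e assume u: "u \<in> cvec n q d" and z: "\<forall>k<p. \<forall>e. act n q A u k e = 0"
  have "(\<lambda>j e. u j (dn 0 e)) \<in> cvec n q (d + 1)"
    using u dn_mons[of 0 n] by (auto simp: cvec_def)
  moreover have "act n q A (\<lambda>j e. u j (dn 0 e)) k e = act n q A u k (dn 0 e)" for k e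
    by (simp add: act_def dn_dn[of 0])
  ultimately have "\<And>j e. u j (dn 0 e) = 0"
    using assms z unfolding inj_deg_def by auto
  from this[of j "up 0 e"] show "u j e = 0" by simp
qed

lemma inj_deg_neg: "d < 0 \<Longrightarrow> inj_deg n q p d A"
  by (auto simp: inj_deg_def cvec_def mons_neg)

lemma inj_deg_mono:
  assumes "inj_deg n q p d A" "d' \<le> d"
  shows "inj_deg n q p d' A"
  using assms(2,1) by (induction d' rule: int_le_induct) (auto intro: inj_deg_pred)

lemma sur_deg_mono:
  assumes "sur_deg n q p d A" "0 \<le> d + 1" "d \<le> d'"
  shows "sur_deg n q p d' A"
  using assms(3) assms(1,2) by (induction d' rule: int_ge_induct) (auto intro: sur_deg_Suc)

section \<open>Changing the size: columns and block sums\<close>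

lemma act_mono_cols:
  assumes "u \<in> cvec n q d" "q \<le> q'"
  shows "act n q' A u k e = act n q A u k e"
  unfolding act_def using assms(2)
  by (intro sum.mono_neutral_right) (auto simp: cvecD[OF assms(1)])

lemma cvec_mono: "q \<le> q' \<Longrightarrow> cvec n q d \<subseteq> cvec n q' d"
  unfolding cvec_def using order_less_le_trans by blast

lemma inj_deg_cols:
  assumes "inj_deg n q' p d A" "q \<le> q'"
  shows "inj_deg n q p d A"
  using assms cvec_mono[OF assms(2)] unfolding inj_deg_def by (metis act_mono_cols subsetD)

lemma sur_deg_cols:
  assumes "sur_deg n q p d A" "q \<le> q'"
  shows "sur_deg n q' p d A"
  using assms cvec_mono[OF assms(2)] unfolding sur_deg_def in_image_def by (metis act_mono_cols subsetD)

lemma cvec_shift: "u \<in> cvec n (q + q') d \<Longrightarrow> (\<lambda>j. u (q + j)) \<in> cvec n q' d"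
  unfolding cvec_def by (intro CollectI allI impI) (drule CollectD, fastforce)

definition block :: "nat \<Rightarrow> nat \<Rightarrow> (nat \<times> nat \<times> nat \<Rightarrow> 'a) \<Rightarrow> (nat \<times> nat \<times> nat \<Rightarrow> 'a) \<Rightarrow> nat \<times> nat \<times> nat \<Rightarrow> 'a :: zero" where
  "block q p A B = (\<lambda>(k, j, i). if k < p then (if j < q then A (k, j, i) else 0)
      else (if j < q then 0 else B (k - p, j - q, i)))"

lemma sum_lessThan_add: "(\<Sum>j<q + q'. f j) = (\<Sum>j<q. f j) + (\<Sum>j<q'. f (q + j))"
  for f :: "nat \<Rightarrow> 'a :: comm_monoid_add"
  by (induction q') (auto simp: add.assoc)

lemma act_block:
  "k < p \<Longrightarrow> act n (q + q') (block q p A B) u k e = act n q A u k e"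
  "act n (q + q') (block q p A B) u (p + k) e = act n q' B (\<lambda>j. u (q + j)) k e"
  by (auto simp: act_def sum_lessThan_add block_def)

lemma inj_deg_block:
  assumes "inj_deg n q p d A" "inj_deg n q' p' d B"
  shows "inj_deg n (q + q') (p + p') d (block q p A B)"
  unfolding inj_deg_def
proof (intro ballI impI allI)
  fix u j e assume u: "u \<in> cvec n (q + q') d"
    and z: "\<forall>k<p + p'. \<forall>e. act n (q + q') (block q p A B) u k e = 0"
  let ?u1 = "\<lambda>j e. if j < q then u j e else 0"
  have "?u1 \<in> cvec n q d" using u by (auto simp: cvec_def)
  moreover have "act n q A ?u1 k e = 0" if "k < p" for k e
  proof -
    have "act n q A ?u1 k e = act n q A u k e" by (simp add: act_def)
    then show ?thesis using z that act_block(1)[OF that, of n q q' A B u e] by auto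
  qed
  ultimately have 1: "?u1 j e = 0" using assms(1) unfolding inj_deg_def by blast
  have "(\<lambda>j. u (q + j)) \<in> cvec n q' d"
    by (rule cvec_shift[OF u])
  moreover have "act n q' B (\<lambda>j. u (q + j)) k e = 0" if "k < p'" for k e
    using z that act_block(2)[of n q q' p A B u k e] by auto
  ultimately have "u (q + (j - q)) e = 0" using assms(2) unfolding inj_deg_def by blast
  then show "u j e = 0" using 1 by (cases "j < q") auto
qed

lemma sur_deg_block:
  assumes "sur_deg n q p d A" "sur_deg n q' p' d B"
  shows "sur_deg n (q + q') (p + p') d (block q p A B)"
  unfolding sur_deg_def
proof
  fix w :: "nat \<Rightarrow> (nat \<Rightarrow> int) \<Rightarrow> 'a" assume w: "w \<in> cvec n (p + p') (d + 1)"
  have "(\<lambda>k e. if k < p then w k e else 0) \<in> cvec n p (d + 1)" using w by (auto simp: cvec_def)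
  then have "in_image n q p d A (\<lambda>k e. if k < p then w k e else 0)"
    using assms(1) unfolding sur_deg_def by blast
  then obtain u where u: "u \<in> cvec n q d" "\<And>k e. k < p \<Longrightarrow> act n q A u k e = w k e"
    unfolding in_image_def by auto
  have "(\<lambda>k. w (p + k)) \<in> cvec n p' (d + 1)"
    by (rule cvec_shift[OF w])
  then have "in_image n q' p' d B (\<lambda>k. w (p + k))"
    using assms(2) unfolding sur_deg_def by blast
  then obtain v where v: "v \<in> cvec n q' d" "\<And>k e. k < p' \<Longrightarrow> act n q' B v k e = w (p + k) e"
    unfolding in_image_def by auto
  let ?u = "\<lambda>j. if j < q then u j else v (j - q)"
  have "?u \<in> cvec n (q + q') d"
    unfolding cvec_def
  proof (intro CollectI allI impI)
    fix j e assume nz: "?u j e \<noteq> 0"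
    show "j < q + q' \<and> e \<in> mons n d"
    proof (cases "j < q")
      case True
      then show ?thesis using nz cvecD[OF u(1), of j e] by auto
    next
      case False
      then have "j - q < q' \<and> e \<in> mons n d" using nz cvecD[OF v(1), of "j - q" e] by auto
      then show ?thesis by auto
    qed
  qed
  moreover have "\<forall>k<p + p'. \<forall>e. act n (q + q') (block q p A B) ?u k e = w k e"
  proof (intro allI impI)
    fix k e assume k: "k < p + p'"
    show "act n (q + q') (block q p A B) ?u k e = w k e"
    proof (cases "k < p")
      case True
      have "act n q A ?u k e = act n q A u k e" by (simp add: act_def)
      then show ?thesis using True u(2) by (simp add: act_block)
    next
      case False
      then obtain k' where k': "k = p + k'" by (metis le_iff_add linorder_not_less)
      then show ?thesis using k v(2)[of k' e] by (simp add: act_block)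
    qed
  qed
  ultimately show "in_image n (q + q') (p + p') d (block q p A B) w" unfolding in_image_def by blast
qed

text \<open>One variable times the identity matrix. As a block it adds equally many rows and columns
  and keeps injectivity in every degree, so it serves as padding.\<close>

lemma inj_deg_diag:
  "inj_deg n p p d (\<lambda>(k, j, i). if j = k \<and> i = 0 then 1 else 0)"
  unfolding inj_deg_def
proof (intro ballI impI allI)
  fix u :: "nat \<Rightarrow> (nat \<Rightarrow> int) \<Rightarrow> 'a" and j e
  let ?A = "\<lambda>(k, j, i). if j = k \<and> i = 0 then 1 else 0 :: 'a"
  assume u: "u \<in> cvec n p d" and z: "\<forall>k<p. \<forall>e. act n p ?A u k e = 0"
  have *: "act n p ?A u k e = u k (dn 0 e)" if "k < p" for k e
  proof -
    have "act n p ?A u k e = (\<Sum>j<p. \<Sum>i\<le>n. if i = 0 then (if j = k then u j (dn 0 e) else 0) else 0)"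
      unfolding act_def by (intro sum.cong) auto
    also have "\<dots> = u k (dn 0 e)" using that by (simp add: sum.delta)
    finally show ?thesis .
  qed
  show "u j e = 0"
  proof (cases "j < p")
    case True
    then show ?thesis using z *[OF True, of "up 0 e"] by auto
  next
    case False
    then show ?thesis using cvecD[OF u] by blast
  qed
qed

text \<open>The matrix of the graded map in the monomial bases, with row \<open>y\<close> and column
  \<open>x\<close>. For given \<open>x\<close> and \<open>y\<close> at most one \<open>i\<close>
  contributes to the sum.\<close>

definition lmat :: "nat \<Rightarrow> (nat \<times> nat \<times> nat \<Rightarrow> 'a) \<Rightarrow> nat \<times> (nat \<Rightarrow> int) \<Rightarrow> nat \<times> (nat \<Rightarrow> int) \<Rightarrow> 'a :: comm_ring_1" where
  "lmat n A y x = (\<Sum>i\<le>n. if snd x = dn i (snd y) then A (fst y, fst x, i) else 0)"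

lemma sum_Times: "(\<Sum>x\<in>X \<times> Y. f x) = (\<Sum>a\<in>X. \<Sum>b\<in>Y. f (a, b))"
  by (simp add: sum.cartesian_product)

lemma act_lmat:
  assumes "u \<in> cvec n q d"
  shows "act n q A u k e = (\<Sum>x\<in>{..<q} \<times> mons n d. lmat n A (k, e) x * u (fst x) (snd x))"
proof -
  have "(\<Sum>x\<in>{..<q} \<times> mons n d. lmat n A (k, e) x * u (fst x) (snd x))
      = (\<Sum>j<q. \<Sum>e'\<in>mons n d. \<Sum>i\<le>n. if e' = dn i e then A (k, j, i) * u j e' else 0)"
    by (simp add: sum_Times lmat_def sum_distrib_right if_distrib if_distribR cong: if_cong)
  also have "\<dots> = (\<Sum>j<q. \<Sum>i\<le>n. \<Sum>e'\<in>mons n d. if e' = dn i e then A (k, j, i) * u j e' else 0)"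
    by (intro sum.cong refl sum.swap)
  also have "\<dots> = act n q A u k e"
    unfolding act_def by (intro sum.cong refl) (auto simp: sum.delta cvecD[OF assms])
  finally show ?thesis by simp
qed

definition as_cvec :: "nat \<Rightarrow> nat \<Rightarrow> int \<Rightarrow> (nat \<times> (nat \<Rightarrow> int) \<Rightarrow> 'a) \<Rightarrow> nat \<Rightarrow> (nat \<Rightarrow> int) \<Rightarrow> 'a :: zero" where
  "as_cvec n q d v j e = (if j < q \<and> e \<in> mons n d then v (j, e) else 0)"

lemma as_cvec: "as_cvec n q d v \<in> cvec n q d"
  by (auto simp: as_cvec_def cvec_def)

lemma act_as_cvec:
  "act n q A (as_cvec n q d v) k e = (\<Sum>x\<in>{..<q} \<times> mons n d. lmat n A (k, e) x * v x)"
  by (subst act_lmat[OF as_cvec]) (auto simp: as_cvec_def intro!: sum.cong)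

lemma inj_deg_lmat:
  "inj_deg n q p d A \<longleftrightarrow> (\<forall>v. (\<forall>y\<in>{..<p} \<times> mons n (d + 1). (\<Sum>x\<in>{..<q} \<times> mons n d. lmat n A y x * v x) = 0)
     \<longrightarrow> (\<forall>x\<in>{..<q} \<times> mons n d. v x = 0))" (is "_ \<longleftrightarrow> ?R")
proof
  assume inj: "inj_deg n q p d A"
  show ?R
  proof (intro allI impI ballI)
    fix v x assume z: "\<forall>y\<in>{..<p} \<times> mons n (d + 1). (\<Sum>x\<in>{..<q} \<times> mons n d. lmat n A y x * v x) = 0"
      and x: "x \<in> {..<q} \<times> mons n d"
    have "\<forall>k<p. \<forall>e. act n q A (as_cvec n q d v) k e = 0"
    proof (intro allI impI)
      fix k e assume "k < p"
      then show "act n q A (as_cvec n q d v) k e = 0"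
        using act_outside[OF as_cvec, of e n d q A v k] z
        by (cases "e \<in> mons n (d + 1)") (simp_all add: act_as_cvec)
    qed
    then have "\<forall>j e. as_cvec n q d v j e = 0" using inj as_cvec unfolding inj_deg_def by blast
    then show "v x = 0" using x by (auto simp: as_cvec_def split: if_splits)
  qed
next
  assume R: ?R
  show "inj_deg n q p d A" unfolding inj_deg_def
  proof (intro ballI impI allI)
    fix u j e assume u: "u \<in> cvec n q d" and z: "\<forall>k<p. \<forall>e. act n q A u k e = 0"
    have "\<forall>x\<in>{..<q} \<times> mons n d. u (fst x) (snd x) = 0"
      using z R[rule_format, of "\<lambda>x. u (fst x) (snd x)"] by (auto simp: act_lmat[OF u])
    then show "u j e = 0" using cvecD[OF u, of j e] by auto
  qed
qed

lemma sur_deg_lmat: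
  "sur_deg n q p d A \<longleftrightarrow> (\<forall>w. \<exists>v. \<forall>y\<in>{..<p} \<times> mons n (d + 1). (\<Sum>x\<in>{..<q} \<times> mons n d. lmat n A y x * v x) = w y)"
  (is "_ \<longleftrightarrow> ?R")
proof
  assume sur: "sur_deg n q p d A"
  show ?R
  proof
    fix w
    obtain u where u: "u \<in> cvec n q d" "\<forall>k<p. \<forall>e. act n q A u k e = as_cvec n p (d + 1) w k e"
      using sur as_cvec unfolding sur_deg_def in_image_def by blast
    then show "\<exists>v. \<forall>y\<in>{..<p} \<times> mons n (d + 1). (\<Sum>x\<in>{..<q} \<times> mons n d. lmat n A y x * v x) = w y"
      by (intro exI[of _ "\<lambda>x. u (fst x) (snd x)"]) (auto simp: act_lmat[OF u(1), symmetric] as_cvec_def)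
  qed
next
  assume R: ?R
  show "sur_deg n q p d A" unfolding sur_deg_def in_image_def
  proof
    fix w :: "nat \<Rightarrow> (nat \<Rightarrow> int) \<Rightarrow> 'a" assume w: "w \<in> cvec n p (d + 1)"
    obtain v where v: "\<forall>y\<in>{..<p} \<times> mons n (d + 1). (\<Sum>x\<in>{..<q} \<times> mons n d. lmat n A y x * v x) = w (fst y) (snd y)"
      using R[rule_format, of "\<lambda>y. w (fst y) (snd y)"] by blast
    have "act n q A (as_cvec n q d v) k e = w k e" if "k < p" for k e
    proof (cases "e \<in> mons n (d + 1)")
      case True
      then show ?thesis using v that by (auto simp: act_as_cvec)
    next
      case False
      then show ?thesis using act_outside[OF as_cvec] cvecD[OF w] by metis
    qed
    then show "\<exists>u\<in>cvec n q d. \<forall>k<p. \<forall>e. act n q A u k e = w k e" using as_cvec by blast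
  qed
qed

lemma square_sur_imp_inj_deg:
  fixes A :: "nat \<times> nat \<times> nat \<Rightarrow> 'a :: field"
  assumes "sur_deg n q p d A" "q * card (mons n d) = p * card (mons n (d + 1))"
  shows "inj_deg n q p d A"
  unfolding inj_deg_lmat
proof (intro allI impI ballI)
  fix v x assume "\<forall>y\<in>{..<p} \<times> mons n (d + 1). (\<Sum>x\<in>{..<q} \<times> mons n d. lmat n A y x * v x) = 0"
     "x \<in> {..<q} \<times> mons n d"
  then show "v x = 0"
    using assms by (intro square_surj_imp_inj[of "{..<q} \<times> mons n d" "{..<p} \<times> mons n (d + 1)" "lmat n A"])
      (auto simp: sur_deg_lmat card_cartesian_product)
qed

section \<open>Toeplitz matrices and open conditions\<close>

definition toep :: "nat \<times> nat \<times> nat \<Rightarrow> 'a :: zero_neq_one" where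
  "toep = (\<lambda>(k, j, i). if j = k + i then 1 else 0)"

text \<open>Read as a relation in the cokernel: column \<open>j\<close> times a monomial puts one
  term on each row \<open>j - i\<close>, multiplied by the variable with index \<open>i\<close>.
  Terms on rows beyond \<open>p\<close> vanish because \<open>k' < p\<close>.\<close>

lemma act_toep_unitv:
  assumes "k' < p" "j < n + p"
  shows "act n (n + p) toep (unitv j e) k' e' = (\<Sum>i\<in>{i. i \<le> n \<and> i \<le> j}. unitv (j - i) (up i e) k' e' :: 'a :: comm_ring_1)"
proof -
  have "act n (n + p) toep (unitv j e) k' e'
      = (\<Sum>i\<le>n. \<Sum>j'<n + p. if j' = k' + i then unitv j e j' (dn i e') else 0 :: 'a)"
    unfolding act_def by (subst sum.swap) (auto simp: toep_def intro!: sum.cong)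
  also have "\<dots> = (\<Sum>i\<le>n. unitv j e (k' + i) (dn i e'))"
    using assms by (intro sum.cong) (auto simp: sum.delta)
  also have "\<dots> = (\<Sum>i\<le>n. if i \<le> j then unitv (j - i) (up i e) k' e' else 0)"
    by (intro sum.cong) (auto simp: unitv_def dn_eq_iff)
  also have "\<dots> = (\<Sum>i\<in>{i. i \<le> n \<and> i \<le> j}. unitv (j - i) (up i e) k' e')"
    by (simp add: sum.inter_filter[symmetric])
  finally show ?thesis .
qed

definition partial_deg :: "(nat \<Rightarrow> int) \<Rightarrow> nat \<Rightarrow> int" where
  "partial_deg e x = (\<Sum>y\<le>x. e y)"

text \<open>In the relation attached to column \<open>j\<close> and a monomial of degree \<open>p - 1\<close> exactly one term has
  minimal potential; solving for it gives the straightening behind Dedekind--Mertens.\<close>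

definition toep_potential :: "nat \<Rightarrow> int \<Rightarrow> int \<Rightarrow> (nat \<Rightarrow> int) \<Rightarrow> int" where
  "toep_potential n p k e = (\<Sum>x<n. partial_deg e x * (p - partial_deg e x)) + k\<^sup>2 - (p - 1) * k"

lemma partial_deg_up: "partial_deg (up i e) x = partial_deg e x + (if i \<le> x then 1 else 0)"
proof (cases "i \<le> x")
  case True
  then show ?thesis by (simp add: partial_deg_def sum_up)
next
  case False
  then have "(\<Sum>y\<le>x. up i e y) = (\<Sum>y\<le>x. e y)" by (intro sum.cong) (auto simp: up_def)
  then show ?thesis using False by (simp add: partial_deg_def)
qed

lemma partial_deg_dn: "partial_deg (dn i e) x = partial_deg e x - (if i \<le> x then 1 else 0)"
  using partial_deg_up[of i "dn i e" x] by simp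

lemma partial_deg_mono: "(\<And>y. 0 \<le> e y) \<Longrightarrow> x \<le> x' \<Longrightarrow> partial_deg e x \<le> partial_deg e x'"
  unfolding partial_deg_def by (rule sum_mono2) auto

text \<open>Replacing the factor with index \<open>i0\<close> by the one with index \<open>i\<close>
  shifts the partial degrees strictly between the two cut positions by one, and shifts the row by
  the distance t in the opposite direction. The bounds by \<open>k\<close> and \<open>k + 1\<close>
  estimate the change of the products from below; the terms linear in t cancel against those of the
  quadratic in \<open>k\<close>, and at least t squared remains.\<close>

lemma toep_potential_less:
  fixes e :: "nat \<Rightarrow> int"
  assumes lo: "\<And>x. x < i0 \<Longrightarrow> partial_deg e x \<le> k"
    and hi: "\<And>x. i0 \<le> x \<Longrightarrow> k + 1 \<le> partial_deg e x"
    and i: "i \<le> n" "i \<noteq> i0" "i0 \<le> n"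
  shows "toep_potential n p k e < toep_potential n p (k + int i0 - int i) (up i (dn i0 e))"
proof -
  define F where "F = (\<Sum>x<n. partial_deg e x * (p - partial_deg e x))"
  define F' where "F' = (\<Sum>x<n. partial_deg (up i (dn i0 e)) x * (p - partial_deg (up i (dn i0 e)) x))"
  show ?thesis
  proof (cases "i0 < i")
    case True
    let ?t = "int i - int i0"
    have "(\<Sum>x<n. if i0 \<le> x \<and> x < i then 2 * k + 1 - p else 0)
        \<le> (\<Sum>x<n. partial_deg (up i (dn i0 e)) x * (p - partial_deg (up i (dn i0 e)) x)
              - partial_deg e x * (p - partial_deg e x))"
    proof (rule sum_mono)
      fix x
      show "(if i0 \<le> x \<and> x < i then 2 * k + 1 - p else 0)
        \<le> partial_deg (up i (dn i0 e)) x * (p - partial_deg (up i (dn i0 e)) x)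
              - partial_deg e x * (p - partial_deg e x)"
        using hi[of x] True by (auto simp: partial_deg_up partial_deg_dn algebra_simps)
    qed
    moreover have "(\<Sum>x<n. if i0 \<le> x \<and> x < i then 2 * k + 1 - p else 0) = ?t * (2 * k + 1 - p)"
    proof -
      have "(\<Sum>x<n. if i0 \<le> x \<and> x < i then 2 * k + 1 - p else 0) = (\<Sum>x\<in>{i0..<i}. 2 * k + 1 - p)"
        using i by (intro sum.mono_neutral_cong_right) auto
      then show ?thesis using True by simp
    qed
    moreover have "0 < ?t\<^sup>2" using True by simp
    ultimately show ?thesis
      unfolding sum_subtractf toep_potential_def F_def[symmetric] F'_def[symmetric]
      by (simp add: power2_eq_square algebra_simps)
  next
    case False
    then have i': "i < i0" using i by simp
    let ?t = "int i0 - int i"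
    have "(\<Sum>x<n. if i \<le> x \<and> x < i0 then p - 2 * k - 1 else 0)
        \<le> (\<Sum>x<n. partial_deg (up i (dn i0 e)) x * (p - partial_deg (up i (dn i0 e)) x)
              - partial_deg e x * (p - partial_deg e x))"
    proof (rule sum_mono)
      fix x
      show "(if i \<le> x \<and> x < i0 then p - 2 * k - 1 else 0)
        \<le> partial_deg (up i (dn i0 e)) x * (p - partial_deg (up i (dn i0 e)) x)
              - partial_deg e x * (p - partial_deg e x)"
        using lo[of x] i' by (auto simp: partial_deg_up partial_deg_dn algebra_simps)
    qed
    moreover have "(\<Sum>x<n. if i \<le> x \<and> x < i0 then p - 2 * k - 1 else 0) = ?t * (p - 2 * k - 1)"
    proof -
      have "(\<Sum>x<n. if i \<le> x \<and> x < i0 then p - 2 * k - 1 else 0) = (\<Sum>x\<in>{i..<i0}. p - 2 * k - 1)"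
        using i by (intro sum.mono_neutral_cong_right) auto
      then show ?thesis using i' by simp
    qed
    moreover have "0 < ?t\<^sup>2" using i' by simp
    ultimately show ?thesis
      unfolding sum_subtractf toep_potential_def F_def[symmetric] F'_def[symmetric]
      by (simp add: power2_eq_square algebra_simps)
  qed
qed

text \<open>Write the monomial as a product of \<open>p\<close> variables in increasing order of
  index and count the factors from 0: \<open>i0\<close> is the index of factor number
  \<open>k\<close>. It exists because \<open>k\<close> is less than the degree.\<close>

lemma split_index:
  assumes e: "e \<in> mons n (int p)" and k: "k < p"
  obtains i0 where "i0 \<le> n" "dn i0 e \<in> mons n (int p - 1)"
    "\<And>x. x < i0 \<Longrightarrow> partial_deg e x \<le> int k" "\<And>x. i0 \<le> x \<Longrightarrow> int k + 1 \<le> partial_deg e x"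
proof -
  define i0 where "i0 = (LEAST x. int k < partial_deg e x)"
  have n: "int k < partial_deg e n" using e k by (simp add: partial_deg_def mons_def exps_def)
  have nn: "\<And>y. 0 \<le> e y" using e by (simp add: mons_def)
  have i0: "int k < partial_deg e i0" unfolding i0_def by (rule LeastI) (rule n)
  have lo: "partial_deg e x \<le> int k" if "x < i0" for x
    using not_less_Least[of x "\<lambda>x. int k < partial_deg e x"] that unfolding i0_def by auto
  have hi: "int k + 1 \<le> partial_deg e x" if "i0 \<le> x" for x
    using partial_deg_mono[of e, OF nn that] i0 by simp
  have i0n: "i0 \<le> n" unfolding i0_def by (rule Least_le) (rule n)
  have "e i0 > 0"
  proof (cases i0)
    case 0
    then show ?thesis using i0 by (simp add: partial_deg_def)
  next
    case (Suc m)
    then have "partial_deg e i0 = partial_deg e m + e i0" by (simp add: partial_deg_def)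
    then show ?thesis using lo[of m] i0 Suc by simp
  qed
  then have "dn i0 e \<in> mons n (int p - 1)" using e i0n by (simp add: dn_mons_iff)
  then show ?thesis using that i0n lo hi by blast
qed

text \<open>The relation of column \<open>k + i0\<close> and the monomial without its factor
  \<open>i0\<close> contains the wanted basis vector, and all its other terms have larger potential.
  Potentials are bounded on the finite set of basis vectors, so induction on the distance to the
  maximum ends.\<close>

lemma toep_in_image:
  assumes "k < p" "e \<in> mons n (int p)"
  shows "in_image n (n + p) p (int p - 1) (toep :: _ \<Rightarrow> 'a :: comm_ring_1) (unitv k e)"
proof -
  define B where "B = Max ((\<lambda>(k, e). toep_potential n (int p) (int k) e) ` ({..<p} \<times> mons n (int p)))"
  have B: "toep_potential n (int p) (int k) e \<le> B" if "k < p" "e \<in> mons n (int p)" for k e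
    unfolding B_def using that by (intro Max_ge) auto
  show ?thesis using assms
  proof (induction "nat (B - toep_potential n (int p) (int k) e)" arbitrary: k e rule: less_induct)
    case less
    note k = less.prems(1) and e = less.prems(2)
    obtain i0 where i0: "i0 \<le> n" "dn i0 e \<in> mons n (int p - 1)"
      "\<And>x. x < i0 \<Longrightarrow> partial_deg e x \<le> int k" "\<And>x. i0 \<le> x \<Longrightarrow> int k + 1 \<le> partial_deg e x"
      using split_index[OF e k] by blast
    let ?j = "k + i0"
    let ?I = "{i. i \<le> n \<and> i \<le> ?j}"
    let ?I' = "{i. i \<le> n \<and> i \<le> ?j \<and> i \<noteq> i0 \<and> ?j - i < p}"
    let ?e = "dn i0 e"
    have others: "in_image n (n + p) p (int p - 1) (toep :: _ \<Rightarrow> 'a) (unitv (?j - i) (up i ?e))" if i: "i \<in> ?I'" for i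
    proof (rule less.hyps)
      show kk: "?j - i < p" using i by auto
      show ee: "up i ?e \<in> mons n (int p)" using up_mons[of i n ?e "int p - 1"] i i0(2) by auto
      have "int (?j - i) = int k + int i0 - int i" using i by auto
      then have "toep_potential n (int p) (int k) e < toep_potential n (int p) (int (?j - i)) (up i ?e)"
        using toep_potential_less[of i0 e "int k" i n "int p"] i i0 by auto
      then show "nat (B - toep_potential n (int p) (int (?j - i)) (up i ?e)) < nat (B - toep_potential n (int p) (int k) e)"
        using B[OF kk ee] by auto
    qed
    have rel: "in_image n (n + p) p (int p - 1) (toep :: _ \<Rightarrow> 'a) (act n (n + p) toep (unitv ?j ?e))"
      unfolding in_image_def
    proof (intro bexI[of _ "unitv ?j ?e"])
      show "(unitv ?j ?e :: _ \<Rightarrow> _ \<Rightarrow> 'a) \<in> cvec n (n + p) (int p - 1)"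
        using i0 k by (auto simp: cvec_def unitv_def)
    qed auto
    \<comment> \<open>One linear combination packs the relation, at \<open>None\<close> with
      coefficient 1, together with the terms already known to be in the image, with coefficient
      -1.\<close>
    let ?w = "\<lambda>s. case s of None \<Rightarrow> act n (n + p) toep (unitv ?j ?e) | Some i \<Rightarrow> (unitv (?j - i) (up i ?e) :: _ \<Rightarrow> _ \<Rightarrow> 'a)"
    let ?c = "\<lambda>s. case s of None \<Rightarrow> 1 | Some (i :: nat) \<Rightarrow> (- 1 :: 'a)"
    have "in_image n (n + p) p (int p - 1) (toep :: _ \<Rightarrow> 'a)
      (\<lambda>k' e'. \<Sum>s\<in>insert None (Some ` ?I'). ?c s * ?w s k' e')"
      using rel others by (intro in_image_sum) auto
    moreover have "(\<Sum>s\<in>insert None (Some ` ?I'). ?c s * ?w s k' e') = unitv k e k' e'" if k': "k' < p" for k' e'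
    proof -
      have fin: "finite ?I'" by auto
      have "(\<Sum>s\<in>insert None (Some ` ?I'). ?c s * ?w s k' e')
        = act n (n + p) toep (unitv ?j ?e) k' e' - (\<Sum>i\<in>?I'. unitv (?j - i) (up i ?e) k' e')"
        using fin by (subst sum.insert) (auto simp: sum.reindex sum_negf)
      also have "act n (n + p) toep (unitv ?j ?e) k' e' = (\<Sum>i\<in>?I. unitv (?j - i) (up i ?e) k' e')"
        using k i0(1) by (intro act_toep_unitv[OF k']) auto
      \<comment> \<open>Terms with \<open>?j - i\<close> at least \<open>p\<close> belong to no row
        of the matrix and vanish at \<open>k'\<close>, so only the indices treated by induction and
        \<open>i0\<close> survive.\<close>
      also have "\<dots> = (\<Sum>i\<in>insert i0 ?I'. unitv (?j - i) (up i ?e) k' e')"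
        using k' i0(1) by (intro sum.mono_neutral_right) (auto simp: unitv_def)
      also have "\<dots> = unitv (?j - i0) (up i0 ?e) k' e' + (\<Sum>i\<in>?I'. unitv (?j - i) (up i ?e) k' e')"
        using fin by (subst sum.insert) auto
      finally show ?thesis by simp
    qed
    ultimately show ?case by (rule in_image_cong[THEN iffD1, rotated])
  qed
qed

lemma sur_deg_toep: "sur_deg n (n + p) p (int p - 1) (toep :: _ \<Rightarrow> 'a :: comm_ring_1)"
  unfolding sur_deg_unitv using toep_in_image by auto

text \<open>In degree \<open>p - 1\<close> source and target have the same dimension, so
  surjectivity already gives injectivity.\<close>

lemma inj_deg_toep: "inj_deg n (n + p) p (int p - 1) (toep :: _ \<Rightarrow> 'a :: field)"
proof (cases "p = 0")
  case True
  then show ?thesis by (simp add: inj_deg_neg)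
next
  case False
  have "int p * int (card (mons n (int p))) = (int p + int n) * int (card (mons n (int p - 1)))"
    using card_mons_Suc[of "int p - 1" n] False by simp
  then have "int ((n + p) * card (mons n (int p - 1))) = int (p * card (mons n (int p - 1 + 1)))"
    by (simp add: algebra_simps)
  then show ?thesis by (intro square_sur_imp_inj_deg sur_deg_toep) (metis of_nat_eq_iff)
qed

section \<open>Maps assembled from Toeplitz blocks\<close>

lemma ex_inj_deg_multiple:
  "\<exists>A :: _ \<Rightarrow> 'a :: field. inj_deg n (k * (n + b)) (k * b) (int b - 1) A"
proof (induction k)
  case 0
  show ?case by (auto simp: inj_deg_def cvec_def)
next
  case (Suc k)
  then obtain A :: "_ \<Rightarrow> 'a" where "inj_deg n (k * (n + b)) (k * b) (int b - 1) A" by blast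
  from inj_deg_block[OF inj_deg_toep this] show ?case by (auto simp: add.commute)
qed

text \<open>Take \<open>k\<close> Toeplitz blocks with \<open>b\<close> rows each, fill the
  remaining \<open>p - k * b\<close> rows with the padding block, and delete columns until
  \<open>r + p\<close> are left.\<close>

lemma ex_inj_deg:
  assumes "k * b \<le> p" "r \<le> k * n"
  shows "\<exists>A :: _ \<Rightarrow> 'a :: field. inj_deg n (r + p) p (int b - 1) A"
proof -
  obtain A :: "_ \<Rightarrow> 'a" where A: "inj_deg n (k * (n + b)) (k * b) (int b - 1) A"
    using ex_inj_deg_multiple by blast
  have "inj_deg n (k * (n + b) + (p - k * b)) (k * b + (p - k * b)) (int b - 1)
     (block (k * (n + b)) (k * b) A (\<lambda>(k, j, i). if j = k \<and> i = 0 then 1 else 0))"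
    by (intro inj_deg_block A inj_deg_diag)
  moreover have "k * (n + b) + (p - k * b) = k * n + p" "k * b + (p - k * b) = p"
    using assms(1) by (auto simp: algebra_simps)
  ultimately show ?thesis using inj_deg_cols[of n "k * n + p" p "int b - 1" _ "r + p"] assms(2) by auto
qed

text \<open>At most \<open>k\<close> Toeplitz blocks with at most \<open>b\<close> rows each cover
  all rows; spare columns do no harm to surjectivity.\<close>

lemma ex_sur_deg:
  assumes "p \<le> k * b" "k * n \<le> r" "b \<ge> 1"
  shows "\<exists>A :: _ \<Rightarrow> 'a :: field. sur_deg n (r + p) p (int b - 1) A"
proof -
  have "\<exists>A :: _ \<Rightarrow> 'a. sur_deg n (k * n + p) p (int b - 1) A" using assms(1)
  proof (induction k arbitrary: p)
    case 0
    then show ?case by (auto simp: sur_deg_unitv)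
  next
    case (Suc k)
    let ?p = "min p b"
    have "p - ?p \<le> k * b" using Suc.prems by (cases "p \<le> b") (simp_all add: min_def)
    then obtain A :: "_ \<Rightarrow> 'a" where A: "sur_deg n (k * n + (p - ?p)) (p - ?p) (int b - 1) A"
      using Suc.IH by blast
    \<comment> \<open>A block with fewer than \<open>b\<close> rows is surjective already in a lower
      degree, hence also in degree \<open>b - 1\<close>.\<close>
    have "sur_deg n (n + ?p) ?p (int b - 1) (toep :: _ \<Rightarrow> 'a)"
      by (rule sur_deg_mono[OF sur_deg_toep]) auto
    from sur_deg_block[OF this A]
    have "sur_deg n (n + ?p + (k * n + (p - ?p))) (?p + (p - ?p)) (int b - 1)
       (block (n + ?p) ?p toep A)" .
    moreover have "n + ?p + (k * n + (p - ?p)) = Suc k * n + p" "?p + (p - ?p) = p" by auto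
    ultimately show ?case by metis
  qed
  then show ?thesis using sur_deg_cols[of n "k * n + p" p "int b - 1" _ "r + p"] assms(2) by auto
qed

section \<open>Openness of injectivity and surjectivity in the matrix\<close>

lemma polyfun_lmat:
  assumes "y \<in> {..<p} \<times> mons n d'" "x \<in> {..<q} \<times> mons n d"
  shows "(\<lambda>A. lmat n A y x) \<in> polyfun (hom_index n q p)"
proof -
  have "(\<lambda>A :: _ \<Rightarrow> complex. if snd x = dn i (snd y) then A (fst y, fst x, i) else 0) \<in> polyfun (hom_index n q p)"
    if "i \<le> n" for i
    using that assms
    by (cases "snd x = dn i (snd y)") (auto intro!: polyfun.coord polyfun.const simp: hom_index_def)
  then show ?thesis unfolding lmat_def by (intro polyfun_sum) auto
qed

lemma sum_adjoint:
  fixes a :: "'x \<Rightarrow> 'a :: comm_semiring_0"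
  shows "(\<Sum>x\<in>X. a x * (\<Sum>y\<in>Y. c y x * L y)) = (\<Sum>y\<in>Y. (\<Sum>x\<in>X. c y x * a x) * L y)"
  unfolding sum_distrib_left sum_distrib_right by (subst sum.swap) (simp add: mult_ac)

text \<open>Instead of selecting a nonzero maximal minor, multiply by the conjugate transpose of the
  fixed matrix of \<open>A0\<close>. The resulting square determinant is polynomial in
  \<open>A\<close>, since the conjugates are constants; it is nonzero at \<open>A0\<close> because a
  Gram matrix of independent columns is definite; and where it is nonzero, \<open>A\<close> is
  injective.\<close>

lemma inj_deg_open:
  assumes "inj_deg n q p d (A0 :: lin_matrix)"
  shows "\<exists>P\<in>polyfun (hom_index n q p). P A0 \<noteq> 0 \<and> (\<forall>A. P A \<noteq> 0 \<longrightarrow> inj_deg n q p d A)"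
proof -
  let ?X = "{..<q} \<times> mons n d" and ?Y = "{..<p} \<times> mons n (d + 1)"
  have fX: "finite ?X" by simp
  let ?M = "\<lambda>A x x'. \<Sum>y\<in>?Y. cnj (lmat n A0 y x) * lmat n A y x'"
  have exch: "(\<Sum>x'\<in>?X. ?M A x x' * v x') = (\<Sum>y\<in>?Y. cnj (lmat n A0 y x) * (\<Sum>x'\<in>?X. lmat n A y x' * v x'))"
    for A v x
    unfolding sum_distrib_right sum_distrib_left by (subst sum.swap) (simp add: mult.assoc)
  have "(\<lambda>A. fdet ?X (?M A)) \<in> polyfun (hom_index n q p)"
    by (rule polyfun_fdet[OF fX], rule polyfun_sum, intro polyfun.mult polyfun.const)
      (auto intro!: polyfun_lmat)
  moreover have "fdet ?X (?M A0) \<noteq> 0"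
  proof
    assume "fdet ?X (?M A0) = 0"
    then obtain v where v: "\<exists>x\<in>?X. v x \<noteq> 0" "\<forall>x\<in>?X. (\<Sum>x'\<in>?X. ?M A0 x x' * v x') = 0"
      unfolding fdet_zero_iff[OF fX] by blast
    let ?L = "\<lambda>y. \<Sum>x'\<in>?X. lmat n A0 y x' * v x'"
    have "0 = (\<Sum>x\<in>?X. cnj (v x) * (\<Sum>y\<in>?Y. cnj (lmat n A0 y x) * ?L y))"
      proof (intro sum.neutral[symmetric] ballI)
      fix x assume "x \<in> ?X"
      then show "cnj (v x) * (\<Sum>y\<in>?Y. cnj (lmat n A0 y x) * ?L y) = 0"
        using bspec[OF v(2), of x] unfolding exch by simp
    qed
    also have "\<dots> = (\<Sum>y\<in>?Y. (\<Sum>x\<in>?X. cnj (lmat n A0 y x) * cnj (v x)) * ?L y)"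
      by (rule sum_adjoint)
    also have "\<dots> = (\<Sum>y\<in>?Y. of_real ((cmod (?L y))\<^sup>2))"
      \<comment> \<open>Each summand is a complex number times its conjugate, so the whole sum is
        the squared norm of the image of \<open>v\<close> under \<open>A0\<close>.\<close>
      by (intro sum.cong refl) (metis (no_types, lifting) cnj_sum complex_cnj_mult complex_norm_square mult.commute sum.cong)
    also have "\<dots> = of_real (\<Sum>y\<in>?Y. (cmod (?L y))\<^sup>2)" by simp
    finally have "of_real (\<Sum>y\<in>?Y. (cmod (?L y))\<^sup>2) = (0 :: complex)" by (rule sym)
    then have "(\<Sum>y\<in>?Y. (cmod (?L y))\<^sup>2) = 0" by (simp only: of_real_eq_0_iff)
    then have "\<forall>y\<in>?Y. ?L y = 0" by (subst (asm) sum_nonneg_eq_0_iff) auto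
    then show False using assms v(1) unfolding inj_deg_lmat by blast
  qed
  moreover have "inj_deg n q p d A" if "fdet ?X (?M A) \<noteq> 0" for A
    unfolding inj_deg_lmat
  proof (intro allI impI)
    fix v assume z: "\<forall>y\<in>?Y. (\<Sum>x\<in>?X. lmat n A y x * v x) = 0"
    have "\<forall>x\<in>?X. (\<Sum>x'\<in>?X. ?M A x x' * v x') = 0"
      unfolding exch
    proof (intro ballI sum.neutral)
      fix x y assume "y \<in> ?Y"
      then show "cnj (lmat n A0 y x) * (\<Sum>x'\<in>?X. lmat n A y x' * v x') = 0"
        using bspec[OF z, of y] by simp
    qed
    then show "\<forall>x\<in>?X. v x = 0" using that unfolding fdet_zero_iff[OF fX] by blast
  qed
  ultimately show ?thesis by (intro bexI[of _ "\<lambda>A. fdet ?X (?M A)"]) auto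
qed

text \<open>Composing with a right inverse fixed at \<open>A0\<close> gives a square determinant
  polynomial in \<open>A\<close>. It equals 1 at \<open>A0\<close>, and where it is nonzero the map
  is surjective.\<close>

lemma sur_deg_open:
  assumes "sur_deg n q p d (A0 :: lin_matrix)"
  shows "\<exists>P\<in>polyfun (hom_index n q p). P A0 \<noteq> 0 \<and> (\<forall>A. P A \<noteq> 0 \<longrightarrow> sur_deg n q p d A)"
proof -
  let ?X = "{..<q} \<times> mons n d" and ?Y = "{..<p} \<times> mons n (d + 1)"
  have fY: "finite ?Y" by simp
  have "\<forall>y'. \<exists>v. \<forall>y\<in>?Y. (\<Sum>x\<in>?X. lmat n A0 y x * v x) = (if y = y' then 1 else 0)"
    by (intro allI) (rule assms[unfolded sur_deg_lmat, THEN spec])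
  then obtain R where R: "\<And>y y'. y \<in> ?Y \<Longrightarrow> (\<Sum>x\<in>?X. lmat n A0 y x * R y' x) = (if y = y' then 1 else 0)"
    by metis
  let ?M = "\<lambda>A y y'. \<Sum>x\<in>?X. lmat n A y x * R y' x"
  have "(\<lambda>A. fdet ?Y (?M A)) \<in> polyfun (hom_index n q p)"
    by (rule polyfun_fdet[OF fY], rule polyfun_sum, intro polyfun.mult polyfun.const)
      (auto intro!: polyfun_lmat)
  moreover have "fdet ?Y (?M A0) = 1" by (rule fdet_one[OF fY]) (rule R)
  moreover have "sur_deg n q p d A" if *: "fdet ?Y (?M A) \<noteq> 0" for A
    unfolding sur_deg_lmat
  proof
    fix w
    obtain z where z: "\<forall>y\<in>?Y. (\<Sum>y'\<in>?Y. ?M A y y' * z y') = w y"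
      using fdet_nonzero_imp_solvable[OF fY *] by blast
    have "(\<Sum>x\<in>?X. lmat n A y x * (\<Sum>y'\<in>?Y. R y' x * z y')) = (\<Sum>y'\<in>?Y. ?M A y y' * z y')" for y
      unfolding sum_distrib_right sum_distrib_left by (subst sum.swap) (simp add: mult.assoc)
    then show "\<exists>v. \<forall>y\<in>?Y. (\<Sum>x\<in>?X. lmat n A y x * v x) = w y"
      using z by (intro exI[of _ "\<lambda>x. \<Sum>y'\<in>?Y. R y' x * z y'"]) simp
  qed
  ultimately show ?thesis by (intro bexI[of _ "\<lambda>A. fdet ?Y (?M A)"]) auto
qed

lemma polyfun_restrict:
  assumes "f \<in> polyfun J"
  shows "f (\<lambda>i. if i \<in> J then x i else 0) = f x"
  using assms by induction auto

lemma for_general_map_degs: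
  fixes A B :: lin_matrix
  assumes "inj_deg n q p d A" "sur_deg n q p d' B"
    and Q: "\<And>C. inj_deg n q p d C \<Longrightarrow> sur_deg n q p d' C \<Longrightarrow> Q C"
  shows "for_general_map n q p Q"
proof -
  let ?J = "hom_index n q p"
  obtain P where P: "P \<in> polyfun ?J" "P A \<noteq> 0" "\<forall>C. P C \<noteq> 0 \<longrightarrow> inj_deg n q p d C"
    using inj_deg_open[OF assms(1)] by blast
  obtain R where R: "R \<in> polyfun ?J" "R B \<noteq> 0" "\<forall>C. R C \<noteq> 0 \<longrightarrow> sur_deg n q p d' C"
    using sur_deg_open[OF assms(2)] by blast
  let ?W = "{x \<in> affine_space ?J. \<exists>f\<in>{\<lambda>x. P x * R x}. f x \<noteq> 0}"
  have "zariski_open ?J ?W"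
    unfolding zariski_open_def using polyfun.mult[OF P(1) R(1)] by (intro exI[of _ "{\<lambda>x. P x * R x}"]) auto
  moreover have "?W \<noteq> {}"
  proof -
    \<comment> \<open>The given matrices may have stray values outside the index set; truncating
      them moves them into the affine space without changing any polynomial function.\<close>
    have "(\<lambda>i. if i \<in> ?J then A i else 0) \<in> affine_space ?J" "(\<lambda>i. if i \<in> ?J then B i else 0) \<in> affine_space ?J"
      by (simp_all add: affine_space_def)
    moreover have "P (\<lambda>i. if i \<in> ?J then A i else 0) \<noteq> 0" "R (\<lambda>i. if i \<in> ?J then B i else 0) \<noteq> 0"
      by (subst polyfun_restrict[OF P(1)], rule P(2)) (subst polyfun_restrict[OF R(1)], rule R(2))
    ultimately obtain z where "z \<in> affine_space ?J" "P z * R z \<noteq> 0"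
      using polyfun_nonzero_mult[OF P(1) R(1)] by blast
    then have "z \<in> ?W" by simp
    then show ?thesis by (rule ex_in_conv[THEN iffD1, OF exI])
  qed
  moreover have "\<forall>C\<in>?W. Q C" using P(3) R(3) Q by auto
  ultimately show ?thesis unfolding for_general_map_def by (intro exI[of _ ?W] conjI)
qed

section \<open>Counting over a finite field\<close>

text \<open>Equality in the weighted count would force every monomial of the shadow to have all its
  quotients by a variable in \<open>T\<close>. Then \<open>T\<close> would be closed under
  exchanging one variable factor for another, and these exchanges connect all monomials of degree
  \<open>d\<close>.\<close>

lemma upset_weight_strict:
  assumes T: "T \<subseteq> mons n d" and ne: "T \<noteq> {}" "T \<noteq> mons n d" and d: "0 \<le> d"
  shows "(d + int n + 1) * int (card T) + 1 \<le> (d + 1) * int (card (upset n T))"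
proof (rule ccontr)
  let ?W = "upset n T"
  let ?g = "\<lambda>e. \<Sum>i\<le>n. if dn i e \<in> T then e i else 0"
  assume "\<not> ?thesis"
  then have le: "(d + 1) * int (card ?W) \<le> (d + int n + 1) * int (card T)" by simp
  have WM: "?W \<subseteq> mons n (d + 1)" by (rule upset_mons[OF T])
  then have fW: "finite ?W" using finite_subset[OF _ finite_mons] by blast
  have "(\<Sum>e\<in>?W. (d + 1) - ?g e) = (d + 1) * int (card ?W) - (d + int n + 1) * int (card T)"
    by (simp add: sum_subtractf upset_weight[OF T] algebra_simps)
  then have "(\<Sum>e\<in>?W. (d + 1) - ?g e) \<le> 0" using le by simp
  moreover have nn: "\<forall>e\<in>?W. 0 \<le> (d + 1) - ?g e"
    using upset_weight_le WM by (simp add: subset_iff)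
  ultimately have "(\<Sum>e\<in>?W. (d + 1) - ?g e) = 0"
    using sum_nonneg[of ?W "\<lambda>e. (d + 1) - ?g e"] by auto
  then have geq: "?g e = d + 1" if "e \<in> ?W" for e
    using nn that fW by (subst (asm) sum_nonneg_eq_0_iff) auto
  \<comment> \<open>A missing quotient would remove the positive exponent \<open>e j\<close> from
    the weight of \<open>e\<close>, which is already exactly the degree.\<close>
  have closed: "dn j e \<in> T" if e: "e \<in> ?W" and j: "j \<le> n" "e j > 0" for e j
  proof (rule ccontr)
    assume nT: "dn j e \<notin> T"
    have eM: "e \<in> mons n (d + 1)" using e WM by blast
    have "?g e < (\<Sum>i\<le>n. e i)"
      using eM j nT by (intro sum_strict_mono_ex1) (auto simp: mons_def intro!: bexI[of _ j])
    then show False using geq[OF e] eM by (simp add: mons_def exps_def)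
  qed
  have move: "dn j (up i t) \<in> T" if "t \<in> T" "i \<le> n" "j \<le> n" "up i t j > 0" for i j t
    using that by (intro closed) (auto simp: upset_def)
  have ex_pos: "\<exists>j\<le>n. j \<noteq> 0 \<and> e j > 0" if e: "e \<in> mons n d" "e 0 \<noteq> d" for e
  proof (rule ccontr)
    assume "\<not> ?thesis"
    then have "\<forall>j\<in>{..n} - {0}. e j = 0" using e(1) by (auto simp: mons_def) (metis antisym_conv3 not_less)
    then have "(\<Sum>j\<in>{..n} - {0}. e j) = 0" by simp
    then have "(\<Sum>j\<le>n. e j) = e 0" by (subst sum.remove[of _ 0]) auto
    then show False using e by (simp add: mons_def exps_def)
  qed
  have corner: "e = (\<lambda>i. if i = 0 then d else 0)" if e: "e \<in> mons n d" "e 0 = d" for e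
  proof
    fix i
    have "(\<Sum>j\<le>n. e j) = e 0 + (\<Sum>j\<in>{..n} - {0}. e j)" by (subst sum.remove[of _ 0]) auto
    then have "(\<Sum>j\<in>{..n} - {0}. e j) = 0" using e by (simp add: mons_def exps_def)
    then have "\<forall>j\<in>{..n} - {0}. e j = 0"
      using e(1) by (subst (asm) sum_nonneg_eq_0_iff) (auto simp: mons_def)
    then show "e i = (if i = 0 then d else 0)"
      using e by (cases "i \<le> n") (auto simp: mons_def exps_def)
  qed
  \<comment> \<open>An element of \<open>T\<close> with the largest exponent at 0 must be a pure
    power: any other variable in it could be exchanged for the one with index 0.\<close>
  have "\<exists>t\<in>T. t 0 = d"
  proof -
    have fT: "finite T" using T finite_subset[OF _ finite_mons] by blast
    define M where "M = Max ((\<lambda>t. t 0) ` T)"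
    have "M \<in> (\<lambda>t. t 0) ` T" unfolding M_def using fT ne(1) by (intro Max_in) auto
    then obtain t where t: "t \<in> T" "t 0 = M" by auto
    have "t 0 = d"
    proof (rule ccontr)
      assume "t 0 \<noteq> d"
      then obtain j where j: "j \<le> n" "j \<noteq> 0" "t j > 0" using ex_pos t T by blast
      then have "dn j (up 0 t) \<in> T" using move[of t 0 j] t by (auto simp: up_def)
      then have "dn j (up 0 t) 0 \<le> M" unfolding M_def using fT by (intro Max_ge) auto
      then show False using j t by (simp add: up_def dn_def)
    qed
    then show ?thesis using t by blast
  qed
  then have cT: "(\<lambda>i. if i = 0 then d else 0) \<in> T" using corner T by (metis subsetD)
  \<comment> \<open>From the pure power every monomial is reached by undoing such exchanges one at a
    time.\<close>
  have "m \<in> T" if "m \<in> mons n d" for m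
    using that
  proof (induction "nat (d - m 0)" arbitrary: m)
    case 0
    then have "m 0 = d" using mons_le[of m n d 0] by auto
    then show ?case using corner[OF 0(2)] cT by simp
  next
    case (Suc x)
    then have "m 0 \<noteq> d" by auto
    then obtain j where j: "j \<le> n" "j \<noteq> 0" "m j > 0" using ex_pos Suc by blast
    let ?m = "dn j (up 0 m)"
    have m0: "?m 0 = m 0 + 1" using j by (simp add: up_def dn_def)
    have "?m \<in> mons n d" using j up_mons[OF _ Suc(3), of 0] by (subst dn_mons_iff) (auto simp: up_def)
    then have "?m \<in> T" using m0 Suc(2) by (intro Suc(1)) auto
    then have "dn 0 (up j ?m) \<in> T"
      using move[of ?m j 0] j m0 Suc(3) by (auto simp: up_def dn_def mons_def)
    then show ?case by simp
  qed
  then show False using T ne by blast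
qed

section \<open>Subspaces over a finite field and their leading positions\<close>

definition fsupp :: "'x set \<Rightarrow> ('x \<Rightarrow> 'a :: zero) set" where
  "fsupp X = {f. \<forall>x. x \<notin> X \<longrightarrow> f x = 0}"

lemma fsupp_bij: "bij_betw (\<lambda>f. restrict f X) (fsupp X) (X \<rightarrow>\<^sub>E (UNIV :: 'a :: zero set))"
proof (rule bij_betwI[where g = "\<lambda>f x. if x \<in> X then f x else 0"])
qed (auto simp: fsupp_def PiE_def extensional_def fun_eq_iff)

lemma card_fsupp:
  assumes "finite X"
  shows "card (fsupp X :: ('x \<Rightarrow> 'a :: {zero, finite}) set) = CARD('a) ^ card X"
  using bij_betw_same_card[OF fsupp_bij[of X, where 'a = 'a]] card_PiE[OF assms, of "\<lambda>_. UNIV :: 'a set"]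
  by simp

lemma finite_fsupp:
  assumes "finite X"
  shows "finite (fsupp X :: ('x \<Rightarrow> 'a :: {zero, finite}) set)"
  using bij_betw_finite[OF fsupp_bij[of X, where 'a = 'a]] finite_PiE[OF assms, of "\<lambda>_. UNIV :: 'a set"]
  by simp

definition fsubspace :: "('x \<Rightarrow> 'a :: comm_ring_1) set \<Rightarrow> bool" where
  "fsubspace S \<longleftrightarrow> (\<lambda>_. 0) \<in> S \<and> (\<forall>f\<in>S. \<forall>g\<in>S. \<forall>a. (\<lambda>x. f x + a * g x) \<in> S)"

lemma fsubspaceD: "fsubspace S \<Longrightarrow> f \<in> S \<Longrightarrow> g \<in> S \<Longrightarrow> (\<lambda>x. f x + a * g x) \<in> S"
  unfolding fsubspace_def by blast

lemma fsubspace_sum: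
  assumes S: "fsubspace S" and b: "\<And>t. t \<in> T \<Longrightarrow> b t \<in> S"
  shows "(\<lambda>x. \<Sum>t\<in>T. a t * b t x) \<in> S"
  using b
proof (induction T rule: infinite_finite_induct)
  case (insert t T)
  then have "(\<lambda>x. (\<Sum>t\<in>T. a t * b t x) + a t * b t x) \<in> S" by (intro fsubspaceD[OF S]) auto
  then show ?case using insert by (simp add: add.commute)
qed (use S in \<open>auto simp: fsubspace_def\<close>)

definition is_lead :: "('x \<Rightarrow> int) \<Rightarrow> ('x \<Rightarrow> 'a :: zero) \<Rightarrow> 'x \<Rightarrow> bool" where
  "is_lead \<phi> v m \<longleftrightarrow> v m \<noteq> 0 \<and> (\<forall>m'. v m' \<noteq> 0 \<longrightarrow> \<phi> m' \<le> \<phi> m)"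

text \<open>The initial monomials of a subspace. When the weight is injective on the finite support
  set, their number is the dimension: over a field with c elements the subspace has exactly c to
  that power elements, so dimension can be handled by counting.\<close>

definition leads :: "('x \<Rightarrow> int) \<Rightarrow> ('x \<Rightarrow> 'a :: zero) set \<Rightarrow> 'x set" where
  "leads \<phi> S = {m. \<exists>v\<in>S. is_lead \<phi> v m}"

lemma leads_subset: "S \<subseteq> fsupp M \<Longrightarrow> leads \<phi> S \<subseteq> M"
  unfolding leads_def is_lead_def fsupp_def by blast

lemma ex_lead:
  assumes "v \<in> fsupp M" "finite M" "v \<noteq> (\<lambda>_. 0)"
  obtains m where "is_lead \<phi> v m"
proof -
  let ?N = "{m. v m \<noteq> 0}"
  have N: "finite ?N" "?N \<noteq> {}"
    using assms by (auto simp: fsupp_def intro: finite_subset[of _ M])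
  then have "Max (\<phi> ` ?N) \<in> \<phi> ` ?N" by (intro Max_in) auto
  then obtain m where m: "v m \<noteq> 0" "\<phi> m = Max (\<phi> ` ?N)" by auto
  have "\<phi> m' \<le> \<phi> m" if "v m' \<noteq> 0" for m' unfolding m(2) using N that by (intro Max_ge) auto
  then show thesis using that[of m] m by (auto simp: is_lead_def)
qed

text \<open>Take the heaviest position \<open>t\<close> at which two coefficient families differ. In
  coordinate \<open>t\<close> all other basis vectors contribute nothing to the difference: the
  heavier ones have equal coefficients, the lighter ones do not reach \<open>t\<close>.\<close>

lemma lead_comb_inj:
  fixes b :: "'x \<Rightarrow> 'x \<Rightarrow> 'a :: field"
  assumes "finite T" "inj_on \<phi> T" and b: "\<And>t. t \<in> T \<Longrightarrow> is_lead \<phi> (b t) t"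
  shows "inj_on (\<lambda>a x. \<Sum>t\<in>T. a t * b t x) (fsupp T)"
proof (rule inj_onI)
  fix a a' :: "'x \<Rightarrow> 'a" assume aa: "a \<in> fsupp T" "a' \<in> fsupp T"
    and eq: "(\<lambda>x. \<Sum>t\<in>T. a t * b t x) = (\<lambda>x. \<Sum>t\<in>T. a' t * b t x)"
  show "a = a'"
  proof (rule ccontr)
    assume "a \<noteq> a'"
    then have "(\<lambda>t. a t - a' t) \<noteq> (\<lambda>_. 0)" by (auto simp: fun_eq_iff)
    moreover have "(\<lambda>t. a t - a' t) \<in> fsupp T" using aa by (auto simp: fsupp_def)
    ultimately obtain t where t: "is_lead \<phi> (\<lambda>t. a t - a' t) t" using ex_lead assms(1) by blast
    have tT: "t \<in> T"
    proof (rule ccontr)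
      assume "t \<notin> T"
      then have "a t = 0" "a' t = 0" using aa by (auto simp: fsupp_def)
      then show False using t by (simp add: is_lead_def)
    qed
    have "0 = (\<Sum>s\<in>T. (a s - a' s) * b s t)"
      using fun_cong[OF eq, of t] by (simp add: left_diff_distrib sum_subtractf)
    also have "\<dots> = (\<Sum>s\<in>{t}. (a s - a' s) * b s t)"
    proof (rule sum.mono_neutral_right)
      show "\<forall>i\<in>T - {t}. (a i - a' i) * b i t = 0"
      proof
        fix s assume s: "s \<in> T - {t}"
        show "(a s - a' s) * b s t = 0"
        proof (rule ccontr)
          assume "(a s - a' s) * b s t \<noteq> 0"
          then have "\<phi> s \<le> \<phi> t" "\<phi> t \<le> \<phi> s" using t b[of s] s by (auto simp: is_lead_def)
          then show False using assms(2) s tT by (auto simp: inj_on_def)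
        qed
      qed
    qed (use assms tT in auto)
    also have "\<dots> \<noteq> 0" using t b[OF tT] by (auto simp: is_lead_def)
    finally show False by simp
  qed
qed

lemma leads_card_le:
  fixes S :: "('x \<Rightarrow> 'a :: {field, finite}) set"
  assumes S: "fsubspace S" "S \<subseteq> fsupp M" "finite M" "inj_on \<phi> M" and T: "T \<subseteq> leads \<phi> S"
  shows "CARD('a) ^ card T \<le> card S"
proof -
  have "\<forall>t\<in>T. \<exists>v. v \<in> S \<and> is_lead \<phi> v t" using T unfolding leads_def by blast
  from bchoice[OF this] obtain b where b: "\<And>t. t \<in> T \<Longrightarrow> b t \<in> S" "\<And>t. t \<in> T \<Longrightarrow> is_lead \<phi> (b t) t"
    by auto
  have TM: "T \<subseteq> M" using T leads_subset[OF S(2)] by blast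
  then have fT: "finite T" "inj_on \<phi> T" using S finite_subset inj_on_subset by blast+
  have 1: "card ((\<lambda>a x. \<Sum>t\<in>T. a t * b t x) ` fsupp T) = CARD('a) ^ card T"
    using card_image[OF lead_comb_inj[OF fT b(2)]] card_fsupp[OF fT(1)] by simp
  have 2: "(\<lambda>a x. \<Sum>t\<in>T. a t * b t x) ` fsupp T \<subseteq> S"
    using fsubspace_sum[OF S(1) b(1)] by auto
  have 3: "finite S" using finite_subset[OF S(2) finite_fsupp[OF S(3)]] .
  show ?thesis using card_mono[OF 3 2] 1 by simp
qed

text \<open>Choosing one vector per leading position gives a basis. Independence bounds
  \<open>card S\<close> from below; the bound from above holds because an element of
  \<open>S\<close> is determined by its values at the leading positions.\<close>

lemma leads_basis:
  fixes S :: "('x \<Rightarrow> 'a :: {field, finite}) set"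
  assumes S: "fsubspace S" "S \<subseteq> fsupp M" "finite M" "inj_on \<phi> M"
  obtains b where "\<And>t. t \<in> leads \<phi> S \<Longrightarrow> b t \<in> S"
    "\<And>v. v \<in> S \<Longrightarrow> \<exists>a\<in>fsupp (leads \<phi> S). v = (\<lambda>x. \<Sum>t\<in>leads \<phi> S. a t * b t x)"
proof -
  let ?T = "leads \<phi> S"
  have "\<forall>t\<in>?T. \<exists>v. v \<in> S \<and> is_lead \<phi> v t" unfolding leads_def by blast
  from bchoice[OF this] obtain b where b: "\<And>t. t \<in> ?T \<Longrightarrow> b t \<in> S" "\<And>t. t \<in> ?T \<Longrightarrow> is_lead \<phi> (b t) t"
    by auto
  have TM: "?T \<subseteq> M" by (rule leads_subset[OF S(2)])
  then have fT: "finite ?T" "inj_on \<phi> ?T" using S finite_subset inj_on_subset by blast+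
  let ?F = "\<lambda>a x. \<Sum>t\<in>?T. a t * b t x"
  have cF: "card (?F ` fsupp ?T) = CARD('a) ^ card ?T"
    using card_image[OF lead_comb_inj[OF fT b(2)]] card_fsupp[OF fT(1)] by simp
  have FS: "?F ` fsupp ?T \<subseteq> S"
    using fsubspace_sum[OF S(1) b(1)] by auto
  have finS: "finite S" using finite_subset[OF S(2) finite_fsupp[OF S(3)]] .
  \<comment> \<open>If two elements agree on \<open>?T\<close>, a nonzero difference would lead at a
    position of \<open>?T\<close> where it vanishes.\<close>
  have "inj_on (\<lambda>v x. if x \<in> ?T then v x else 0) S"
  proof (rule inj_onI)
    fix v v' assume v: "v \<in> S" "v' \<in> S" and eq: "(\<lambda>x. if x \<in> ?T then v x else 0) = (\<lambda>x. if x \<in> ?T then v' x else 0)"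
    have d: "(\<lambda>x. v x + (- 1) * v' x) \<in> S" by (rule fsubspaceD[OF S(1) v])
    show "v = v'"
    proof (rule ccontr)
      assume "v \<noteq> v'"
      then have "(\<lambda>x. v x + (- 1) * v' x) \<noteq> (\<lambda>_. 0)" by (auto simp: fun_eq_iff)
      then obtain t where t: "is_lead \<phi> (\<lambda>x. v x + (- 1) * v' x) t" using ex_lead d S by blast
      then have "t \<in> ?T" using d unfolding leads_def by blast
      then show False using t fun_cong[OF eq, of t] by (simp add: is_lead_def)
    qed
  qed
  then have "card S \<le> card (fsupp ?T :: ('x \<Rightarrow> 'a) set)"
    by (rule card_inj_on_le) (auto simp: fsupp_def finite_fsupp[OF fT(1), unfolded fsupp_def])
  then have "card S \<le> card (?F ` fsupp ?T)" using cF card_fsupp[OF fT(1), where 'a = 'a] by simp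
  then have "?F ` fsupp ?T = S" using card_seteq[OF finS FS] by simp
  then show thesis using that[of b] b(1) by blast
qed

text \<open>Every nonempty fibre of a linear map is a translate of the kernel.\<close>

lemma card_kernel_image:
  fixes f :: "('x \<Rightarrow> 'a :: comm_ring_1) \<Rightarrow> ('y \<Rightarrow> 'a)"
  assumes S: "fsubspace S" "finite S"
    and lin: "\<And>u v a. f (\<lambda>x. u x + a * v x) = (\<lambda>y. f u y + a * f v y)"
  shows "card {v \<in> S. f v = (\<lambda>_. 0)} * card (f ` S) = card S"
proof -
  have fib: "card {v \<in> S. f v = w} = card {v \<in> S. f v = (\<lambda>_. 0)}" if w: "w \<in> f ` S" for w
  proof -
    obtain u where u: "u \<in> S" "w = f u" using w by blast
    have "bij_betw (\<lambda>v x. v x + (- 1) * u x) {v \<in> S. f v = w} {v \<in> S. f v = (\<lambda>_. 0)}"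
    proof (rule bij_betwI[where g = "\<lambda>v x. v x + 1 * u x"])
      show "(\<lambda>v x. v x + (- 1) * u x) \<in> {v \<in> S. f v = w} \<rightarrow> {v \<in> S. f v = (\<lambda>_. 0)}"
      proof
        fix v assume v: "v \<in> {v \<in> S. f v = w}"
        then have "(\<lambda>x. v x + (- 1) * u x) \<in> S" by (intro fsubspaceD[OF S(1)] u) auto
        moreover have "f (\<lambda>x. v x + (- 1) * u x) = (\<lambda>_. 0)" using lin[of v "- 1" u] v u by simp
        ultimately show "(\<lambda>x. v x + (- 1) * u x) \<in> {v \<in> S. f v = (\<lambda>_. 0)}" by simp
      qed
      show "(\<lambda>v x. v x + 1 * u x) \<in> {v \<in> S. f v = (\<lambda>_. 0)} \<rightarrow> {v \<in> S. f v = w}"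
      proof
        fix v assume v: "v \<in> {v \<in> S. f v = (\<lambda>_. 0)}"
        then have "(\<lambda>x. v x + 1 * u x) \<in> S" by (intro fsubspaceD[OF S(1)] u) auto
        moreover have "f (\<lambda>x. v x + 1 * u x) = w" using lin[of v 1 u] v u by simp
        ultimately show "(\<lambda>x. v x + 1 * u x) \<in> {v \<in> S. f v = w}" by simp
      qed
    qed auto
    then show ?thesis by (rule bij_betw_same_card)
  qed
  have "card S = (\<Sum>w\<in>f ` S. card {v \<in> S. f v = w})"
    using sum.image_gen[OF S(2), of "\<lambda>_. 1 :: nat" f] by simp
  also have "\<dots> = (\<Sum>w\<in>f ` S. card {v \<in> S. f v = (\<lambda>_. 0)})" using fib by (intro sum.cong) auto
  finally show ?thesis by (simp add: mult.commute)
qed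

text \<open>Modulo \<open>B\<close> only the lowest digit remains, and it is too small to be a
  nonzero multiple of \<open>B\<close>; divide by \<open>B\<close> and repeat.\<close>

lemma digit_sum_eq_0:
  fixes \<delta> :: "nat \<Rightarrow> int"
  assumes "\<And>i. i \<le> n \<Longrightarrow> \<bar>\<delta> i\<bar> < B" "(\<Sum>i\<le>n. \<delta> i * B ^ i) = 0" "i \<le> n"
  shows "\<delta> i = 0"
  using assms
proof (induction n arbitrary: \<delta> i)
  case 0
  then show ?case by simp
next
  case (Suc n)
  have B: "0 < B" using Suc.prems(1)[of 0] by simp
  have eq: "(\<Sum>i\<le>Suc n. \<delta> i * B ^ i) = \<delta> 0 + B * (\<Sum>i\<le>n. \<delta> (Suc i) * B ^ i)"
    by (subst sum.atMost_Suc_shift) (simp add: sum_distrib_left mult.left_commute)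
  have "\<delta> 0 = 0"
  proof (rule ccontr)
    assume nz: "\<delta> 0 \<noteq> 0"
    have "B dvd \<delta> 0" using eq Suc.prems(2)
      by (metis add_eq_0_iff dvd_minus_iff dvd_triv_left)
    then have "B \<le> \<bar>\<delta> 0\<bar>" using dvd_imp_le_int[OF nz, of B] B by simp
    then show False using Suc.prems(1)[of 0] by simp
  qed
  moreover from this have "(\<Sum>i\<le>n. \<delta> (Suc i) * B ^ i) = 0" using eq Suc.prems(2) B by simp
  then have "\<delta> (Suc i) = 0" if "i \<le> n" for i
    using that Suc.prems(1) by (intro Suc.IH[of "\<lambda>i. \<delta> (Suc i)"]) auto
  ultimately show ?case using Suc.prems(3) by (cases i) auto
qed

text \<open>Reading exponents as digits in base \<open>B\<close> gives a monomial order and, by \<open>x\<^sub>i = z\<^bsup>B^i\<^esup>\<close>, a reduction to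
  one variable.\<close>

definition expweight :: "nat \<Rightarrow> int \<Rightarrow> (nat \<Rightarrow> int) \<Rightarrow> int" where
  "expweight n B e = (\<Sum>i\<le>n. e i * B ^ i)"

lemma expweight_inj:
  assumes "\<And>e i. e \<in> E \<Longrightarrow> n < i \<Longrightarrow> e i = 0" "\<And>e i. e \<in> E \<Longrightarrow> i \<le> n \<Longrightarrow> \<bar>e i\<bar> < C" "2 * C \<le> B"
  shows "inj_on (expweight n B) E"
proof (rule inj_onI, rule ext)
  fix e e' i assume e: "e \<in> E" "e' \<in> E" and eq: "expweight n B e = expweight n B e'"
  have "(\<Sum>i\<le>n. (e i - e' i) * B ^ i) = 0"
    using eq by (simp add: expweight_def left_diff_distrib sum_subtractf)
  moreover have "\<bar>e i - e' i\<bar> < B" if "i \<le> n" for i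
    using assms(2)[OF e(1) that] assms(2)[OF e(2) that] assms(3) by linarith
  ultimately have "i \<le> n \<Longrightarrow> e i - e' i = 0" using digit_sum_eq_0[of n "\<lambda>i. e i - e' i" B i] by blast
  then show "e i = e' i" using assms(1)[OF e(1), of i] assms(1)[OF e(2), of i] by (cases "i \<le> n") auto
qed

lemma expweight_up:
  assumes "i \<le> n"
  shows "expweight n B (up i e) = expweight n B e + B ^ i"
proof -
  have "expweight n B (up i e) = (\<Sum>y\<le>n. e y * B ^ y + (if y = i then B ^ i else 0))"
    unfolding expweight_def by (rule sum.cong) (auto simp: up_def distrib_right)
  then show ?thesis using assms by (simp add: sum.distrib expweight_def)
qed

section \<open>Counting the matrices that annihilate a given vector of forms\<close>

definition row_span :: "nat \<Rightarrow> (nat \<Rightarrow> (nat \<Rightarrow> int) \<Rightarrow> 'a :: comm_ring_1) \<Rightarrow> ((nat \<Rightarrow> int) \<Rightarrow> 'a) set" where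
  "row_span q \<kappa> = range (\<lambda>a e. \<Sum>j<q. a j * \<kappa> j e)"

lemma row_span_subspace: "fsubspace (row_span q \<kappa>)"
  unfolding fsubspace_def
proof (intro conjI ballI allI)
  show "(\<lambda>_. 0) \<in> row_span q \<kappa>"
    unfolding row_span_def by (intro range_eqI[of _ _ "\<lambda>_. 0"]) simp
  fix f g b assume "f \<in> row_span q \<kappa>" "g \<in> row_span q \<kappa>"
  then obtain a a' where "f = (\<lambda>e. \<Sum>j<q. a j * \<kappa> j e)" "g = (\<lambda>e. \<Sum>j<q. a' j * \<kappa> j e)"
    unfolding row_span_def by blast
  then show "(\<lambda>x. f x + b * g x) \<in> row_span q \<kappa>"
    unfolding row_span_def
    by (intro range_eqI[of _ _ "\<lambda>j. a j + b * a' j"]) (simp add: distrib_right sum.distrib sum_distrib_left mult.assoc)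
qed

lemma row_span_fsupp: "\<kappa> \<in> cvec n q d \<Longrightarrow> row_span q \<kappa> \<subseteq> fsupp (mons n d)"
  by (auto simp: row_span_def fsupp_def cvecD)

lemma row_in_span: "j < q \<Longrightarrow> \<kappa> j \<in> row_span q \<kappa>"
  unfolding row_span_def
  by (intro range_eqI[of _ _ "\<lambda>j'. if j' = j then 1 else 0"])
    (simp add: if_distrib[of "\<lambda>x. x * _"] sum.delta cong: if_cong)

text \<open>The initial monomials of the span of the entries of \<kappa>. The base
  \<open>2 * (d + 2)\<close> makes the weight injective in degrees \<open>d\<close> and
  \<open>d + 1\<close> at once, since exponents there are below \<open>d + 2\<close>.\<close>

definition row_leads :: "nat \<Rightarrow> nat \<Rightarrow> int \<Rightarrow> (nat \<Rightarrow> (nat \<Rightarrow> int) \<Rightarrow> 'a :: comm_ring_1) \<Rightarrow> (nat \<Rightarrow> int) set" where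
  "row_leads n q d \<kappa> = leads (expweight n (2 * (d + 2))) (row_span q \<kappa>)"

lemma row_leads_subset: "\<kappa> \<in> cvec n q d \<Longrightarrow> row_leads n q d \<kappa> \<subseteq> mons n d"
  unfolding row_leads_def by (intro leads_subset row_span_fsupp)

lemma row_leads_empty:
  assumes "\<kappa> \<in> cvec n q d" "row_leads n q d \<kappa> = {}"
  shows "\<kappa> = (\<lambda>_ _. 0)"
proof (rule ext)
  fix j
  show "\<kappa> j = (\<lambda>_. 0)"
  proof (cases "j < q")
    case True
    show ?thesis
    proof (rule ccontr)
      assume "\<kappa> j \<noteq> (\<lambda>_. 0)"
      moreover have "\<kappa> j \<in> fsupp (mons n d)" using row_in_span[OF True] row_span_fsupp[OF assms(1)] by blast
      ultimately obtain m where "is_lead (expweight n (2 * (d + 2))) (\<kappa> j) m"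
        using ex_lead finite_mons by blast
      then show False using assms(2) row_in_span[OF True] unfolding row_leads_def leads_def by blast
    qed
  next
    case False
    then show ?thesis using cvecD[OF assms(1)] by blast
  qed
qed

lemma mons_weight_inj:
  assumes "d' \<le> d + 1"
  shows "inj_on (expweight n (2 * (d + 2))) (mons n d')"
proof (rule expweight_inj[where C = "d + 2"])
  fix e i assume e: "e \<in> mons n d'"
  show "n < i \<Longrightarrow> e i = 0" using e by (auto simp: mons_def exps_def)
  show "\<bar>e i\<bar> < d + 2" using mons_le[OF e, of i] e assms by (auto simp: mons_def)
qed simp

lemma bij_cvec_fsupp:
  "bij_betw (\<lambda>u x. u (fst x) (snd x)) (cvec n q d) (fsupp ({..<q} \<times> mons n d))"
  by (rule bij_betwI[where g = "\<lambda>f j e. f (j, e)"]) (auto simp: cvec_def fsupp_def, blast+)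

lemma finite_cvec: "finite (cvec n q d :: (nat \<Rightarrow> (nat \<Rightarrow> int) \<Rightarrow> 'a :: {zero, finite}) set)"
  by (subst bij_betw_finite[OF bij_cvec_fsupp]) (rule finite_fsupp, simp)

lemma card_cvec: "card (cvec n q d :: (nat \<Rightarrow> (nat \<Rightarrow> int) \<Rightarrow> 'a :: {zero, finite}) set) = CARD('a) ^ (q * card (mons n d))"
  by (subst bij_betw_same_card[OF bij_cvec_fsupp], subst card_fsupp) (simp_all add: card_cartesian_product)

text \<open>A vector \<kappa> is determined by a basis of its span, which costs
  \<open>card T\<close> polynomials of degree \<open>d\<close>, and by the coordinates of its
  \<open>q\<close> entries in that basis, which cost \<open>q * card T\<close> scalars.\<close>

lemma card_row_leads:
  "card {\<kappa> \<in> (cvec n q d :: (nat \<Rightarrow> (nat \<Rightarrow> int) \<Rightarrow> 'a) set). row_leads n q d \<kappa> = T}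
     \<le> CARD('a :: {field, finite}) ^ (card T * card (mons n d) + q * card T)"
  for T and q n d
proof (cases "T \<subseteq> mons n d")
  case False
  then have e: "{\<kappa> \<in> cvec n q d. row_leads n q d \<kappa> = T} = ({} :: (nat \<Rightarrow> (nat \<Rightarrow> int) \<Rightarrow> 'a) set)"
    using row_leads_subset by blast
  show ?thesis by (subst e) simp
next
  case True
  then have fT: "finite T" using finite_subset finite_mons by blast
  let ?M = "mons n d"
  let ?G = "\<lambda>(a, b) j e. if j < q then \<Sum>t\<in>T. a (j, t) * b (t, e) else 0 :: 'a"
  let ?D = "fsupp ({..<q} \<times> T) \<times> fsupp (T \<times> ?M) :: ((nat \<times> (nat \<Rightarrow> int) \<Rightarrow> 'a) \<times> ((nat \<Rightarrow> int) \<times> (nat \<Rightarrow> int) \<Rightarrow> 'a)) set"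
  have finD: "finite ?D" using fT by (intro finite_cartesian_product finite_fsupp) auto
  have "{\<kappa> \<in> cvec n q d. row_leads n q d \<kappa> = T} \<subseteq> ?G ` ?D"
  proof
    fix \<kappa> :: "nat \<Rightarrow> (nat \<Rightarrow> int) \<Rightarrow> 'a" assume "\<kappa> \<in> {\<kappa> \<in> cvec n q d. row_leads n q d \<kappa> = T}"
    then have k: "\<kappa> \<in> cvec n q d" and T: "leads (expweight n (2 * (d + 2))) (row_span q \<kappa>) = T"
      by (auto simp: row_leads_def)
    have dd: "d \<le> d + 1" by simp
    note basis = leads_basis[OF row_span_subspace row_span_fsupp[OF k] finite_mons mons_weight_inj[OF dd], unfolded T]
    obtain b where b: "\<And>t. t \<in> T \<Longrightarrow> b t \<in> row_span q \<kappa>"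
      "\<And>v. v \<in> row_span q \<kappa> \<Longrightarrow> \<exists>a\<in>fsupp T. v = (\<lambda>x. \<Sum>t\<in>T. a t * b t x)"
      by (rule basis[OF that])
    have "\<forall>j\<in>{..<q}. \<exists>a. a \<in> fsupp T \<and> \<kappa> j = (\<lambda>x. \<Sum>t\<in>T. a t * b t x)"
      using b(2)[OF row_in_span] by blast
    from bchoice[OF this] obtain a where
      a: "\<And>j. j < q \<Longrightarrow> a j \<in> fsupp T" "\<And>j. j < q \<Longrightarrow> \<kappa> j = (\<lambda>x. \<Sum>t\<in>T. a j t * b t x)" by auto
    let ?a = "\<lambda>(j, t). if j < q then a j t else 0" and ?b = "\<lambda>(t, e). if t \<in> T then b t e else 0"
    have "?a \<in> fsupp ({..<q} \<times> T)" using a(1) by (auto simp: fsupp_def)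
    moreover have "?b \<in> fsupp (T \<times> ?M)" using b(1) row_span_fsupp[OF k] by (auto simp: fsupp_def)
    moreover have "\<kappa> = ?G (?a, ?b)"
      using a(2) cvecD[OF k] by (auto simp: fun_eq_iff intro!: sum.cong)
    ultimately show "\<kappa> \<in> ?G ` ?D" by (intro image_eqI[of _ _ "(?a, ?b)"]) auto
  qed
  then have "card {\<kappa> \<in> (cvec n q d :: (nat \<Rightarrow> (nat \<Rightarrow> int) \<Rightarrow> 'a) set). row_leads n q d \<kappa> = T} \<le> card (?G ` ?D)"
    by (rule card_mono[OF finite_imageI[OF finD]])
  also have "\<dots> \<le> card ?D" by (rule card_image_le[OF finD])
  also have "\<dots> = CARD('a) ^ (card T * card ?M + q * card T)"
    using fT by (simp add: card_cartesian_product card_fsupp power_add mult.commute)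
  finally show ?thesis .
qed

text \<open>The action with \<kappa> fixed and the matrix as the variable, which makes it a linear
  map on the space of matrices.\<close>

definition act_fun :: "nat \<Rightarrow> nat \<Rightarrow> nat \<Rightarrow> (nat \<Rightarrow> (nat \<Rightarrow> int) \<Rightarrow> 'a) \<Rightarrow> (nat \<times> nat \<times> nat \<Rightarrow> 'a)
    \<Rightarrow> nat \<times> (nat \<Rightarrow> int) \<Rightarrow> 'a :: comm_ring_1" where
  "act_fun n q p \<kappa> A = (\<lambda>(k, e). if k < p then act n q A \<kappa> k e else 0)"

lemma act_fun_linear:
  "act_fun n q p \<kappa> (\<lambda>x. A x + a * B x) = (\<lambda>y. act_fun n q p \<kappa> A y + a * act_fun n q p \<kappa> B y)"
  by (auto simp: act_fun_def act_def fun_eq_iff distrib_right sum.distrib sum_distrib_left mult.assoc)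

lemma fsubspace_fsupp: "fsubspace (fsupp X)"
  by (auto simp: fsubspace_def fsupp_def)

lemma fsubspace_act_fun: "fsubspace (act_fun n q p \<kappa> ` fsupp X)"
  unfolding fsubspace_def
proof (intro conjI ballI allI)
  show "(\<lambda>_. 0) \<in> act_fun n q p \<kappa> ` fsupp X"
    by (intro image_eqI[of _ _ "\<lambda>_. 0"]) (auto simp: act_fun_def act_def fsupp_def fun_eq_iff)
  fix f g a assume "f \<in> act_fun n q p \<kappa> ` fsupp X" "g \<in> act_fun n q p \<kappa> ` fsupp X"
  then obtain A B where AB: "A \<in> fsupp X" "B \<in> fsupp X" "f = act_fun n q p \<kappa> A" "g = act_fun n q p \<kappa> B" by blast
  then show "(\<lambda>x. f x + a * g x) \<in> act_fun n q p \<kappa> ` fsupp X"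
    using fsubspaceD[OF fsubspace_fsupp AB(1,2)]
    by (intro image_eqI[of _ _ "\<lambda>x. A x + a * B x"]) (auto simp: act_fun_linear)
qed

text \<open>The image of the matrices under evaluation at \<kappa> consists of \<open>p\<close>
  independent copies of the variables times the span of \<kappa>. It has a leading position for
  every row and every monomial in the shadow of the leads, so it is large and the kernel is
  correspondingly small.\<close>

lemma card_kernel_act_fun:
  fixes \<kappa> :: "nat \<Rightarrow> (nat \<Rightarrow> int) \<Rightarrow> 'a :: {field, finite}"
  assumes k: "\<kappa> \<in> cvec n q d"
  shows "card {A \<in> fsupp (hom_index n q p). act_fun n q p \<kappa> A = (\<lambda>_. 0)}
      * CARD('a) ^ (p * card (upset n (row_leads n q d \<kappa>))) \<le> CARD('a) ^ card (hom_index n q p)"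
proof -
  let ?H = "hom_index n q p" and ?W = "upset n (row_leads n q d \<kappa>)"
  let ?S = "act_fun n q p \<kappa> ` fsupp ?H"
  let ?w = "expweight n (2 * (d + 2))"
  \<comment> \<open>The row number is appended as a lowest digit in base \<open>p\<close>, which
    extends the monomial weight injectively to pairs.\<close>
  let ?\<phi> = "\<lambda>(k, e). ?w e * int p + int k"
  let ?Y = "{..<p} \<times> mons n (d + 1)"
  have finH: "finite ?H" by (simp add: hom_index_def)
  have SY: "?S \<subseteq> fsupp ?Y"
    using act_outside[OF k] by (auto simp: fsupp_def act_fun_def)
  have inj: "inj_on ?\<phi> ?Y"
  proof (rule inj_onI, clarify)
    fix k e k' e' assume *: "?w e * int p + int k = ?w e' * int p + int k'" "k < p" "k' < p"
      "e \<in> mons n (d + 1)" "e' \<in> mons n (d + 1)"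
    have "(?w e * int p + int k) mod int p = (?w e' * int p + int k') mod int p" using *(1) by simp
    then have kk: "k = k'" using *(2,3) by simp
    then have "?w e = ?w e'" using * by simp
    then show "k = k' \<and> e = e'" using kk * inj_onD[OF mons_weight_inj[of "d + 1" d n]] by simp
  qed
  have "{..<p} \<times> ?W \<subseteq> leads ?\<phi> ?S"
  proof
    fix x assume "x \<in> {..<p} \<times> ?W"
    then obtain k i t where x: "x = (k, up i t)" "k < p" "i \<le> n" "t \<in> row_leads n q d \<kappa>"
      by (auto simp: upset_def)
    then obtain a where lead: "is_lead ?w (\<lambda>e. \<Sum>j<q. a j * \<kappa> j e) t"
      unfolding row_leads_def leads_def row_span_def by blast
    define v where "v e = (\<Sum>j<q. a j * \<kappa> j e)" for e
    have v: "is_lead ?w v t" using lead unfolding v_def .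
    \<comment> \<open>The matrix with entries \<open>a j\<close> times the variable with index
      \<open>i\<close> in row \<open>k\<close>, and zero elsewhere, sends \<kappa> to that variable
      times \<open>v\<close>, placed in row \<open>k\<close>.\<close>
    let ?A = "\<lambda>(k', j, i'). if k' = k \<and> i' = i \<and> j < q then a j else 0"
    have A: "?A \<in> fsupp ?H" using x by (auto simp: fsupp_def hom_index_def)
    have act: "act_fun n q p \<kappa> ?A (k', e) = (if k' = k then v (dn i e) else 0)" for k' e
    proof -
      have "act n q ?A \<kappa> k' e = (\<Sum>j<q. \<Sum>i'\<le>n. if i' = i then (if k' = k then a j * \<kappa> j (dn i e) else 0) else 0)"
        unfolding act_def by (intro sum.cong) auto
      also have "\<dots> = (if k' = k then v (dn i e) else 0)"
        using x by (simp add: sum.delta v_def)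
      finally show ?thesis using x(2) by (cases "k' = k") (simp_all add: act_fun_def)
    qed
    have "is_lead ?\<phi> (act_fun n q p \<kappa> ?A) x"
      unfolding is_lead_def
    proof (intro conjI allI impI)
      show "act_fun n q p \<kappa> ?A x \<noteq> 0" using v by (simp add: x act is_lead_def)
      fix y assume y: "act_fun n q p \<kappa> ?A y \<noteq> 0"
      obtain k' e where ye: "y = (k', e)" by (cases y)
      have kk: "k' = k" "v (dn i e) \<noteq> 0" using y unfolding ye act by (auto split: if_splits)
      then have "?w (dn i e) \<le> ?w t" using v by (simp add: is_lead_def)
      then have "?w e \<le> ?w (up i t)" using expweight_up[OF x(3), of "2 * (d + 2)" "dn i e"]
          expweight_up[OF x(3), of "2 * (d + 2)" t] by simp
      then show "?\<phi> y \<le> ?\<phi> x" using kk by (simp add: ye x mult_right_mono)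
    qed
    then show "x \<in> leads ?\<phi> ?S" unfolding leads_def using A by blast
  qed
  from leads_card_le[OF fsubspace_act_fun SY _ inj this]
  have "CARD('a) ^ (p * card ?W) \<le> card ?S" by (simp add: card_cartesian_product)
  then have "card {A \<in> fsupp ?H. act_fun n q p \<kappa> A = (\<lambda>_. 0)} * CARD('a) ^ (p * card ?W)
     \<le> card {A \<in> fsupp ?H. act_fun n q p \<kappa> A = (\<lambda>_. 0)} * card ?S" by simp
  also have "\<dots> = card (fsupp ?H :: (nat \<times> nat \<times> nat \<Rightarrow> 'a) set)"
    by (rule card_kernel_image[OF fsubspace_fsupp finite_fsupp[OF finH] act_fun_linear])
  finally show ?thesis by (simp add: card_fsupp[OF finH])
qed

text \<open>The \<open>+ 1\<close> in the strict growth, multiplied by \<open>p\<close> and divided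
  by \<open>d + 1\<close>, is worth at least D squared plus D, where D is the number of monomials. D
  squared pays for the choice of a basis of the span, and D is kept to sum over all sets
  \<open>T\<close>.\<close>

lemma row_leads_weight:
  assumes T: "T \<subseteq> mons n d" "T \<noteq> {}" "T \<noteq> mons n d" and d: "0 \<le> d"
    and qp: "int q * (d + 1) = int p * (d + 1 + int n)"
    and large: "(d + 1) * int (card (mons n d) * card (mons n d) + card (mons n d)) \<le> int p"
  shows "card T * card (mons n d) + q * card T + card (mons n d) \<le> p * card (upset n T)"
proof -
  let ?D = "int (card (mons n d))" and ?t = "int (card T)" and ?w = "int (card (upset n T))"
  have "int p * ((d + int n + 1) * ?t + 1) \<le> int p * ((d + 1) * ?w)"
    using upset_weight_strict[OF T d] by (intro mult_left_mono) auto
  moreover have "int p * ((d + int n + 1) * ?t + 1) = (d + 1) * (int q * ?t) + int p"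
  proof -
    have "int p * ((d + int n + 1) * ?t + 1) = (int p * (d + 1 + int n)) * ?t + int p" by (simp add: algebra_simps)
    then show ?thesis unfolding qp[symmetric] by (simp add: algebra_simps)
  qed
  moreover have "?t * ?D \<le> ?D * ?D" using card_mono[OF finite_mons T(1)] by (intro mult_right_mono) auto
  then have "(d + 1) * (?t * ?D) \<le> (d + 1) * (?D * ?D)" using d by (intro mult_left_mono) auto
  ultimately have "(d + 1) * (?t * ?D + int q * ?t + ?D) \<le> (d + 1) * (int p * ?w)"
    using large by (simp add: algebra_simps)
  then have "?t * ?D + int q * ?t + ?D \<le> int p * ?w" using d by (simp add: mult_le_cancel_left)
  then show ?thesis by (metis (mono_tags) of_nat_add of_nat_mult of_nat_le_iff)
qed

text \<open>Count the pairs of a matrix and a nonzero vector in its kernel. If no matrix were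
  injective, there would be at least two such vectors per matrix, whereas summing over the vectors
  gives fewer than twice the number of matrices.\<close>

lemma ex_inj_deg_finite_field:
  assumes c3: "CARD('a :: {field, finite}) \<ge> 3" and d: "0 \<le> d"
    and qp: "int q * (d + 1) = int p * (d + 1 + int n)"
    and large: "(d + 1) * int (card (mons n d) * card (mons n d) + card (mons n d)) \<le> int p"
  shows "\<exists>A :: _ \<Rightarrow> 'a. inj_deg n q p d A"
proof (rule ccontr)
  assume none: "\<not> ?thesis"
  let ?M = "mons n d" and ?H = "hom_index n q p"
  let ?c = "real CARD('a)" and ?Z = "card ?H" and ?D = "card ?M"
  let ?A = "fsupp ?H :: (nat \<times> nat \<times> nat \<Rightarrow> 'a) set"
  let ?K = "cvec n q d - {\<lambda>_ _. 0} :: (nat \<Rightarrow> (nat \<Rightarrow> int) \<Rightarrow> 'a) set"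
  let ?R = "\<lambda>\<kappa> A. act_fun n q p \<kappa> A = (\<lambda>_. 0)"
  have finH: "finite ?H" by (simp add: hom_index_def)
  have finA: "finite ?A" by (rule finite_fsupp[OF finH])
  have finK: "finite ?K" using finite_cvec by blast
  have c0: "?c > 0" "?c \<ge> 3" using c3 by simp_all
  obtain a :: 'a where a: "a \<noteq> 0" "a \<noteq> 1"
  proof -
    have "\<not> (UNIV :: 'a set) \<subseteq> {0, 1}"
    proof
      assume "(UNIV :: 'a set) \<subseteq> {0, 1}"
      then have "CARD('a) \<le> card {0, 1 :: 'a}" by (intro card_mono) auto
      then show False using c3 by simp
    qed
    then show thesis using that by blast
  qed
  \<comment> \<open>A nonzero kernel vector and its multiple by a scalar other than 0 and 1 are
    distinct; this is where at least three field elements are required.\<close>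
  have two: "2 \<le> card {\<kappa> \<in> ?K. ?R \<kappa> A}" for A :: "nat \<times> nat \<times> nat \<Rightarrow> 'a"
  proof -
    obtain \<kappa> where \<kappa>: "\<kappa> \<in> cvec n q d" "\<forall>k<p. \<forall>e. act n q A \<kappa> k e = 0" "\<not> (\<forall>j e. \<kappa> j e = 0)"
      using none unfolding inj_deg_def by blast
    let ?\<kappa>' = "\<lambda>j e. a * \<kappa> j e"
    obtain j e where je: "\<kappa> j e \<noteq> 0" using \<kappa>(3) by blast
    have "\<kappa> j e \<noteq> ?\<kappa>' j e" using je a by simp
    then have neq: "\<kappa> \<noteq> ?\<kappa>'" by metis
    have "{\<kappa>, ?\<kappa>'} \<subseteq> {\<kappa> \<in> ?K. ?R \<kappa> A}"
    proof -
      have "\<kappa> \<noteq> (\<lambda>_ _. 0)" "?\<kappa>' \<noteq> (\<lambda>_ _. 0)" using je a by (auto dest!: fun_cong[of _ _ j] fun_cong[of _ _ e])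
      moreover have "?\<kappa>' \<in> cvec n q d" using \<kappa>(1) by (auto simp: cvec_def)
      moreover have "?R \<kappa> A" "?R ?\<kappa>' A" using \<kappa>(2) by (auto simp: act_fun_def act_scale)
      ultimately show ?thesis using \<kappa>(1) by simp
    qed
    then have "card {\<kappa>, ?\<kappa>'} \<le> card {\<kappa> \<in> ?K. ?R \<kappa> A}" using finK by (intro card_mono) auto
    then show ?thesis using neq by simp
  qed
  have "2 * ?c ^ ?Z = (\<Sum>A\<in>?A. 2)" by (simp add: card_fsupp[OF finH])
  also have "\<dots> \<le> (\<Sum>A\<in>?A. real (card {\<kappa> \<in> ?K. ?R \<kappa> A}))"
    using of_nat_mono[OF two, where 'a = real] by (intro sum_mono) simp
  also have "\<dots> = (\<Sum>A\<in>?A. \<Sum>\<kappa>\<in>?K. if ?R \<kappa> A then 1 else 0)"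
    using finK by (simp add: sum.If_cases Int_def)
  also have "\<dots> = (\<Sum>\<kappa>\<in>?K. \<Sum>A\<in>?A. if ?R \<kappa> A then 1 else 0)" by (rule sum.swap)
  also have "\<dots> = (\<Sum>\<kappa>\<in>?K. real (card {A \<in> ?A. ?R \<kappa> A}))"
    using finA by (simp add: sum.If_cases Int_def)
  also have "\<dots> \<le> (\<Sum>\<kappa>\<in>?K. ?c ^ ?Z / ?c ^ (p * card (upset n (row_leads n q d \<kappa>))))"
  proof (rule sum_mono)
    fix \<kappa> assume "\<kappa> \<in> ?K"
    then have "real (card {A \<in> ?A. ?R \<kappa> A} * CARD('a) ^ (p * card (upset n (row_leads n q d \<kappa>)))) \<le> real (CARD('a) ^ ?Z)"
      using card_kernel_act_fun[of \<kappa> n q d p] unfolding of_nat_le_iff by auto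
    then show "real (card {A \<in> ?A. ?R \<kappa> A}) \<le> ?c ^ ?Z / ?c ^ (p * card (upset n (row_leads n q d \<kappa>)))"
      using c0 by (simp add: field_simps)
  qed
  \<comment> \<open>The bound on the annihilating matrices depends on \<kappa> only through its
    leading monomials, so the vectors are grouped by that set.\<close>
  also have "\<dots> = (\<Sum>T\<in>Pow ?M - {{}}. \<Sum>\<kappa>\<in>{\<kappa> \<in> ?K. row_leads n q d \<kappa> = T}.
       ?c ^ ?Z / ?c ^ (p * card (upset n (row_leads n q d \<kappa>))))"
  proof (intro sum.group[symmetric] finK)
    show "row_leads n q d ` ?K \<subseteq> Pow ?M - {{}}"
    proof
      fix T assume "T \<in> row_leads n q d ` ?K"
      then obtain \<kappa> :: "nat \<Rightarrow> (nat \<Rightarrow> int) \<Rightarrow> 'a" where "\<kappa> \<in> cvec n q d" "\<kappa> \<noteq> (\<lambda>_ _. 0)" "T = row_leads n q d \<kappa>" by blast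
      then show "T \<in> Pow ?M - {{}}" using row_leads_subset[of \<kappa> n q d] row_leads_empty[of \<kappa> n q d] by auto
    qed
  qed simp
  also have "\<dots> = (\<Sum>T\<in>Pow ?M - {{}}. real (card {\<kappa> \<in> ?K. row_leads n q d \<kappa> = T}) * (?c ^ ?Z / ?c ^ (p * card (upset n T))))"
    by (intro sum.cong) auto
  \<comment> \<open>If all monomials lead, the number of vectors is at most the factor lost by the
    matrices, since the system is square; the group contributes at most one vector per matrix on
    average. Every other group gains the spare factor with exponent \<open>?D\<close>.\<close>
  also have "\<dots> \<le> (\<Sum>T\<in>Pow ?M - {{}}. if T = ?M then ?c ^ ?Z else ?c ^ ?Z / ?c ^ ?D)"
  proof (rule sum_mono)
    fix T assume T: "T \<in> Pow ?M - {{}}"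
    have sub: "{\<kappa> \<in> ?K. row_leads n q d \<kappa> = T} \<subseteq> {\<kappa> \<in> cvec n q d. row_leads n q d \<kappa> = T}" by blast
    show "real (card {\<kappa> \<in> ?K. row_leads n q d \<kappa> = T}) * (?c ^ ?Z / ?c ^ (p * card (upset n T)))
       \<le> (if T = ?M then ?c ^ ?Z else ?c ^ ?Z / ?c ^ ?D)"
    proof (cases "T = ?M")
      case True
      have "card {\<kappa> \<in> ?K. row_leads n q d \<kappa> = T} \<le> card (cvec n q d :: (nat \<Rightarrow> (nat \<Rightarrow> int) \<Rightarrow> 'a) set)"
        by (intro card_mono finite_cvec) auto
      then have "real (card {\<kappa> \<in> ?K. row_leads n q d \<kappa> = T}) \<le> real (CARD('a) ^ (q * ?D))"
        unfolding card_cvec by (rule of_nat_mono)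
      then have "real (card {\<kappa> \<in> ?K. row_leads n q d \<kappa> = T}) \<le> ?c ^ (q * ?D)" by simp
      moreover have "p * card (upset n T) = q * ?D"
      proof -
        have "int p * ((d + 1) * int (card (mons n (d + 1)))) = (int p * (d + 1 + int n)) * int ?D"
          using card_mons_Suc[OF d, of n] by (simp add: algebra_simps)
        then have "(d + 1) * (int p * int (card (mons n (d + 1)))) = (d + 1) * (int q * int ?D)"
          unfolding qp[symmetric] by (simp add: algebra_simps)
        then have "int p * int (card (mons n (d + 1))) = int q * int ?D" using d by simp
        then show ?thesis using True upset_mons_eq[OF d, of n] by (metis of_nat_eq_iff of_nat_mult)
      qed
      ultimately show ?thesis using True c0 by (simp add: field_simps mult_right_mono)
    next
      case False
      have le: "card T * ?D + q * card T + ?D \<le> p * card (upset n T)"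
        using row_leads_weight[OF _ _ False d qp large] T by blast
      have "card {\<kappa> \<in> ?K. row_leads n q d \<kappa> = T} \<le> CARD('a) ^ (card T * ?D + q * card T)"
        by (rule order_trans[OF card_mono[OF _ sub] card_row_leads]) (rule finite_subset[OF _ finite_cvec], blast)
      then have "real (card {\<kappa> \<in> ?K. row_leads n q d \<kappa> = T}) \<le> real (CARD('a) ^ (card T * ?D + q * card T))"
        by (rule of_nat_mono)
      then have "real (card {\<kappa> \<in> ?K. row_leads n q d \<kappa> = T}) \<le> ?c ^ (card T * ?D + q * card T)" by simp
      then have "real (card {\<kappa> \<in> ?K. row_leads n q d \<kappa> = T}) * ?c ^ ?D \<le> ?c ^ (card T * ?D + q * card T) * ?c ^ ?D"
        using c0 by (intro mult_right_mono) auto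
      also have "\<dots> \<le> ?c ^ (p * card (upset n T))"
        unfolding power_add[symmetric] using c0 le by (intro power_increasing) auto
      finally have "real (card {\<kappa> \<in> ?K. row_leads n q d \<kappa> = T}) * ?c ^ ?D * ?c ^ ?Z \<le> ?c ^ (p * card (upset n T)) * ?c ^ ?Z"
        using c0 by (intro mult_right_mono) auto
      then show ?thesis using False c0 by (simp add: field_simps)
    qed
  qed
  also have "\<dots> \<le> (\<Sum>T\<in>insert ?M (Pow ?M - {{}, ?M}). if T = ?M then ?c ^ ?Z else ?c ^ ?Z / ?c ^ ?D)"
    using c0 by (intro sum_mono2) auto
  also have "\<dots> = ?c ^ ?Z + (\<Sum>T\<in>Pow ?M - {{}, ?M}. ?c ^ ?Z / ?c ^ ?D)"
    by (subst sum.insert) (auto intro!: sum.cong)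
  also have "\<dots> = ?c ^ ?Z + real (card (Pow ?M - {{}, ?M})) * (?c ^ ?Z / ?c ^ ?D)" by simp
  \<comment> \<open>There are fewer than 2 to the power \<open>?D\<close> remaining groups, so even
    together they stay below one vector per matrix.\<close>
  also have "\<dots> < ?c ^ ?Z + ?c ^ ?D * (?c ^ ?Z / ?c ^ ?D)"
  proof -
    have "card (Pow ?M - {{}, ?M}) < card (Pow ?M)" by (intro psubset_card_mono) auto
    then have "card (Pow ?M - {{}, ?M}) < 2 ^ ?D" by (simp add: card_Pow)
    then have "real (card (Pow ?M - {{}, ?M})) < 2 ^ ?D"
      by (metis of_nat_less_iff of_nat_numeral of_nat_power)
    also have "(2 :: real) ^ ?D \<le> ?c ^ ?D" using c0 by (intro power_mono) auto
    finally show ?thesis using c0 by (intro add_strict_left_mono mult_strict_right_mono) auto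
  qed
  also have "\<dots> = 2 * ?c ^ ?Z" using c0 by simp
  finally show False by simp
qed


section \<open>The field with three elements and the lift to characteristic zero\<close>

datatype gf3 = Zero3 | One3 | Two3

lemma gf3_UNIV: "(UNIV :: gf3 set) = {Zero3, One3, Two3}"
  using gf3.exhaust by auto

instantiation gf3 :: "{field, finite}"
begin

definition "zero_gf3 = Zero3"
definition "one_gf3 = One3"
definition plus_gf3 :: "gf3 \<Rightarrow> gf3 \<Rightarrow> gf3" where
  "plus_gf3 x y = (case x of Zero3 \<Rightarrow> y
     | One3 \<Rightarrow> (case y of Zero3 \<Rightarrow> One3 | One3 \<Rightarrow> Two3 | Two3 \<Rightarrow> Zero3)
     | Two3 \<Rightarrow> (case y of Zero3 \<Rightarrow> Two3 | One3 \<Rightarrow> Zero3 | Two3 \<Rightarrow> One3))"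
definition uminus_gf3 :: "gf3 \<Rightarrow> gf3" where
  "uminus_gf3 x = (case x of Zero3 \<Rightarrow> Zero3 | One3 \<Rightarrow> Two3 | Two3 \<Rightarrow> One3)"
definition minus_gf3 :: "gf3 \<Rightarrow> gf3 \<Rightarrow> gf3" where
  "minus_gf3 x y = x + (- y)"
definition times_gf3 :: "gf3 \<Rightarrow> gf3 \<Rightarrow> gf3" where
  "times_gf3 x y = (case x of Zero3 \<Rightarrow> Zero3 | One3 \<Rightarrow> y | Two3 \<Rightarrow> - y)"
text \<open>Both nonzero elements square to 1, and the inverse of 0 is 0 by convention.\<close>

definition inverse_gf3 :: "gf3 \<Rightarrow> gf3" where
  "inverse_gf3 x = x"
definition divide_gf3 :: "gf3 \<Rightarrow> gf3 \<Rightarrow> gf3" where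
  "divide_gf3 x y = x * inverse y"

instance
  by standard
    (auto simp: gf3_UNIV zero_gf3_def one_gf3_def plus_gf3_def uminus_gf3_def minus_gf3_def
      times_gf3_def inverse_gf3_def divide_gf3_def split: gf3.splits)

end

lemma gf3_of_int: "\<exists>z. (x :: gf3) = of_int z"
proof (cases x)
  case Zero3
  then show ?thesis by (intro exI[of _ 0]) (simp add: zero_gf3_def)
next
  case One3
  then show ?thesis by (intro exI[of _ 1]) (simp add: one_gf3_def)
next
  case Two3
  then show ?thesis by (intro exI[of _ "- 1"]) (simp add: one_gf3_def uminus_gf3_def)
qed

lemma lmat_of_int: "lmat n (\<lambda>x. of_int (A x) :: 'a :: comm_ring_1) y x = of_int (lmat n A y x)"
  by (simp add: lmat_def if_distrib[of of_int] cong: if_cong)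

text \<open>In the square case injectivity is the nonvanishing of a single determinant, formed in
  the same way over every field; this is what makes it comparable across characteristics.\<close>

lemma inj_deg_square:
  assumes "bij_betw h ({..<q} \<times> mons n d) ({..<p} \<times> mons n (d + 1))"
  shows "inj_deg n q p d (A :: _ \<Rightarrow> 'a :: field) \<longleftrightarrow> fdet ({..<q} \<times> mons n d) (\<lambda>x. lmat n A (h x)) \<noteq> 0"
proof -
  let ?X = "{..<q} \<times> mons n d" and ?Y = "{..<p} \<times> mons n (d + 1)"
  have "?Y = h ` ?X" using assms by (simp add: bij_betw_def)
  then have *: "(\<forall>y\<in>?Y. P y) \<longleftrightarrow> (\<forall>x\<in>?X. P (h x))" for P by (simp only: ball_simps)
  have fX: "finite ?X" by simp
  show ?thesis unfolding fdet_zero_iff[OF fX] inj_deg_lmat * by blast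
qed

text \<open>A determinant that is nonzero modulo 3 is a nonzero integer.\<close>

lemma ex_inj_deg_critical:
  assumes d: "0 \<le> d"
    and qp: "int q * (d + 1) = int p * (d + 1 + int n)"
    and large: "(d + 1) * int (card (mons n d) * card (mons n d) + card (mons n d)) \<le> int p"
  shows "\<exists>A :: lin_matrix. inj_deg n q p d A"
proof -
  have "CARD(gf3) = 3" by (simp add: gf3_UNIV)
  then obtain A :: "_ \<Rightarrow> gf3" where A: "inj_deg n q p d A"
    using ex_inj_deg_finite_field[OF _ d qp large, where 'a = gf3] by auto
  have "\<forall>x. \<exists>z. A x = of_int z" by (intro allI gf3_of_int)
  from choice[OF this] obtain Z where "\<forall>x. A x = of_int (Z x)" ..
  then have Z: "A = (\<lambda>x. of_int (Z x))" by (intro ext) (rule spec)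
  have "int p * ((d + 1) * int (card (mons n (d + 1)))) = (int p * (d + 1 + int n)) * int (card (mons n d))"
    using card_mons_Suc[OF d, of n] by (simp add: algebra_simps)
  then have "(d + 1) * (int p * int (card (mons n (d + 1)))) = (d + 1) * (int q * int (card (mons n d)))"
    unfolding qp[symmetric] by (simp add: algebra_simps)
  then have "int p * int (card (mons n (d + 1))) = int q * int (card (mons n d))" using d by simp
  then have "card ({..<q} \<times> mons n d) = card ({..<p} \<times> mons n (d + 1))"
    by (simp add: card_cartesian_product) (metis of_nat_eq_iff of_nat_mult)
  then obtain h where h: "bij_betw h ({..<q} \<times> mons n d) ({..<p} \<times> mons n (d + 1))"
    using finite_same_card_bij[of "{..<q} \<times> mons n d" "{..<p} \<times> mons n (d + 1)"] by auto
  have "fdet ({..<q} \<times> mons n d) (\<lambda>x. lmat n Z (h x)) \<noteq> 0"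
    using A unfolding inj_deg_square[OF h] Z lmat_of_int fdet_of_int by auto
  then have "inj_deg n q p d (\<lambda>x. of_int (Z x) :: complex)"
    unfolding inj_deg_square[OF h] lmat_of_int fdet_of_int by simp
  then show ?thesis by blast
qed

section \<open>Laurent polynomials and interpolation\<close>

definition lmon :: "nat \<Rightarrow> (nat \<Rightarrow> int) \<Rightarrow> point \<Rightarrow> complex" where
  "lmon n e x = (\<Prod>i\<le>n. x i powi e i)"

definition leval :: "nat \<Rightarrow> ((nat \<Rightarrow> int) \<Rightarrow> complex) \<Rightarrow> point \<Rightarrow> complex" where
  "leval n c x = (\<Sum>e | c e \<noteq> 0. c e * lmon n e x)"

lemma leval_superset:
  assumes "finite S" "{e. c e \<noteq> 0} \<subseteq> S"
  shows "leval n c x = (\<Sum>e\<in>S. c e * lmon n e x)"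
  unfolding leval_def by (rule sum.mono_neutral_left) (use assms in auto)

lemma leval_sum:
  assumes "finite S" "\<And>s. s \<in> S \<Longrightarrow> finite {e. c s e \<noteq> 0}"
  shows "leval n (\<lambda>e. \<Sum>s\<in>S. c s e) x = (\<Sum>s\<in>S. leval n (c s) x)"
proof -
  let ?E = "\<Union>s\<in>S. {e. c s e \<noteq> 0}"
  have E: "finite ?E" using assms by blast
  have "{e. (\<Sum>s\<in>S. c s e) \<noteq> 0} \<subseteq> ?E"
    using sum.neutral[of S] by fastforce
  then have "leval n (\<lambda>e. \<Sum>s\<in>S. c s e) x = (\<Sum>e\<in>?E. \<Sum>s\<in>S. c s e * lmon n e x)"
    by (subst leval_superset[OF E]) (auto simp: sum_distrib_right)
  also have "\<dots> = (\<Sum>s\<in>S. \<Sum>e\<in>?E. c s e * lmon n e x)" by (rule sum.swap)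
  also have "\<dots> = (\<Sum>s\<in>S. leval n (c s) x)"
    by (intro sum.cong refl leval_superset[OF E, symmetric]) auto
  finally show ?thesis .
qed

lemma leval_single: "leval n (\<lambda>e. if e = e0 then a else 0) x = a * lmon n e0 x"
  by (subst leval_superset[of "{e0}"]) auto

lemma leval_scale: "leval n (\<lambda>e. a * c e) x = a * leval n c x"
  by (cases "a = 0") (simp_all add: leval_def sum_distrib_left mult.assoc)

lemma leval_add:
  assumes "finite {e. c e \<noteq> 0}" "finite {e. c' e \<noteq> 0}"
  shows "leval n (\<lambda>e. c e + c' e) x = leval n c x + leval n c' x"
proof -
  have E: "finite ({e. c e \<noteq> 0} \<union> {e. c' e \<noteq> 0})" using assms by simp
  show ?thesis
    by (subst (1 2 3) leval_superset[OF E]) (auto simp: distrib_right sum.distrib)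
qed

text \<open>Kronecker substitution: the exponents are finitely many and bounded, so distinct
  monomials become distinct powers of one variable, and a polynomial in one variable with infinitely
  many zeros vanishes.\<close>

lemma leval_zero_imp:
  assumes fin: "finite {e. c e \<noteq> 0}" and supp: "\<And>e i. c e \<noteq> 0 \<Longrightarrow> n < i \<Longrightarrow> e i = 0"
    and z: "\<And>x. x \<in> chart n {..n} \<Longrightarrow> leval n c x = 0"
  shows "c e0 = 0"
proof (rule ccontr)
  assume e0: "c e0 \<noteq> 0"
  let ?S = "{e. c e \<noteq> 0}"
  define C where "C = Max (insert 0 ((\<lambda>(e, i). \<bar>e i\<bar>) ` (?S \<times> {..n}))) + 1"
  have C: "\<bar>e i\<bar> < C" if "e \<in> ?S" "i \<le> n" for e i
  proof -
    have "\<bar>e i\<bar> \<le> Max (insert 0 ((\<lambda>(e, i). \<bar>e i\<bar>) ` (?S \<times> {..n})))"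
      using fin that by (intro Max_ge) auto
    then show ?thesis by (simp add: C_def)
  qed
  let ?B = "2 * C"
  have inj: "inj_on (expweight n ?B) ?S"
    by (rule expweight_inj[of _ n C]) (use C supp in auto)
  \<comment> \<open>A common shift that makes all substituted exponents nonnegative, so that an
    ordinary polynomial results.\<close>
  define N where "N = Max (insert 0 ((\<lambda>e. - expweight n ?B e) ` ?S))"
  have N: "0 \<le> expweight n ?B e + N" if "e \<in> ?S" for e
  proof -
    have "- expweight n ?B e \<le> N" unfolding N_def using fin that by (intro Max_ge) auto
    then show ?thesis by simp
  qed
  define P where "P = (\<Sum>e\<in>?S. monom (c e) (nat (expweight n ?B e + N)))"
  have "poly P z = 0" if "z \<noteq> 0" for z
  proof -
    let ?x = "\<lambda>i. if i \<le> n then z powi (?B ^ i) else 0"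
    have x: "?x \<in> chart n {..n}" using that by (auto simp: chart_def proj_space_def affine_space_def fun_eq_iff intro!: exI[of _ 0])
    have lm: "lmon n e ?x = z powi expweight n ?B e" for e
    proof -
      have "lmon n e ?x = (\<Prod>i\<le>n. z powi (e i * ?B ^ i))"
        unfolding lmon_def by (intro prod.cong) (simp_all add: power_int_mult[symmetric] mult.commute)
      also have "\<dots> = z powi (\<Sum>i\<le>n. e i * ?B ^ i)"
        using that by (induction n) (simp_all add: power_int_add)
      finally show ?thesis by (simp add: expweight_def)
    qed
    have "poly P z = (\<Sum>e\<in>?S. c e * z ^ nat (expweight n ?B e + N))"
      by (simp add: P_def poly_sum poly_monom)
    also have "\<dots> = (\<Sum>e\<in>?S. z powi N * (c e * lmon n e ?x))"
    proof (rule sum.cong[OF refl])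
      fix e assume "e \<in> ?S"
      then have "z ^ nat (expweight n ?B e + N) = z powi (expweight n ?B e + N)"
        using N[of e] by (subst power_int_nonneg_exp) auto
      also have "\<dots> = z powi expweight n ?B e * z powi N" using that by (simp add: power_int_add)
      finally show "c e * z ^ nat (expweight n ?B e + N) = z powi N * (c e * lmon n e ?x)"
        by (simp add: lm)
    qed
    also have "\<dots> = z powi N * leval n c ?x" by (simp add: leval_def sum_distrib_left)
    also have "\<dots> = 0" using z[OF x] by simp
    finally show ?thesis .
  qed
  then have "UNIV - {0} \<subseteq> {z. poly P z = 0}" by auto
  moreover have "infinite (UNIV - {0 :: complex})" by (simp add: infinite_UNIV_char_0)
  ultimately have "P = 0" using poly_roots_finite[of P] finite_subset by blast
  then have "0 = coeff P (nat (expweight n ?B e0 + N))" by simp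
  also have "\<dots> = (\<Sum>e\<in>?S. if e = e0 then c e else 0)"
    unfolding P_def coeff_sum coeff_monom
  proof (rule sum.cong[OF refl])
    fix e assume e: "e \<in> ?S"
    have "nat (expweight n ?B e + N) = nat (expweight n ?B e0 + N) \<longleftrightarrow> e = e0"
      using N[OF e] N[of e0] e0 e inj by (auto simp: eq_nat_nat_iff inj_on_def)
    then show "(if nat (expweight n ?B e + N) = nat (expweight n ?B e0 + N) then c e else 0) = (if e = e0 then c e else 0)"
      by simp
  qed
  also have "\<dots> = c e0" using fin e0 by simp
  finally show False using e0 by simp
qed

text \<open>Split off the full power of the variable; the cofactor has no root at all and is
  constant by the fundamental theorem of algebra.\<close>

lemma root_free_poly:
  fixes h :: "complex poly"
  assumes "h \<noteq> 0" "\<And>T. T \<noteq> 0 \<Longrightarrow> poly h T \<noteq> 0"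
  shows "\<exists>a k. a \<noteq> 0 \<and> k \<le> degree h \<and> h = monom a k \<and> (poly h 0 \<noteq> 0 \<longrightarrow> k = 0)"
proof -
  obtain g where g: "h = [:- 0, 1:] ^ order 0 h * g" "\<not> [:- 0, 1:] dvd g"
    using order_decomp[OF assms(1)] by blast
  have g0: "poly g 0 \<noteq> 0" using g(2) by (simp only: poly_eq_0_iff_dvd not_False_eq_True)
  have "poly g T \<noteq> 0" for T
  proof (cases "T = 0")
    case False
    then have "poly h T \<noteq> 0" by (rule assms(2))
    then show ?thesis by (subst (asm) g(1)) auto
  qed (use g0 in simp)
  then have "constant (poly g)" using fundamental_theorem_of_algebra by blast
  then have "degree g = 0" by (simp add: constant_degree)
  then obtain a where a: "g = [:a:]" using degree_eq_zeroE by blast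
  have "a \<noteq> 0" using g0 a by simp
  moreover have "[:- 0, 1:] ^ k * [:a:] = monom a k" for k
    by (simp add: monom_altdef)
  then have h: "h = monom a (order 0 h)" using g(1) a by metis
  moreover have "order 0 h \<le> degree h" by (subst (2) h) (simp add: degree_monom_eq \<open>a \<noteq> 0\<close>)
  moreover have "poly h 0 \<noteq> 0 \<longrightarrow> order 0 h = 0" by (simp add: order_root)
  ultimately show ?thesis by blast
qed

text \<open>Among all denominators choose one of minimal degree: it has no root in \<open>Z\<close>, since a linear
  factor vanishing at a point of \<open>Z\<close> could be cancelled.\<close>

lemma regular_one_var:
  fixes \<phi> :: "complex \<Rightarrow> complex" and g0 h0 :: "complex poly"
  assumes Z: "Z = UNIV \<or> Z = - {0}" and h0: "h0 \<noteq> 0" "\<And>T. T \<in> Z \<Longrightarrow> \<phi> T * poly h0 T = poly g0 T"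
    and loc: "\<And>T. T \<in> Z \<Longrightarrow> \<exists>g h. poly h T \<noteq> 0 \<and> (\<forall>T'\<in>Z. \<phi> T' * poly h T' = poly g T')"
    and E: "degree h0 \<le> E"
  shows "\<exists>P. degree P \<le> degree g0 + E \<and> (\<forall>T\<in>Z. \<phi> T * (if Z = UNIV then 1 else T ^ E) = poly P T)"
proof -
  have infZ: "infinite Z" using Z by (auto simp: infinite_UNIV_char_0 Compl_eq_Diff_UNIV)
  have polyeq: "p = q" if "\<And>T. T \<in> Z \<Longrightarrow> poly p T = poly q T" for p q :: "complex poly"
  proof -
    have "Z \<subseteq> {T. poly (p - q) T = 0}" using that by auto
    then have "p - q = 0" using infZ poly_roots_finite[of "p - q"] finite_subset by blast
    then show ?thesis by simp
  qed
  define Q where "Q d \<longleftrightarrow> (\<exists>g h. h \<noteq> 0 \<and> degree h = d \<and> (\<forall>T\<in>Z. \<phi> T * poly h T = poly g T))" for d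
  have Q0: "Q (degree h0)" unfolding Q_def using h0 by blast
  obtain g1 h1 where gh1: "h1 \<noteq> 0" "degree h1 = (LEAST d. Q d)" "\<And>T. T \<in> Z \<Longrightarrow> \<phi> T * poly h1 T = poly g1 T"
    using LeastI[of Q, OF Q0] unfolding Q_def by blast
  have nz: "poly h1 T0 \<noteq> 0" if T0: "T0 \<in> Z" for T0
  proof
    assume r: "poly h1 T0 = 0"
    obtain g h where gh: "poly h T0 \<noteq> 0" "\<And>T. T \<in> Z \<Longrightarrow> \<phi> T * poly h T = poly g T"
      using loc[OF T0] by blast
    have "poly (g * h1) T = poly (g1 * h) T" if "T \<in> Z" for T
    proof -
      have "poly g T * poly h1 T = \<phi> T * poly h T * poly h1 T" using gh(2)[OF that] by simp
      also have "\<dots> = poly g1 T * poly h T" using gh1(3)[OF that] by (simp add: mult_ac)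
      finally show ?thesis by simp
    qed
    then have eq: "g * h1 = g1 * h" by (rule polyeq)
    have "poly g1 T0 * poly h T0 = 0" using arg_cong[OF eq, of "\<lambda>p. poly p T0"] r by simp
    then have "poly g1 T0 = 0" using gh(1) by simp
    then obtain g2 where g2: "g1 = [:- T0, 1:] * g2" unfolding poly_eq_0_iff_dvd by (auto elim: dvdE)
    obtain h2 where h2: "h1 = [:- T0, 1:] * h2" using r unfolding poly_eq_0_iff_dvd by (auto elim: dvdE)
    have h20: "h2 \<noteq> 0" using h2 gh1(1) by auto
    have "[:- T0, 1:] * (g * h2) = [:- T0, 1:] * (g2 * h)" using eq unfolding g2 h2 by (simp only: mult_ac)
    then have eq2: "g * h2 = g2 * h" by (subst (asm) mult_cancel_left) simp
    have "\<phi> T * poly h2 T = poly g2 T" if "T \<in> Z" for T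
    proof (cases "T = T0")
      \<comment> \<open>At \<open>T0\<close> itself the linear factor is zero and cannot be divided
        out; the local fraction with \<open>h\<close> nonzero at \<open>T0\<close> supplies the
        identity there.\<close>
      case True
      have "(\<phi> T * poly h2 T) * poly h T = poly g T * poly h2 T" using gh(2)[OF that] by (simp add: mult_ac)
      also have "\<dots> = poly g2 T * poly h T" using arg_cong[OF eq2, of "\<lambda>p. poly p T"] by simp
      finally show ?thesis using gh(1) True by simp
    next
      case False
      have "(T - T0) * (\<phi> T * poly h2 T) = (T - T0) * poly g2 T"
        using gh1(3)[OF that] unfolding g2 h2 by (simp add: algebra_simps)
      then show ?thesis using False by simp
    qed
    then have "Q (degree h2)" unfolding Q_def using h20 by blast
    moreover have "degree h2 < (LEAST d. Q d)"
      unfolding gh1(2)[symmetric] h2 using h20 by (subst degree_mult_eq) auto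
    ultimately show False using not_less_Least by blast
  qed
  have "poly h1 T \<noteq> 0" if "T \<noteq> 0" for T using nz that Z by auto
  then obtain a k where ak: "a \<noteq> 0" "k \<le> degree h1" "h1 = monom a k" "poly h1 0 \<noteq> 0 \<longrightarrow> k = 0"
    using root_free_poly[OF gh1(1)] by blast
  have dh: "degree h1 \<le> degree h0" unfolding gh1(2) by (rule Least_le) (rule Q0)
  \<comment> \<open>The degree of the reduced numerator is controlled by the original fraction. A
    bound of this kind, uniform over all parallel lines, later fixes the number of interpolation
    nodes.\<close>
  have dg: "degree g1 \<le> degree g0"
  proof (cases "g1 = 0")
    case False
    have eq: "g1 * h0 = g0 * h1"
    proof (rule polyeq)
      fix T assume T: "T \<in> Z"
      have "poly g1 T * poly h0 T = \<phi> T * poly h1 T * poly h0 T" using gh1(3)[OF T] by simp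
      also have "\<dots> = poly g0 T * poly h1 T" using h0(2)[OF T] by (simp add: mult_ac)
      finally show "poly (g1 * h0) T = poly (g0 * h1) T" by simp
    qed
    then have "g0 \<noteq> 0" using False h0(1) by auto
    then have "degree g1 + degree h0 = degree g0 + degree h1"
      using eq False h0(1) gh1(1) by (metis degree_mult_eq)
    then show ?thesis using dh by simp
  qed simp
  have kE: "k \<le> E" using ak(2) dh E by simp
  show ?thesis
  proof (cases "Z = UNIV")
    case True
    then have "k = 0" using ak(4) nz by auto
    then have "\<phi> T * 1 = poly (smult (1 / a) g1) T" for T
      using gh1(3)[of T] True ak by (simp add: poly_monom field_simps)
    then show ?thesis using True dg by (intro exI[of _ "smult (1 / a) g1"]) auto
  next
    case False
    then have Z0: "Z = - {0}" using Z by simp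
    let ?P = "smult (1 / a) (g1 * monom 1 (E - k))"
    have "\<phi> T * T ^ E = poly ?P T" if "T \<in> Z" for T
    proof -
      have "T ^ E = T ^ k * T ^ (E - k)" using kE by (simp add: power_add[symmetric])
      then have "\<phi> T * T ^ E = (1 / a) * (\<phi> T * poly h1 T) * T ^ (E - k)"
        using ak by (simp add: poly_monom)
      also have "\<dots> = poly ?P T" using gh1(3)[OF that] by (simp add: poly_monom)
      finally show ?thesis .
    qed
    moreover have "degree ?P \<le> degree g0 + E"
    proof -
      have "degree (g1 * monom 1 (E - k)) \<le> degree g1 + degree (monom 1 (E - k) :: complex poly)" by (rule degree_mult_le)
      also have "\<dots> \<le> degree g0 + E" using dg by (intro add_mono) (auto simp: degree_monom_eq)
      finally show ?thesis by (rule order_trans[OF degree_smult_le])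
    qed
    ultimately show ?thesis using False by (intro exI[of _ ?P]) auto
  qed
qed

text \<open>The Lagrange basis for the nodes 1, ..., N + 1. Starting at 1 keeps the nodes off zero,
  so they also lie in the punctured line.\<close>

definition lagrange :: "nat \<Rightarrow> nat \<Rightarrow> complex poly" where
  "lagrange N l = (\<Prod>m\<in>{..N} - {l}. [:- of_nat (Suc m) / (of_nat l - of_nat m), 1 / (of_nat l - of_nat m):])"

lemma lagrange_interpolation:
  assumes "degree P \<le> N"
  shows "P = (\<Sum>l\<le>N. smult (poly P (of_nat (Suc l))) (lagrange N l))"
proof -
  have pe: "poly [:- a / d, 1 / d:] b = (b - a) / d" for a b d :: complex
    by (simp add: diff_divide_distrib)
  have node: "poly (lagrange N l) (of_nat (Suc m)) = (if m = l then 1 else 0)" if "m \<le> N" for l m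
  proof (cases "m = l")
    case True
    have "poly (lagrange N l) (of_nat (Suc l)) = (\<Prod>m\<in>{..N} - {l}. 1)"
      unfolding lagrange_def poly_prod
    proof (rule prod.cong[OF refl])
      fix m assume "m \<in> {..N} - {l}"
      then have ne: "of_nat l - of_nat m \<noteq> (0 :: complex)" by auto
      show "poly [:- of_nat (Suc m) / (of_nat l - of_nat m), 1 / (of_nat l - of_nat m):] (of_nat (Suc l)) = (1 :: complex)"
        unfolding pe using ne by simp
    qed
    then show ?thesis using True by simp
  next
    case False
    have "poly (lagrange N l) (of_nat (Suc m))
      = (\<Prod>m'\<in>{..N} - {l}. (of_nat (Suc m) - of_nat (Suc m')) / (of_nat l - of_nat m'))"
      by (simp only: lagrange_def poly_prod pe)
    also have "\<dots> = 0" by (rule prod_zero) (use that False in \<open>auto intro!: bexI[of _ m]\<close>)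
    finally show ?thesis using False by simp
  qed
  have dl: "degree (lagrange N l) \<le> N" if "l \<le> N" for l
  proof -
    have "degree (lagrange N l) \<le> (\<Sum>m\<in>{..N} - {l}. degree [:- of_nat (Suc m) / (of_nat l - of_nat m), 1 / (of_nat l - of_nat m) :: complex:])"
      unfolding lagrange_def by (rule order_trans[OF degree_prod_sum_le]) auto
    also have "\<dots> \<le> (\<Sum>m\<in>{..N} - {l}. 1)" by (intro sum_mono) auto
    also have "\<dots> \<le> N" using that by simp
    finally show ?thesis .
  qed
  show ?thesis
  proof (rule poly_eqI_degree[where A = "(\<lambda>m. of_nat (Suc m)) ` {..N}"])
    fix x assume "x \<in> (\<lambda>m. of_nat (Suc m) :: complex) ` {..N}"
    then obtain m where m: "m \<le> N" "x = of_nat (Suc m)" by auto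
    have "poly (\<Sum>l\<le>N. smult (poly P (of_nat (Suc l))) (lagrange N l)) x
      = (\<Sum>l\<le>N. if l = m then poly P x else 0)"
      unfolding poly_sum m(2) poly_smult node[OF m(1)] by (intro sum.cong) auto
    then show "poly P x = poly (\<Sum>l\<le>N. smult (poly P (of_nat (Suc l))) (lagrange N l)) x"
      using m(1) by simp
  next
    have c: "card ((\<lambda>m. of_nat (Suc m) :: complex) ` {..N}) = Suc N"
      by (subst card_image) (auto simp: inj_on_def)
    show "degree P < card ((\<lambda>m. of_nat (Suc m) :: complex) ` {..N})" using assms c by simp
    have "degree (\<Sum>l\<le>N. smult (poly P (of_nat (Suc l))) (lagrange N l)) \<le> N"
      by (intro degree_sum_le order_trans[OF degree_smult_le] dl) auto
    then show "degree (\<Sum>l\<le>N. smult (poly P (of_nat (Suc l))) (lagrange N l)) < card ((\<lambda>m. of_nat (Suc m) :: complex) ` {..N})"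
      using c by simp
  qed
qed

section \<open>Regular functions on the charts\<close>

definition nonzero_locus :: "'i set \<Rightarrow> 'i set \<Rightarrow> ('i \<Rightarrow> complex) set" where
  "nonzero_locus J I = {x \<in> affine_space J. \<forall>i\<in>I. x i \<noteq> 0}"

text \<open>The fraction around \<open>x\<close> is required to satisfy
  \<open>f y * h y = g y\<close> on the whole locus, with \<open>h\<close> nonzero only at
  \<open>x\<close>. This form mentions no open sets and passes directly to slices and lines.\<close>

definition regular :: "'i set \<Rightarrow> 'i set \<Rightarrow> (('i \<Rightarrow> complex) \<Rightarrow> complex) \<Rightarrow> bool" where
  "regular J I f \<longleftrightarrow> (\<forall>x\<in>nonzero_locus J I. \<exists>g\<in>polyfun J. \<exists>h\<in>polyfun J.
     h x \<noteq> 0 \<and> (\<forall>y\<in>nonzero_locus J I. f y * h y = g y))"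

lemma regularE:
  assumes "regular J I f" "x \<in> nonzero_locus J I"
  obtains g h where "g \<in> polyfun J" "h \<in> polyfun J" "h x \<noteq> 0"
    "\<And>y. y \<in> nonzero_locus J I \<Longrightarrow> f y * h y = g y"
proof -
  have "\<exists>g\<in>polyfun J. \<exists>h\<in>polyfun J. h x \<noteq> 0 \<and> (\<forall>y\<in>nonzero_locus J I. f y * h y = g y)"
    using assms unfolding regular_def by (rule bspec)
  then obtain g h where "g \<in> polyfun J" "h \<in> polyfun J" "h x \<noteq> 0"
    "\<forall>y\<in>nonzero_locus J I. f y * h y = g y" by (elim bexE conjE)
  then show thesis using that by simp
qed

lemma polyfun_subst:
  assumes "f \<in> polyfun (insert j J)"
  shows "(\<lambda>y. f (y(j := c))) \<in> polyfun J"
  using assms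
proof induction
  case (coord i)
  then show ?case by (cases "i = j") (auto intro: polyfun.intros)
qed (auto intro: polyfun.intros)

lemma polyfun_mono: "f \<in> polyfun J \<Longrightarrow> J \<subseteq> J' \<Longrightarrow> f \<in> polyfun J'"
  by (induction rule: polyfun.induct) (auto intro: polyfun.intros)

lemma polyfun_upd_outside: "f \<in> polyfun J \<Longrightarrow> j \<notin> J \<Longrightarrow> f (y(j := c)) = f y"
  by (induction rule: polyfun.induct) auto

lemma polyfun_pow: "f \<in> polyfun J \<Longrightarrow> (\<lambda>x. f x ^ k) \<in> polyfun J"
  by (induction k) (auto intro: polyfun.intros)

text \<open>The degree in the coordinate \<open>j\<close> alone, bounded uniformly in all other
  coordinates.\<close>

lemma polyfun_degree_bound:
  assumes "f \<in> polyfun J"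
  shows "\<exists>E. \<forall>y. \<exists>Q :: complex poly. degree Q \<le> E \<and> (\<forall>T. f (y(j := T)) = poly Q T)"
  using assms
proof induction
  case (const c)
  show ?case by (intro exI[of _ 0] allI exI[of _ "[:c:]"]) simp
next
  case (coord i)
  show ?case
  proof (cases "i = j")
    case True
    then show ?thesis by (intro exI[of _ 1] allI exI[of _ "[:0, 1:]"]) simp
  next
    case False
    have "degree [:y i:] \<le> 0 \<and> (\<forall>T. (y(j := T)) i = poly [:y i:] T)" for y :: "_ \<Rightarrow> complex"
      using False by simp
    then show ?thesis by blast
  qed
next
  case (add f g)
  then obtain E E' where E: "\<And>y. \<exists>Q :: complex poly. degree Q \<le> E \<and> (\<forall>T. f (y(j := T)) = poly Q T)"
    and E': "\<And>y. \<exists>Q :: complex poly. degree Q \<le> E' \<and> (\<forall>T. g (y(j := T)) = poly Q T)" by blast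
  show ?case
  proof (intro exI[of _ "max E E'"] allI)
    fix y
    obtain Q Q' :: "complex poly" where "degree Q \<le> E" "\<forall>T. f (y(j := T)) = poly Q T"
      "degree Q' \<le> E'" "\<forall>T. g (y(j := T)) = poly Q' T" using E[of y] E'[of y] by blast
    then show "\<exists>Q. degree Q \<le> max E E' \<and> (\<forall>T. f (y(j := T)) + g (y(j := T)) = poly Q T)"
      by (intro exI[of _ "Q + Q'"]) (auto intro!: degree_add_le)
  qed
next
  case (mult f g)
  then obtain E E' where E: "\<And>y. \<exists>Q :: complex poly. degree Q \<le> E \<and> (\<forall>T. f (y(j := T)) = poly Q T)"
    and E': "\<And>y. \<exists>Q :: complex poly. degree Q \<le> E' \<and> (\<forall>T. g (y(j := T)) = poly Q T)" by blast
  show ?case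
  proof (intro exI[of _ "E + E'"] allI)
    fix y
    obtain Q Q' :: "complex poly" where "degree Q \<le> E" "\<forall>T. f (y(j := T)) = poly Q T"
      "degree Q' \<le> E'" "\<forall>T. g (y(j := T)) = poly Q' T" using E[of y] E'[of y] by blast
    then show "\<exists>Q. degree Q \<le> E + E' \<and> (\<forall>T. f (y(j := T)) * g (y(j := T)) = poly Q T)"
      by (intro exI[of _ "Q * Q'"]) (auto intro!: order_trans[OF degree_mult_le] add_mono)
  qed
qed

text \<open>Density: at \<open>x\<close> write \<open>f\<close> as g/h. The polynomial built from
  \<open>P * h\<close> and \<open>g\<close> times the power of the product vanishes wherever
  \<open>h0\<close> and that product are nonzero, hence everywhere, in particular at
  \<open>x\<close>.\<close>

lemma regular_extend:
  assumes J: "finite J" "I \<subseteq> J" and f: "regular J I f"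
    and P: "P \<in> polyfun J" and h0: "h0 \<in> polyfun J" "x0 \<in> nonzero_locus J I" "h0 x0 \<noteq> 0"
    and eq: "\<And>x. x \<in> nonzero_locus J I \<Longrightarrow> h0 x \<noteq> 0 \<Longrightarrow> f x * (\<Prod>i\<in>I. x i) ^ M = P x"
    and x: "x \<in> nonzero_locus J I"
  shows "f x * (\<Prod>i\<in>I. x i) ^ M = P x"
proof -
  have finI: "finite I" using J finite_subset by blast
  let ?m = "\<lambda>x. \<Prod>i\<in>I. x i :: complex"
  have m: "?m \<in> polyfun J" using J by (intro polyfun_prod polyfun.coord) auto
  obtain g h where gh: "g \<in> polyfun J" "h \<in> polyfun J" "h x \<noteq> 0"
    "\<And>y. y \<in> nonzero_locus J I \<Longrightarrow> f y * h y = g y"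
    by (rule regularE[OF f x, OF that])
  let ?d = "\<lambda>y. P y * h y + (- 1) * (g y * ?m y ^ M)"
  have d: "?d \<in> polyfun J" using P gh m by (intro polyfun.add polyfun.mult polyfun.const polyfun_pow)
  have "?d y * (h0 y * ?m y) = 0" if y: "y \<in> affine_space J" for y
  proof (cases "y \<in> nonzero_locus J I \<and> h0 y \<noteq> 0")
    case True
    then have "P y * h y = f y * ?m y ^ M * h y" using eq by simp
    also have "\<dots> = g y * ?m y ^ M" using gh(4) True by (metis mult.assoc mult.commute)
    finally show ?thesis by simp
  next
    case False
    then have "h0 y = 0 \<or> ?m y = 0" using y finI by (auto simp: nonzero_locus_def)
    then show ?thesis by auto
  qed
  moreover have "h0 x0 * ?m x0 \<noteq> 0" using h0 finI by (auto simp: nonzero_locus_def)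
  moreover have "x0 \<in> affine_space J" "x \<in> affine_space J" using h0 x by (auto simp: nonzero_locus_def)
  ultimately have "?d x = 0"
    using polyfun_nonzero_mult[OF d polyfun.mult[OF h0(1) m], of x J x0] by blast
  then have "P x * h x = g x * ?m x ^ M" by simp
  also have "\<dots> = f x * ?m x ^ M * h x" using gh(4)[OF x] by (simp add: mult_ac)
  finally show ?thesis using gh(3) by simp
qed

lemma regular_slice:
  assumes "regular (insert j J) I f" "j \<notin> J" "j \<in> I \<longrightarrow> c \<noteq> 0"
  shows "regular J (I - {j}) (\<lambda>y. f (y(j := c)))"
  unfolding regular_def
proof
  fix x assume x: "x \<in> nonzero_locus J (I - {j})"
  have up: "y(j := c) \<in> nonzero_locus (insert j J) I" if "y \<in> nonzero_locus J (I - {j})" for y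
    using that assms(3) by (auto simp: nonzero_locus_def affine_space_def)
  obtain g h where gh: "g \<in> polyfun (insert j J)" "h \<in> polyfun (insert j J)" "h (x(j := c)) \<noteq> 0"
    "\<And>y. y \<in> nonzero_locus (insert j J) I \<Longrightarrow> f y * h y = g y"
    by (rule regularE[OF assms(1) up[OF x], OF that])
  then show "\<exists>g\<in>polyfun J. \<exists>h\<in>polyfun J. h x \<noteq> 0 \<and> (\<forall>y\<in>nonzero_locus J (I - {j}). f (y(j := c)) * h y = g y)"
    using up by (intro bexI[OF _ polyfun_subst[OF gh(1), of c]] bexI[OF _ polyfun_subst[OF gh(2), of c]]) auto
qed

text \<open>Induction on the variables: along the last variable \<open>f\<close> is a Laurent polynomial of bounded
  degree, hence determined by interpolation from finitely many slices.\<close>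

lemma regular_imp_polynomial:
  assumes "finite J" "I \<subseteq> J" "regular J I f"
  shows "\<exists>M. \<exists>P\<in>polyfun J. \<forall>x\<in>nonzero_locus J I. f x * (\<Prod>i\<in>I. x i) ^ M = P x"
  using assms
proof (induction J arbitrary: I f rule: finite_induct)
  case empty
  then have "nonzero_locus {} I = {\<lambda>_. 0}" by (auto simp: nonzero_locus_def affine_space_def)
  then show ?case using empty by (auto intro!: bexI[OF _ polyfun.const[of "f (\<lambda>_. 0)"]])
next
  case (insert j J)
  let ?J = "insert j J" and ?I = "I - {j}"
  let ?D = "nonzero_locus ?J I" and ?D' = "nonzero_locus J ?I"
  let ?Z = "if j \<in> I then - {0} else UNIV :: complex set"
  let ?m' = "\<lambda>x. \<Prod>i\<in>?I. x i :: complex"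
  have finI: "finite I" using insert.prems(1) insert.hyps(1) finite_subset by blast
  have m': "?m' \<in> polyfun ?J" using insert.prems(1) by (intro polyfun_prod polyfun.coord) auto
  have m'_upd: "?m' (y(j := T)) = ?m' y" for y T by (rule prod.cong) auto
  have prodI: "(\<Prod>i\<in>I. x i) = (if j \<in> I then x j else 1) * ?m' x" for x :: "_ \<Rightarrow> complex"
    using finI by (simp add: prod.remove[of I j])
  have upd: "y(j := T) \<in> ?D" if "y \<in> ?D'" "T \<in> ?Z" for y T
    using that by (auto simp: nonzero_locus_def affine_space_def split: if_splits)
  have "\<exists>M. \<exists>P\<in>polyfun J. \<forall>y\<in>?D'. f (y(j := of_nat (Suc l))) * ?m' y ^ M = P y" for l
  proof (rule insert.IH)
    show "?I \<subseteq> J" using insert.prems(1) by blast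
    show "regular J ?I (\<lambda>y. f (y(j := of_nat (Suc l))))"
      using insert.prems(2) insert.hyps(2) by (intro regular_slice) (auto simp del: of_nat_Suc)
  qed
  then obtain Ml P where MP: "\<And>l. P l \<in> polyfun J"
    "\<And>l y. y \<in> ?D' \<Longrightarrow> f (y(j := of_nat (Suc l))) * ?m' y ^ Ml l = P l y" by metis
  \<comment> \<open>The all-ones point lies in the locus for every \<open>I\<close>; it provides one
    fraction whose denominator is nonzero generically.\<close>
  define x0 where "x0 = (\<lambda>i. if i \<in> ?J then 1 else 0 :: complex)"
  have x0: "x0 \<in> ?D" using insert.prems(1) by (auto simp: x0_def nonzero_locus_def affine_space_def)
  obtain g0 h0 where gh0: "g0 \<in> polyfun ?J" "h0 \<in> polyfun ?J" "h0 x0 \<noteq> 0"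
    "\<And>y. y \<in> ?D \<Longrightarrow> f y * h0 y = g0 y"
    by (rule regularE[OF insert.prems(2) x0, OF that])
  obtain Eg where Eg: "\<And>y. \<exists>Q :: complex poly. degree Q \<le> Eg \<and> (\<forall>T. g0 (y(j := T)) = poly Q T)"
    using polyfun_degree_bound[OF gh0(1)] by blast
  obtain E where E: "\<And>y. \<exists>Q :: complex poly. degree Q \<le> E \<and> (\<forall>T. h0 (y(j := T)) = poly Q T)"
    using polyfun_degree_bound[OF gh0(2)] by blast
  let ?N = "Eg + E"
  \<comment> \<open>Clears the possible pole along the coordinate \<open>j\<close>; the exponent is
    the degree bound of the chosen denominator.\<close>
  let ?pw = "\<lambda>T :: complex. if j \<in> I then T ^ E else 1"
  \<comment> \<open>The slices come with different exponents, but only finitely many of them are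
    used.\<close>
  define M where "M = Max (Ml ` {..?N})"
  have M: "Ml l \<le> M" if "l \<le> ?N" for l unfolding M_def using that by (intro Max_ge) auto
  define F where "F x = (\<Sum>l\<le>?N. ?pw (of_nat (Suc l)) * (P l x * ?m' x ^ (M - Ml l)) * poly (lagrange ?N l) (x j))" for x
  have polyT: "(\<lambda>x. poly p (x j)) \<in> polyfun ?J" for p :: "complex poly"
    by (induction p) (auto intro!: polyfun.intros)
  have F: "F \<in> polyfun ?J"
    unfolding F_def by (intro polyfun_sum polyfun.mult polyfun.const polyfun_pow m' polyT polyfun_mono[OF MP(1)]) auto
  \<comment> \<open>On the line through \<open>x\<close> in direction \<open>j\<close>, a nonzero
    \<open>h0 x\<close> makes the restricted denominator a nonzero polynomial, so the one-variable
    result applies and interpolation recovers the value from the slices.\<close>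
  have generic: "f x * ?pw (x j) * ?m' x ^ M = F x" if x: "x \<in> ?D" and h0x: "h0 x \<noteq> 0" for x
  proof -
    define y where "y = x(j := 0)"
    have y: "y \<in> ?D'" using x by (auto simp: y_def nonzero_locus_def affine_space_def)
    have yx: "y(j := x j) = x" by (simp add: y_def)
    have xj: "x j \<in> ?Z" using x by (auto simp: nonzero_locus_def)
    obtain g1 where g1: "degree g1 \<le> Eg" "\<And>T. g0 (y(j := T)) = poly g1 T" using Eg[of y] by blast
    obtain h1 where h1: "degree h1 \<le> E" "\<And>T. h0 (y(j := T)) = poly h1 T" using E[of y] by blast
    have "\<exists>Q. degree Q \<le> degree g1 + E \<and> (\<forall>T\<in>?Z. f (y(j := T)) * (if ?Z = UNIV then 1 else T ^ E) = poly Q T)"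
    proof (rule regular_one_var)
      show "?Z = UNIV \<or> ?Z = - {0}" by simp
      show "h1 \<noteq> 0" using h1(2)[of "x j"] h0x yx by auto
      show "f (y(j := T)) * poly h1 T = poly g1 T" if "T \<in> ?Z" for T
        using gh0(4)[OF upd[OF y that]] g1(2) h1(2) by simp
      show "\<exists>g h. poly h T \<noteq> 0 \<and> (\<forall>T'\<in>?Z. f (y(j := T')) * poly h T' = poly g T')" if T: "T \<in> ?Z" for T
      proof -
        obtain g h where gh: "g \<in> polyfun ?J" "h \<in> polyfun ?J" "h (y(j := T)) \<noteq> 0"
          "\<And>y. y \<in> ?D \<Longrightarrow> f y * h y = g y"
          by (rule regularE[OF insert.prems(2) upd[OF y T], OF that])
        obtain g2 where g2: "\<And>T. g (y(j := T)) = poly g2 T" using polyfun_degree_bound[OF gh(1), of j] by blast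
        obtain h2 where h2: "\<And>T. h (y(j := T)) = poly h2 T" using polyfun_degree_bound[OF gh(2), of j] by blast
        show ?thesis
          using gh(3) gh(4)[OF upd[OF y]] by (intro exI[of _ g2] exI[of _ h2]) (auto simp: g2 h2)
      qed
      show "degree h1 \<le> E" by (rule h1(1))
    qed
    then obtain Q where Q: "degree Q \<le> degree g1 + E" "\<And>T. T \<in> ?Z \<Longrightarrow> f (y(j := T)) * ?pw T = poly Q T"
      by (auto split: if_splits)
    have "degree Q \<le> ?N" using Q(1) g1(1) by simp
    then have "Q = (\<Sum>l\<le>?N. smult (poly Q (of_nat (Suc l))) (lagrange ?N l))"
      by (rule lagrange_interpolation)
    then have "poly Q (x j) = poly (\<Sum>l\<le>?N. smult (poly Q (of_nat (Suc l))) (lagrange ?N l)) (x j)" by simp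
    then have "poly Q (x j) = (\<Sum>l\<le>?N. poly Q (of_nat (Suc l)) * poly (lagrange ?N l) (x j))"
      by (simp only: poly_sum poly_smult)
    then have "f x * ?pw (x j) * ?m' x ^ M = (\<Sum>l\<le>?N. poly Q (of_nat (Suc l)) * poly (lagrange ?N l) (x j)) * ?m' x ^ M"
      using Q(2)[OF xj] yx by simp
    also have "\<dots> = F x"
      unfolding F_def sum_distrib_right
    proof (rule sum.cong[OF refl])
      fix l assume l: "l \<in> {..?N}"
      have Suc0: "of_nat (Suc l) \<in> ?Z" by (simp del: of_nat_Suc)
      have "?m' x = ?m' y" unfolding y_def by (rule m'_upd[symmetric])
      moreover have "P l x = P l y" unfolding y_def by (rule polyfun_upd_outside[OF MP(1) insert.hyps(2), symmetric])
      moreover have "?m' y ^ M = ?m' y ^ Ml l * ?m' y ^ (M - Ml l)"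
        using M[of l] l by (simp add: power_add[symmetric])
      moreover have "poly Q (of_nat (Suc l)) = f (y(j := of_nat (Suc l))) * ?pw (of_nat (Suc l))"
        using Q(2)[OF Suc0] by simp
      ultimately show "poly Q (of_nat (Suc l)) * poly (lagrange ?N l) (x j) * ?m' x ^ M
          = ?pw (of_nat (Suc l)) * (P l x * ?m' x ^ (M - Ml l)) * poly (lagrange ?N l) (x j)"
        by (simp only: MP(2)[OF y, of l, symmetric] mult_ac)
    qed
    finally show ?thesis .
  qed
  \<comment> \<open>One common exponent for all variables in \<open>I\<close>, large enough for the
    last coordinate and for the remaining ones.\<close>
  define K where "K = max M E"
  define G where "G x = F x * ((if j \<in> I then x j ^ (K - E) else 1) * ?m' x ^ (K - M))" for x
  have "G \<in> polyfun ?J"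
  proof (cases "j \<in> I")
    case True
    then show ?thesis unfolding G_def by (simp, intro polyfun.mult F polyfun_pow m' polyfun.coord) auto
  next
    case False
    then have "G = (\<lambda>x. F x * (1 * ?m' x ^ (K - M)))" by (intro ext) (simp only: G_def if_False)
    then show ?thesis by (simp only:) (intro polyfun.mult polyfun.const F polyfun_pow m')
  qed
  moreover have "f x * (\<Prod>i\<in>I. x i) ^ K = G x" if "x \<in> ?D" for x
  proof (rule regular_extend[OF _ insert.prems \<open>G \<in> polyfun ?J\<close> gh0(2) x0 gh0(3) _ that])
    show "finite ?J" using insert.hyps by simp
    fix x assume x: "x \<in> ?D" "h0 x \<noteq> 0"
    have a: "?m' x ^ K = ?m' x ^ M * ?m' x ^ (K - M)" by (simp add: K_def power_add[symmetric])
    have b: "x j ^ K = x j ^ E * x j ^ (K - E)" by (simp add: K_def power_add[symmetric])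
    show "f x * (\<Prod>i\<in>I. x i) ^ K = G x"
      unfolding G_def generic[OF x, symmetric] prodI power_mult_distrib a
      using b by (cases "j \<in> I") (simp_all only: if_True if_False power_one mult_ac mult_1)
  qed
  ultimately show ?case by blast
qed

section \<open>Sections of twisting sheaves\<close>

lemma hom_poly_mult: "hom_poly n d g \<Longrightarrow> hom_poly n e h \<Longrightarrow> hom_poly n (d + e) (\<lambda>x. g x * h x)"
  by (auto simp: hom_poly_def power_add intro: polyfun.mult)

lemma hom_poly_add: "hom_poly n d g \<Longrightarrow> hom_poly n d h \<Longrightarrow> hom_poly n d (\<lambda>x. g x + h x)"
  by (auto simp: hom_poly_def distrib_left intro: polyfun.add)

lemma hom_poly_const: "hom_poly n 0 (\<lambda>_. c)"
  by (auto simp: hom_poly_def intro: polyfun.const)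

lemma hom_poly_zero: "hom_poly n d (\<lambda>_. 0)"
  by (auto simp: hom_poly_def intro: polyfun.const)

lemma hom_poly_scale: "hom_poly n d g \<Longrightarrow> hom_poly n d (\<lambda>x. c * g x)"
  using hom_poly_mult[OF hom_poly_const[of n c], of d g] by simp

lemma hom_poly_coord: "i \<le> n \<Longrightarrow> hom_poly n 1 (\<lambda>x. x i)"
  by (auto simp: hom_poly_def intro: polyfun.coord)

lemma hom_poly_pow: "hom_poly n d g \<Longrightarrow> hom_poly n (k * d) (\<lambda>x. g x ^ k)"
  by (induction k) (auto simp: hom_poly_const hom_poly_mult)

lemma hom_poly_prod:
  assumes "finite S" "\<And>s. s \<in> S \<Longrightarrow> hom_poly n (d s) (f s)"
  shows "hom_poly n (\<Sum>s\<in>S. d s) (\<lambda>x. \<Prod>s\<in>S. f s x)"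
  using assms by (induction S rule: finite_induct) (auto simp: hom_poly_const hom_poly_mult)

lemma hom_poly_sum:
  assumes "\<And>s. s \<in> S \<Longrightarrow> hom_poly n d (f s)"
  shows "hom_poly n d (\<lambda>x. \<Sum>s\<in>S. f s x)"
  using assms by (induction S rule: infinite_finite_induct) (auto simp: hom_poly_zero hom_poly_add)

lemma hom_polyD: "hom_poly n d p \<Longrightarrow> p (\<lambda>i. c * x i) = c ^ d * p x"
  by (simp add: hom_poly_def)

lemma proj_open_nonvanishing: "hom_poly n d p \<Longrightarrow> proj_open n {x \<in> proj_space n. p x \<noteq> 0}"
  unfolding proj_open_def by (intro exI[of _ "{p}"]) auto

lemma proj_open_Int:
  assumes "proj_open n U" "proj_open n V"
  shows "proj_open n (U \<inter> V)"
proof -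
  obtain P Q where P: "\<And>p. p \<in> P \<Longrightarrow> \<exists>d. hom_poly n d p" "U = {x \<in> proj_space n. \<exists>p\<in>P. p x \<noteq> 0}"
    and Q: "\<And>p. p \<in> Q \<Longrightarrow> \<exists>d. hom_poly n d p" "V = {x \<in> proj_space n. \<exists>p\<in>Q. p x \<noteq> 0}"
    using assms unfolding proj_open_def by blast
  let ?R = "(\<lambda>(p, q) x. p x * q x) ` (P \<times> Q)"
  have "\<exists>d. hom_poly n d r" if r: "r \<in> ?R" for r
  proof -
    obtain p q where pq: "p \<in> P" "q \<in> Q" "r = (\<lambda>x. p x * q x)" using r by auto
    then show ?thesis using P(1)[OF pq(1)] Q(1)[OF pq(2)] hom_poly_mult by blast
  qed
  moreover have "U \<inter> V = {x \<in> proj_space n. \<exists>r\<in>?R. r x \<noteq> 0}"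
    unfolding P(2) Q(2) by auto
  ultimately show ?thesis unfolding proj_open_def by blast
qed

lemma proj_open_subset: "proj_open n U \<Longrightarrow> U \<subseteq> proj_space n"
  unfolding proj_open_def by auto

lemma proj_open_cone:
  assumes "proj_open n U" "x \<in> U" "c \<noteq> 0"
  shows "(\<lambda>i. c * x i) \<in> U"
proof -
  obtain P where P: "\<And>p. p \<in> P \<Longrightarrow> \<exists>d. hom_poly n d p" "U = {x \<in> proj_space n. \<exists>p\<in>P. p x \<noteq> 0}"
    using assms unfolding proj_open_def by blast
  have "(\<lambda>i. c * x i) \<in> proj_space n"
    using assms P(2) by (auto simp: proj_space_def affine_space_def fun_eq_iff)
  moreover obtain p d where "p \<in> P" "p x \<noteq> 0" "hom_poly n d p" using assms P by blast
  ultimately show ?thesis using assms(3) unfolding P(2) by (auto simp: hom_polyD intro!: bexI[of _ p])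
qed

lemma chart_eq: "finite I \<Longrightarrow> chart n I = {x \<in> proj_space n. (\<Prod>i\<in>I. x i) \<noteq> 0}"
  by (auto simp: chart_def)

lemma chart_open: "I \<subseteq> {..n} \<Longrightarrow> proj_open n (chart n I)"
proof -
  assume I: "I \<subseteq> {..n}"
  then have fin: "finite I" using finite_subset by blast
  have "hom_poly n (\<Sum>i\<in>I. 1) (\<lambda>x. \<Prod>i\<in>I. x i)"
    using I by (intro hom_poly_prod[OF fin] hom_poly_coord) auto
  then show ?thesis unfolding chart_eq[OF fin] by (rule proj_open_nonvanishing)
qed

lemma chart_locus: "I \<noteq> {} \<Longrightarrow> chart n I = nonzero_locus {..n} I"
  by (auto simp: chart_def proj_space_def nonzero_locus_def)

lemma ex_coord_nonzero: "x \<in> proj_space n \<Longrightarrow> \<exists>i\<le>n. x i \<noteq> 0"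
  by (auto simp: proj_space_def affine_space_def fun_eq_iff)

lemma O_sections_outside: "f \<in> O_sections n a U \<Longrightarrow> x \<notin> U \<Longrightarrow> f x = 0"
  by (auto simp: O_sections_def)

lemma O_sections_local:
  assumes "f \<in> O_sections n a U" "x \<in> U"
  obtains W g h d e where "proj_open n W" "x \<in> W" "W \<subseteq> U" "hom_poly n d g" "hom_poly n e h"
    "int d - int e = a" "\<And>y. y \<in> W \<Longrightarrow> h y \<noteq> 0" "\<And>y. y \<in> W \<Longrightarrow> f y = g y / h y"
proof -
  have "\<exists>W g h d e. proj_open n W \<and> x \<in> W \<and> W \<subseteq> U \<and> hom_poly n d g \<and> hom_poly n e h \<and>
     int d - int e = a \<and> (\<forall>y\<in>W. h y \<noteq> 0 \<and> f y = g y / h y)"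
    using assms unfolding O_sections_def by blast
  then show thesis using that by metis
qed

lemma O_sectionsI:
  assumes "\<And>x. x \<notin> U \<Longrightarrow> f x = 0"
    and "\<And>x. x \<in> U \<Longrightarrow> \<exists>W g h d e. proj_open n W \<and> x \<in> W \<and> W \<subseteq> U \<and> hom_poly n d g \<and> hom_poly n e h \<and>
       int d - int e = a \<and> (\<forall>y\<in>W. h y \<noteq> 0 \<and> f y = g y / h y)"
  shows "f \<in> O_sections n a U"
  using assms unfolding O_sections_def by blast

lemma O_sections_quot:
  assumes "proj_open n U" "hom_poly n d g" "hom_poly n e h" "int d - int e = a" "\<And>x. x \<in> U \<Longrightarrow> h x \<noteq> 0"
  shows "(\<lambda>x. if x \<in> U then g x / h x else 0) \<in> O_sections n a U"
  by (rule O_sectionsI, simp, intro exI[of _ U] exI[of _ g] exI[of _ h] exI[of _ d] exI[of _ e]) (use assms in auto)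

text \<open>Zero too must be presented as a fraction of the right degree; for negative
  \<open>a\<close> the denominator is a power of a coordinate that does not vanish at the
  point.\<close>

lemma O_sections_zero:
  assumes "proj_open n U"
  shows "(\<lambda>_. 0) \<in> O_sections n a U"
proof (rule O_sectionsI)
  fix x assume x: "x \<in> U"
  then obtain i where i: "i \<le> n" "x i \<noteq> 0" using ex_coord_nonzero proj_open_subset[OF assms] by blast
  let ?W = "U \<inter> chart n {i}"
  have "proj_open n ?W" using assms chart_open[of "{i}" n] i by (intro proj_open_Int) auto
  moreover have "x \<in> ?W" using x i proj_open_subset[OF assms] by (auto simp: chart_def)
  moreover have "hom_poly n (nat (- a)) (\<lambda>x. x i ^ nat (- a))"
    using hom_poly_pow[OF hom_poly_coord[OF i(1)], of "nat (- a)"] by simp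
  moreover have "int (nat a) - int (nat (- a)) = a" by simp
  ultimately show "\<exists>W g h d e. proj_open n W \<and> x \<in> W \<and> W \<subseteq> U \<and> hom_poly n d g \<and> hom_poly n e h \<and>
       int d - int e = a \<and> (\<forall>y\<in>W. h y \<noteq> 0 \<and> 0 = g y / h y)"
    using hom_poly_zero[of n "nat a"]
    by (intro exI[of _ ?W] exI[of _ "\<lambda>_. 0"] exI[of _ "\<lambda>x. x i ^ nat (- a)"] exI[of _ "nat a"] exI[of _ "nat (- a)"])
      (auto simp: chart_def)
qed simp

lemma O_sections_add:
  assumes f: "f \<in> O_sections n a U" and f': "f' \<in> O_sections n a U"
  shows "(\<lambda>x. f x + f' x) \<in> O_sections n a U"
proof (rule O_sectionsI)
  fix x assume x: "x \<in> U"
  obtain W g h d e where W: "proj_open n W" "x \<in> W" "W \<subseteq> U" "hom_poly n d g" "hom_poly n e h"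
    "int d - int e = a" "\<And>y. y \<in> W \<Longrightarrow> h y \<noteq> 0" "\<And>y. y \<in> W \<Longrightarrow> f y = g y / h y"
    using O_sections_local[OF f x] by metis
  obtain W' g' h' d' e' where W': "proj_open n W'" "x \<in> W'" "W' \<subseteq> U" "hom_poly n d' g'" "hom_poly n e' h'"
    "int d' - int e' = a" "\<And>y. y \<in> W' \<Longrightarrow> h' y \<noteq> 0" "\<And>y. y \<in> W' \<Longrightarrow> f' y = g' y / h' y"
    using O_sections_local[OF f' x] by metis
  have de: "d + e' = d' + e" using W(6) W'(6) by simp
  have "hom_poly n (d + e') (\<lambda>x. g x * h' x + g' x * h x)"
    using hom_poly_mult[OF W(4) W'(5)] hom_poly_mult[OF W'(4) W(5)] by (intro hom_poly_add) (simp_all add: de)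
  then show "\<exists>W g h d e. proj_open n W \<and> x \<in> W \<and> W \<subseteq> U \<and> hom_poly n d g \<and> hom_poly n e h \<and>
       int d - int e = a \<and> (\<forall>y\<in>W. h y \<noteq> 0 \<and> f y + f' y = g y / h y)"
    using W W' hom_poly_mult[OF W(5) W'(5)] proj_open_Int[OF W(1) W'(1)]
    by (intro exI[of _ "W \<inter> W'"] exI[of _ "\<lambda>x. g x * h' x + g' x * h x"] exI[of _ "\<lambda>x. h x * h' x"]
        exI[of _ "d + e'"] exI[of _ "e + e'"])
      (auto simp: field_simps)
qed (simp add: O_sections_outside[OF f] O_sections_outside[OF f'])

lemma O_sections_mult:
  assumes f: "f \<in> O_sections n a U" and f': "f' \<in> O_sections n b U"
  shows "(\<lambda>x. f x * f' x) \<in> O_sections n (a + b) U"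
proof (rule O_sectionsI)
  fix x assume x: "x \<in> U"
  obtain W g h d e where W: "proj_open n W" "x \<in> W" "W \<subseteq> U" "hom_poly n d g" "hom_poly n e h"
    "int d - int e = a" "\<And>y. y \<in> W \<Longrightarrow> h y \<noteq> 0" "\<And>y. y \<in> W \<Longrightarrow> f y = g y / h y"
    using O_sections_local[OF f x] by metis
  obtain W' g' h' d' e' where W': "proj_open n W'" "x \<in> W'" "W' \<subseteq> U" "hom_poly n d' g'" "hom_poly n e' h'"
    "int d' - int e' = b" "\<And>y. y \<in> W' \<Longrightarrow> h' y \<noteq> 0" "\<And>y. y \<in> W' \<Longrightarrow> f' y = g' y / h' y"
    using O_sections_local[OF f' x] by metis
  show "\<exists>W g h d e. proj_open n W \<and> x \<in> W \<and> W \<subseteq> U \<and> hom_poly n d g \<and> hom_poly n e h \<and>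
       int d - int e = a + b \<and> (\<forall>y\<in>W. h y \<noteq> 0 \<and> f y * f' y = g y / h y)"
    using W W' hom_poly_mult[OF W(5) W'(5)] hom_poly_mult[OF W(4) W'(4)] proj_open_Int[OF W(1) W'(1)]
    by (intro exI[of _ "W \<inter> W'"] exI[of _ "\<lambda>x. g x * g' x"] exI[of _ "\<lambda>x. h x * h' x"]
        exI[of _ "d + d'"] exI[of _ "e + e'"])
      auto
qed (simp add: O_sections_outside[OF f])

lemma O_sections_restr:
  assumes f: "f \<in> O_sections n a U" and V: "proj_open n V" "V \<subseteq> U"
  shows "(\<lambda>x. if x \<in> V then f x else 0) \<in> O_sections n a V"
proof (rule O_sectionsI)
  fix x assume x: "x \<in> V"
  then have "x \<in> U" using V by blast
  from O_sections_local[OF f this]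
  obtain W g h d e where W: "proj_open n W" "x \<in> W" "W \<subseteq> U" "hom_poly n d g" "hom_poly n e h"
    "int d - int e = a" "\<And>y. y \<in> W \<Longrightarrow> h y \<noteq> 0" "\<And>y. y \<in> W \<Longrightarrow> f y = g y / h y" by metis
  show "\<exists>W g h d e. proj_open n W \<and> x \<in> W \<and> W \<subseteq> V \<and> hom_poly n d g \<and> hom_poly n e h \<and>
       int d - int e = a \<and> (\<forall>y\<in>W. h y \<noteq> 0 \<and> (if y \<in> V then f y else 0) = g y / h y)"
    using W x proj_open_Int[OF V(1) W(1)]
    by (intro exI[of _ "V \<inter> W"] exI[of _ g] exI[of _ h] exI[of _ d] exI[of _ e]) auto
qed simp

lemma O_sections_sum:
  assumes "proj_open n U" "\<And>s. s \<in> S \<Longrightarrow> f s \<in> O_sections n a U"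
  shows "(\<lambda>x. \<Sum>s\<in>S. f s x) \<in> O_sections n a U"
  using assms(2) by (induction S rule: infinite_finite_induct) (auto intro: O_sections_zero[OF assms(1)] O_sections_add)

lemma O_sections_hom_mult:
  assumes U: "proj_open n U" and p: "hom_poly n d p" and f: "f \<in> O_sections n a U"
  shows "(\<lambda>x. p x * f x) \<in> O_sections n (a + int d) U"
proof -
  have "(\<lambda>x. f x * (if x \<in> U then p x / 1 else 0)) \<in> O_sections n (a + int d) U"
    by (intro O_sections_mult[OF f] O_sections_quot[OF U p hom_poly_const]) auto
  also have "(\<lambda>x. f x * (if x \<in> U then p x / 1 else 0)) = (\<lambda>x. p x * f x)"
    using O_sections_outside[OF f] by (auto simp: fun_eq_iff)
  finally show ?thesis .
qed

lemma O_sections_scale: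
  assumes "proj_open n U" "f \<in> O_sections n a U"
  shows "(\<lambda>x. c * f x) \<in> O_sections n a U"
  using O_sections_hom_mult[OF assms(1) hom_poly_const assms(2), of c] by simp

section \<open>Laurent polynomials and sections over the charts\<close>

lemma lmon_add:
  assumes "\<And>i. i \<le> n \<Longrightarrow> x i \<noteq> 0 \<or> 0 \<le> e i \<and> 0 \<le> e' i"
  shows "lmon n (\<lambda>i. e i + e' i) x = lmon n e x * lmon n e' x"
  unfolding lmon_def prod.distrib[symmetric]
proof (rule prod.cong[OF refl])
  fix i assume "i \<in> {..n}"
  then show "x i powi (e i + e' i) = x i powi e i * x i powi e' i"
    using assms[of i] by (cases "x i = 0") (auto simp: power_int_add power_int_0_left_if)
qed

lemma lmon_up:
  assumes "i \<le> n" "x i \<noteq> 0 \<or> 0 \<le> e i"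
  shows "lmon n (up i e) x = x i * lmon n e x"
proof -
  have "x i powi (e i + 1) = x i powi e i * x i"
    using assms(2) by (cases "x i = 0") (auto simp: power_int_add power_int_0_left_if)
  then show ?thesis using assms(1)
    unfolding lmon_def by (subst (1 2) prod.remove[of "{..n}" i]) (auto simp: up_def intro!: prod.cong)
qed

text \<open>Coefficient families of the degree \<open>a\<close> part of the polynomial ring
  localized at the variables with index in \<open>I\<close>.\<close>

definition lau :: "nat \<Rightarrow> int \<Rightarrow> nat set \<Rightarrow> ((nat \<Rightarrow> int) \<Rightarrow> complex) set" where
  "lau n a I = {c. finite {e. c e \<noteq> 0} \<and> (\<forall>e. c e \<noteq> 0 \<longrightarrow> e \<in> exps n a \<and> (\<forall>i. i \<notin> I \<longrightarrow> 0 \<le> e i))}"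

lemma lauD:
  assumes "c \<in> lau n a I"
  shows "finite {e. c e \<noteq> 0}" "c e \<noteq> 0 \<Longrightarrow> e \<in> exps n a" "c e \<noteq> 0 \<Longrightarrow> i \<notin> I \<Longrightarrow> 0 \<le> e i" "c e \<noteq> 0 \<Longrightarrow> n < i \<Longrightarrow> e i = 0"
  using assms by (auto simp: lau_def exps_def)

lemma lau_shift:
  assumes "c \<in> lau n a I" "i \<le> n"
  shows "(\<lambda>e. c (dn i e)) \<in> lau n (a + 1) I"
proof -
  have "{e. c (dn i e) \<noteq> 0} = up i ` {e. c e \<noteq> 0}"
    by (auto simp: image_iff intro!: exI[of _ "dn i _"])
  then have "finite {e. c (dn i e) \<noteq> 0}" using lauD(1)[OF assms(1)] by simp
  moreover have "0 \<le> e j" if "c (dn i e) \<noteq> 0" "j \<notin> I" for e j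
    using lauD(3)[OF assms(1) that] by (auto simp: dn_def split: if_splits)
  moreover have "e \<in> exps n (a + 1)" if "c (dn i e) \<noteq> 0" for e
    using lauD(2)[OF assms(1) that] dn_exps_iff[OF assms(2)] by blast
  ultimately show ?thesis by (auto simp: lau_def)
qed

lemma leval_shift:
  assumes c: "c \<in> lau n a I" and i: "i \<le> n" and x: "x \<in> chart n I"
  shows "leval n (\<lambda>e. c (dn i e)) x = x i * leval n c x"
proof -
  let ?S = "{e. c e \<noteq> 0}"
  have "leval n (\<lambda>e. c (dn i e)) x = (\<Sum>e\<in>up i ` ?S. c (dn i e) * lmon n e x)"
    using lauD(1)[OF c] by (intro leval_superset) (auto simp: image_iff intro!: exI[of _ "dn i _"])
  also have "\<dots> = (\<Sum>e\<in>?S. c e * lmon n (up i e) x)" by (subst sum.reindex) (auto simp: inj_on_def)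
  also have "\<dots> = (\<Sum>e\<in>?S. x i * (c e * lmon n e x))"
  proof (rule sum.cong[OF refl])
    fix e assume "e \<in> ?S"
    then have "x i \<noteq> 0 \<or> 0 \<le> e i" using lauD(3)[OF c, of e i] x by (auto simp: chart_def)
    then show "c e * lmon n (up i e) x = x i * (c e * lmon n e x)" using i by (simp add: lmon_up)
  qed
  also have "\<dots> = x i * leval n c x" by (simp add: leval_def sum_distrib_left)
  finally show ?thesis .
qed

lemma polyfun_laurent:
  assumes "P \<in> polyfun {..n}"
  shows "\<exists>c. finite {e. c e \<noteq> 0} \<and> (\<forall>e. c e \<noteq> 0 \<longrightarrow> (\<forall>i>n. e i = 0) \<and> (\<forall>i. 0 \<le> e i)) \<and> (\<forall>x. P x = leval n c x)"
  using assms
proof induction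
  case (const a)
  show ?case
    by (rule exI[of _ "\<lambda>e. if e = (\<lambda>_. 0) then a else 0"]) (auto simp: leval_single lmon_def)
next
  case (coord i)
  have "lmon n (up i (\<lambda>_. 0)) x = x i" for x
    using coord lmon_up[of i n x "\<lambda>_. 0"] by (simp add: lmon_def)
  then show ?case
    using coord by (intro exI[of _ "\<lambda>e. if e = up i (\<lambda>_. 0) then 1 else 0"]) (auto simp: leval_single up_def)
next
  case (add f g)
  then obtain c c' where c: "finite {e. c e \<noteq> 0}" "\<And>e. c e \<noteq> 0 \<Longrightarrow> (\<forall>i>n. e i = 0) \<and> (\<forall>i. 0 \<le> e i)" "\<And>x. f x = leval n c x"
    and c': "finite {e. c' e \<noteq> 0}" "\<And>e. c' e \<noteq> 0 \<Longrightarrow> (\<forall>i>n. e i = 0) \<and> (\<forall>i. 0 \<le> e i)" "\<And>x. g x = leval n c' x"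
    by blast
  have "finite {e. c e + c' e \<noteq> 0}"
    by (rule finite_subset[of _ "{e. c e \<noteq> 0} \<union> {e. c' e \<noteq> 0}"]) (use c c' in auto)
  moreover have "c e \<noteq> 0 \<or> c' e \<noteq> 0" if "c e + c' e \<noteq> 0" for e using that by auto
  ultimately show ?case
    using c(2) c'(2) by (intro exI[of _ "\<lambda>e. c e + c' e"]) (simp add: leval_add[OF c(1) c'(1)] c(3) c'(3), blast)
next
  case (mult f g)
  then obtain c c' where c: "finite {e. c e \<noteq> 0}" "\<And>e. c e \<noteq> 0 \<Longrightarrow> (\<forall>i>n. e i = 0) \<and> (\<forall>i. 0 \<le> e i)" "\<And>x. f x = leval n c x"
    and c': "finite {e. c' e \<noteq> 0}" "\<And>e. c' e \<noteq> 0 \<Longrightarrow> (\<forall>i>n. e i = 0) \<and> (\<forall>i. 0 \<le> e i)" "\<And>x. g x = leval n c' x"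
    by blast
  let ?S = "{e. c e \<noteq> 0} \<times> {e. c' e \<noteq> 0}"
  let ?t = "\<lambda>s i. fst s i + snd s i :: int"
  let ?c = "\<lambda>e. \<Sum>s\<in>?S. if e = ?t s then c (fst s) * c' (snd s) else 0"
  have S: "finite ?S" using c c' by simp
  have supp: "e \<in> ?t ` ?S" if "?c e \<noteq> 0" for e
  proof (rule ccontr)
    assume "e \<notin> ?t ` ?S"
    then have "\<forall>s\<in>?S. e \<noteq> ?t s" by blast
    then have "?c e = 0" by (intro sum.neutral) simp
    then show False using that by simp
  qed
  have "finite {e. ?c e \<noteq> 0}" by (rule finite_subset[of _ "?t ` ?S"]) (use supp S in auto)
  moreover have "(\<forall>i>n. e i = 0) \<and> (\<forall>i. 0 \<le> e i)" if nz: "?c e \<noteq> 0" for e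
  proof -
    obtain a b where ab: "c a \<noteq> 0" "c' b \<noteq> 0" "e = (\<lambda>i. a i + b i)" using supp[OF nz] by auto
    then show ?thesis using c(2)[OF ab(1)] c'(2)[OF ab(2)] by simp
  qed
  moreover have "f x * g x = leval n ?c x" for x
  proof -
    have "leval n ?c x = (\<Sum>s\<in>?S. c (fst s) * c' (snd s) * lmon n (?t s) x)"
      by (subst leval_sum[OF S]) (auto simp: leval_single intro: finite_subset[of _ "{?t _}"])
    also have "\<dots> = (\<Sum>s\<in>?S. (c (fst s) * lmon n (fst s) x) * (c' (snd s) * lmon n (snd s) x))"
    proof (rule sum.cong[OF refl])
      fix s assume "s \<in> ?S"
      then have "lmon n (?t s) x = lmon n (fst s) x * lmon n (snd s) x"
        using c(2)[of "fst s"] c'(2)[of "snd s"] by (intro lmon_add) auto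
      then show "c (fst s) * c' (snd s) * lmon n (?t s) x = (c (fst s) * lmon n (fst s) x) * (c' (snd s) * lmon n (snd s) x)"
        by simp
    qed
    also have "\<dots> = f x * g x"
      unfolding c(3) c'(3) leval_def sum_product sum.cartesian_product by (simp add: split_beta)
    finally show ?thesis by simp
  qed
  ultimately show ?case by (intro exI[of _ ?c]) blast
qed

text \<open>Any two local fractions of a section agree on the intersection of their domains, which
  is nonempty because the space is irreducible. So the cross-multiplied identity of the fraction at
  \<open>x\<close> with the one at \<open>y\<close> holds everywhere, including at
  \<open>y\<close>.\<close>

lemma O_sections_regular:
  assumes I: "I \<subseteq> {..n}" "I \<noteq> {}" and f: "f \<in> O_sections n a (chart n I)"
  shows "regular {..n} I f"
  unfolding regular_def
proof
  fix x assume "x \<in> nonzero_locus {..n} I"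
  then have x: "x \<in> chart n I" by (simp add: chart_locus[OF I(2)])
  obtain W g h d e where W: "proj_open n W" "x \<in> W" "W \<subseteq> chart n I" "hom_poly n d g" "hom_poly n e h"
    "\<And>y. y \<in> W \<Longrightarrow> h y \<noteq> 0" "\<And>y. y \<in> W \<Longrightarrow> f y = g y / h y"
    using O_sections_local[OF f x] by metis
  obtain p where p: "p \<in> polyfun {..n}" "p x \<noteq> 0" "\<And>y. y \<in> proj_space n \<Longrightarrow> p y \<noteq> 0 \<Longrightarrow> y \<in> W"
    using W(1,2) unfolding proj_open_def hom_poly_def by blast
  have "f y * h y = g y" if y: "y \<in> chart n I" for y
  proof -
    obtain W' g' h' d' e' where W': "proj_open n W'" "y \<in> W'" "W' \<subseteq> chart n I" "hom_poly n d' g'" "hom_poly n e' h'"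
      "\<And>y. y \<in> W' \<Longrightarrow> h' y \<noteq> 0" "\<And>y. y \<in> W' \<Longrightarrow> f y = g' y / h' y"
      using O_sections_local[OF f y] by metis
    obtain p' where p': "p' \<in> polyfun {..n}" "p' y \<noteq> 0" "\<And>z. z \<in> proj_space n \<Longrightarrow> p' z \<noteq> 0 \<Longrightarrow> z \<in> W'"
      using W'(1,2) unfolding proj_open_def hom_poly_def by blast
    obtain i where i: "i \<in> I" "i \<le> n" using I by blast
    let ?D = "\<lambda>z. g z * h' z + (- 1) * (g' z * h z)"
    have D: "?D \<in> polyfun {..n}"
      using W(4,5) W'(4,5) by (intro polyfun.add polyfun.mult polyfun.const) (auto simp: hom_poly_def)
    \<comment> \<open>The extra factors restrict to points where both fractions are valid; elsewhere
      the product vanishes trivially.\<close>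
    have zero: "?D z * (p z * (p' z * z i)) = 0" if z: "z \<in> affine_space {..n}" for z
    proof (cases "z i \<noteq> 0 \<and> p z \<noteq> 0 \<and> p' z \<noteq> 0")
      case True
      then have "z \<in> proj_space n" using z by (auto simp: proj_space_def)
      then have zW: "z \<in> W" "z \<in> W'" using True p(3) p'(3) by auto
      then have "g z / h z = g' z / h' z" using W(7) W'(7) by metis
      then have "g z * h' z = g' z * h z" using W(6)[OF zW(1)] W'(6)[OF zW(2)] by (simp add: frac_eq_eq)
      then show ?thesis by simp
    qed auto
    have xy: "x \<in> affine_space {..n}" "y \<in> affine_space {..n}" "x i \<noteq> 0" "y i \<noteq> 0"
      using x y i by (auto simp: chart_def proj_space_def)
    have pi': "(\<lambda>z. p' z * z i) \<in> polyfun {..n}" using p'(1) i by (intro polyfun.mult polyfun.coord) auto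
    obtain w where w: "w \<in> affine_space {..n}" "p w * (p' w * w i) \<noteq> 0"
      using polyfun_nonzero_mult[OF p(1) pi', of x "{..n}" y] p(2) p'(2) xy by auto
    have "?D y = 0"
    proof (rule ccontr)
      assume "?D y \<noteq> 0"
      then show False
        using polyfun_nonzero_mult[OF D polyfun.mult[OF p(1) pi'], of y "{..n}" w] xy w zero by blast
    qed
    then have "g y * h' y = g' y * h y" by simp
    then have "(f y * h y) * h' y = g y * h' y"
      using W'(6,7)[OF W'(2)] by (simp add: field_simps)
    then show ?thesis using W'(6)[OF W'(2)] by simp
  qed
  then show "\<exists>g\<in>polyfun {..n}. \<exists>h\<in>polyfun {..n}. h x \<noteq> 0 \<and> (\<forall>y\<in>nonzero_locus {..n} I. f y * h y = g y)"
    using W(4,5) W(6)[OF W(2)] unfolding chart_locus[OF I(2), symmetric] hom_poly_def by blast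
qed

lemma O_sections_homogeneous:
  assumes "f \<in> O_sections n a U" "x \<in> U" "c \<noteq> 0"
  shows "f (\<lambda>i. c * x i) = c powi a * f x"
proof -
  obtain W g h d e where W: "proj_open n W" "x \<in> W" "W \<subseteq> U" "hom_poly n d g" "hom_poly n e h"
    "int d - int e = a" "\<And>y. y \<in> W \<Longrightarrow> h y \<noteq> 0" "\<And>y. y \<in> W \<Longrightarrow> f y = g y / h y"
    using O_sections_local[OF assms(1,2)] by metis
  have "f (\<lambda>i. c * x i) = (c ^ d * g x) / (c ^ e * h x)"
    using W(8)[OF proj_open_cone[OF W(1,2) assms(3)]] by (simp add: hom_polyD[OF W(4)] hom_polyD[OF W(5)])
  also have "\<dots> = (c ^ d / c ^ e) * (g x / h x)" by simp
  also have "c ^ d / c ^ e = c powi a" using assms(3) unfolding W(6)[symmetric] by (simp add: power_int_diff)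
  finally show ?thesis using W(8)[OF W(2)] by simp
qed

text \<open>Clearing denominators gives a polynomial by regularity; shifting exponents back gives a
  Laurent polynomial, and homogeneity of the section forces every monomial to have degree
  \<open>a\<close>.\<close>

lemma O_sections_laurent:
  assumes I: "I \<subseteq> {..n}" "I \<noteq> {}" and f: "f \<in> O_sections n a (chart n I)"
  shows "\<exists>c\<in>lau n a I. \<forall>x\<in>chart n I. f x = leval n c x"
proof -
  have finI: "finite I" using I finite_subset by blast
  obtain M P where P: "P \<in> polyfun {..n}" "\<And>x. x \<in> chart n I \<Longrightarrow> f x * (\<Prod>i\<in>I. x i) ^ M = P x"
    using regular_imp_polynomial[OF _ I(1) O_sections_regular[OF I f]] unfolding chart_locus[OF I(2), symmetric] by auto
  obtain b where b: "finite {e. b e \<noteq> 0}" "\<And>e. b e \<noteq> 0 \<Longrightarrow> (\<forall>i>n. e i = 0) \<and> (\<forall>i. 0 \<le> e i)" "\<And>x. P x = leval n b x"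
    using polyfun_laurent[OF P(1)] by blast
  \<comment> \<open>The exponent of the cleared denominator.\<close>
  define s where "s = (\<lambda>i. if i \<in> I then int M else 0)"
  define c where "c e = b (\<lambda>i. e i + s i)" for e
  let ?sh = "\<lambda>e i. e i - s i"
  have cS: "{e. c e \<noteq> 0} = ?sh ` {e. b e \<noteq> 0}"
  proof (intro equalityI subsetI)
    fix e assume "e \<in> {e. c e \<noteq> 0}"
    then show "e \<in> ?sh ` {e. b e \<noteq> 0}" by (intro image_eqI[of _ _ "\<lambda>i. e i + s i"]) (auto simp: c_def)
  qed (auto simp: c_def)
  have fin: "finite {e. c e \<noteq> 0}" unfolding cS using b(1) by simp
  have neg: "0 \<le> e i" if "c e \<noteq> 0" "i \<notin> I" for e i
    using b(2)[of "\<lambda>i. e i + s i"] that by (auto simp: c_def s_def dest!: spec[of _ i])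
  have out: "e i = 0" if "c e \<noteq> 0" "n < i" for e i
  proof -
    have "i \<notin> I" using I(1) that(2) by auto
    then show ?thesis using b(2)[of "\<lambda>i. e i + s i"] that by (auto simp: c_def s_def dest!: spec[of _ i])
  qed
  have fc: "f x = leval n c x" if x: "x \<in> chart n I" for x
  proof -
    have m0: "(\<Prod>i\<in>I. x i) \<noteq> 0" using x finI by (auto simp: chart_def)
    have ms: "lmon n s x = (\<Prod>i\<in>I. x i) ^ M"
    proof -
      have "lmon n s x = (\<Prod>i\<in>{..n}. if i \<in> I then x i ^ M else 1)"
        unfolding lmon_def s_def by (intro prod.cong) auto
      also have "\<dots> = (\<Prod>i\<in>I. x i ^ M)" using I(1) by (simp add: prod.If_cases Int_absorb1)
      finally show ?thesis by (simp add: prod_power_distrib)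
    qed
    have "leval n c x * lmon n s x = (\<Sum>e\<in>?sh ` {e. b e \<noteq> 0}. c e * lmon n e x * lmon n s x)"
      unfolding leval_def cS by (rule sum_distrib_right)
    also have "\<dots> = (\<Sum>e | b e \<noteq> 0. c (?sh e) * lmon n (?sh e) x * lmon n s x)"
      by (subst sum.reindex) (auto simp: inj_on_def fun_eq_iff)
    also have "\<dots> = (\<Sum>e | b e \<noteq> 0. b e * lmon n e x)"
    proof (rule sum.cong[OF refl])
      fix e assume e: "e \<in> {e. b e \<noteq> 0}"
      have "lmon n (\<lambda>i. ?sh e i + s i) x = lmon n (?sh e) x * lmon n s x"
        using b(2)[of e] e x by (intro lmon_add) (auto simp: s_def chart_def)
      then show "c (?sh e) * lmon n (?sh e) x * lmon n s x = b e * lmon n e x"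
        by (simp add: c_def mult.assoc)
    qed
    also have "\<dots> = f x * lmon n s x" using P(2)[OF x] b(3)[of x] by (simp add: leval_def ms)
    finally show ?thesis using m0 by (simp add: ms)
  qed
  \<comment> \<open>Compare coefficients after scaling the point by 2: distinct integers give
    distinct powers of 2, so a single scalar detects the degree.\<close>
  have deg: "(\<Sum>i\<le>n. e i) = a" if e: "c e \<noteq> 0" for e
  proof -
    let ?T = "\<lambda>e. (\<Sum>i\<le>n. e i) :: int"
    have lm2: "lmon n e (\<lambda>i. 2 * x i) = 2 powi ?T e * lmon n e x" for e x
    proof -
      have "lmon n e (\<lambda>i. 2 * x i) = (\<Prod>i\<le>n. (2 :: complex) powi e i) * lmon n e x"
        unfolding lmon_def by (simp add: power_int_mult_distrib prod.distrib)
      also have "(\<Prod>i\<le>n. (2 :: complex) powi e i) = 2 powi ?T e"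
        by (induction n) (simp_all add: power_int_add)
      finally show ?thesis .
    qed
    have "c e * 2 powi ?T e + (- (2 powi a)) * c e = 0"
    proof (rule leval_zero_imp[where n = n and c = "\<lambda>e. c e * 2 powi ?T e + (- (2 powi a)) * c e"])
      show "finite {e. c e * 2 powi ?T e + (- (2 powi a)) * c e \<noteq> 0}"
        by (rule finite_subset[OF _ fin]) auto
      show "e i = 0" if "c e * 2 powi ?T e + (- (2 powi a)) * c e \<noteq> 0" "n < i" for e i
        using out[of e i] that by auto
      fix x assume x: "x \<in> chart n {..n}"
      then have x': "x \<in> chart n I" using I(1) by (auto simp: chart_def)
      then have x2: "(\<lambda>i. 2 * x i) \<in> chart n I"
        using proj_open_cone[OF chart_open[OF I(1)] x', of 2] by simp
      have fin': "finite {e. c e * 2 powi ?T e \<noteq> 0}" by (rule finite_subset[OF _ fin]) auto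
      have fin'': "finite {e. (- (2 powi a)) * c e \<noteq> 0}" by (rule finite_subset[OF _ fin]) auto
      have "leval n (\<lambda>e. c e * 2 powi ?T e) x = (\<Sum>e | c e \<noteq> 0. c e * 2 powi ?T e * lmon n e x)"
        by (rule leval_superset[OF fin]) auto
      also have "\<dots> = leval n c (\<lambda>i. 2 * x i)" unfolding leval_def lm2 by (simp add: mult_ac)
      also have "\<dots> = 2 powi a * leval n c x"
        using O_sections_homogeneous[OF f x', of 2] fc[OF x'] fc[OF x2] by simp
      finally show "leval n (\<lambda>e. c e * 2 powi ?T e + (- (2 powi a)) * c e) x = 0"
        by (subst leval_add[OF fin' fin'']) (simp only: leval_scale, simp)
    qed
    then have "c e * (2 powi ?T e - 2 powi a) = 0" by (simp add: algebra_simps)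
    then have "(2 :: complex) powi ?T e = 2 powi a" using e by simp
    then have "cmod (2 powi ?T e) = cmod (2 powi a)" by simp
    then have "(2 :: real) powi ?T e = 2 powi a" by (simp add: norm_power_int)
    then have "\<not> ?T e < a" "\<not> a < ?T e" using power_int_strict_increasing[of "?T e" a "2 :: real"]
        power_int_strict_increasing[of a "?T e" "2 :: real"] by auto
    then show ?thesis by simp
  qed
  have "c \<in> lau n a I" using fin deg out neg by (auto simp: lau_def exps_def)
  then show ?thesis using fc by blast
qed

lemma laurent_section:
  assumes I: "I \<subseteq> {..n}" "I \<noteq> {}" and c: "c \<in> lau n a I"
  shows "(\<lambda>x. if x \<in> chart n I then leval n c x else 0) \<in> O_sections n a (chart n I)"
proof -
  let ?U = "chart n I"
  have finI: "finite I" using I finite_subset by blast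
  have U: "proj_open n ?U" by (rule chart_open[OF I(1)])
  have "(\<lambda>x. if x \<in> ?U then lmon n e x else 0) \<in> O_sections n a ?U" if e: "c e \<noteq> 0" for e
  proof -
    let ?g = "\<lambda>x. \<Prod>i\<in>{..n}. x i ^ nat (e i)" and ?h = "\<lambda>x. \<Prod>i\<in>{..n}. x i ^ nat (- e i) :: complex"
    have g: "hom_poly n (\<Sum>i\<in>{..n}. nat (e i)) ?g" and h: "hom_poly n (\<Sum>i\<in>{..n}. nat (- e i)) ?h"
      using hom_poly_pow[OF hom_poly_coord] by (auto intro!: hom_poly_prod)
    have h0: "?h x \<noteq> 0" if "x \<in> ?U" for x
      using that lauD(3)[OF c e] by (fastforce simp: chart_def prod_zero_iff not_less)
    have d: "int (\<Sum>i\<in>{..n}. nat (e i)) - int (\<Sum>i\<in>{..n}. nat (- e i)) = a"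
    proof -
      have "int (\<Sum>i\<in>{..n}. nat (e i)) - int (\<Sum>i\<in>{..n}. nat (- e i)) = (\<Sum>i\<in>{..n}. int (nat (e i)) - int (nat (- e i)))"
        by (simp add: sum_subtractf)
      also have "\<dots> = (\<Sum>i\<in>{..n}. e i)" by (rule sum.cong) auto
      finally show ?thesis using lauD(2)[OF c e] by (simp add: exps_def)
    qed
    have "(\<lambda>x. if x \<in> ?U then ?g x / ?h x else 0) \<in> O_sections n a ?U"
      by (rule O_sections_quot[OF U g h d h0])
    also have "(\<lambda>x. if x \<in> ?U then ?g x / ?h x else 0) = (\<lambda>x. if x \<in> ?U then lmon n e x else 0)"
    proof (rule ext)
      fix x :: point
      have "x i ^ nat (e i) / x i ^ nat (- e i) = x i powi e i" for i
        by (auto simp: power_int_def divide_simps)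
      then show "(if x \<in> ?U then ?g x / ?h x else 0) = (if x \<in> ?U then lmon n e x else 0)"
        by (simp add: lmon_def prod_dividef[symmetric])
    qed
    finally show ?thesis .
  qed
  then have "(\<lambda>x. \<Sum>e | c e \<noteq> 0. c e * (if x \<in> ?U then lmon n e x else 0)) \<in> O_sections n a ?U"
    by (intro O_sections_sum[OF U] O_sections_scale[OF U]) auto
  also have "(\<lambda>x. \<Sum>e | c e \<noteq> 0. c e * (if x \<in> ?U then lmon n e x else 0)) = (\<lambda>x. if x \<in> ?U then leval n c x else 0)"
    by (auto simp: fun_eq_iff leval_def)
  finally show ?thesis .
qed

section \<open>Cech cohomology of twisting sheaves\<close>

definition simplex_sign :: "nat set \<Rightarrow> nat \<Rightarrow> complex" where
  "simplex_sign I i = (- 1) ^ card {i' \<in> I. i' < i}"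

lemma simplex_sign_insert:
  assumes "finite I" "j \<notin> I"
  shows "simplex_sign (insert j I) i = simplex_sign I i * (if j < i then - 1 else 1)"
proof -
  have "{i' \<in> insert j I. i' < i} = (if j < i then insert j {i' \<in> I. i' < i} else {i' \<in> I. i' < i})" by auto
  then show ?thesis using assms by (simp add: simplex_sign_def)
qed

lemma simplex_sign_remove:
  assumes "finite I" "j \<in> I"
  shows "simplex_sign (I - {j}) i = simplex_sign I i * (if j < i then - 1 else 1)"
  using simplex_sign_insert[of "I - {j}" j i] assms by (simp add: insert_absorb)

lemma simplex_sign_square [simp]: "simplex_sign I i * simplex_sign I i = 1"
  by (simp add: simplex_sign_def power_add[symmetric] flip: mult_2)

text \<open>Removing \<open>i\<close> and \<open>j\<close> in either order leaves the same set, with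
  opposite signs, so the summand is antisymmetric.\<close>

lemma alternating_double_sum:
  assumes K: "finite K"
  shows "(\<Sum>i\<in>K. simplex_sign K i * (\<Sum>j\<in>K - {i}. simplex_sign (K - {i}) j * f (K - {i} - {j}))) = (0 :: complex)"
proof -
  define g where "g i j = (if i = j then 0 else simplex_sign K i * simplex_sign K j * (if i < j then - 1 else 1) * f (K - {i} - {j}))" for i j
  have expand: "(\<Sum>i\<in>K. simplex_sign K i * (\<Sum>j\<in>K - {i}. simplex_sign (K - {i}) j * f (K - {i} - {j}))) = (\<Sum>i\<in>K. \<Sum>j\<in>K. g i j)"
  proof (rule sum.cong[OF refl])
    fix i assume i: "i \<in> K"
    have "simplex_sign K i * (\<Sum>j\<in>K - {i}. simplex_sign (K - {i}) j * f (K - {i} - {j})) = (\<Sum>j\<in>K - {i}. g i j)"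
      unfolding sum_distrib_left
      by (rule sum.cong) (auto simp: g_def simplex_sign_remove[OF K i])
    also have "\<dots> = (\<Sum>j\<in>K. g i j)"
      using K by (intro sum.mono_neutral_left) (auto simp: g_def)
    finally show "simplex_sign K i * (\<Sum>j\<in>K - {i}. simplex_sign (K - {i}) j * f (K - {i} - {j})) = (\<Sum>j\<in>K. g i j)" .
  qed
  have anti: "g i j = - g j i" for i j
  proof -
    have "K - {i} - {j} = K - {j} - {i}" by blast
    then show ?thesis by (auto simp: g_def)
  qed
  have "(\<Sum>i\<in>K. \<Sum>j\<in>K. g i j) = (\<Sum>i\<in>K. \<Sum>j\<in>K. - g j i)"
    by (intro sum.cong refl) (rule anti)
  then have "(\<Sum>i\<in>K. \<Sum>j\<in>K. g i j) = - (\<Sum>i\<in>K. \<Sum>j\<in>K. g j i)"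
    by (simp only: sum_negf)
  moreover have "(\<Sum>i\<in>K. \<Sum>j\<in>K. g j i) = (\<Sum>i\<in>K. \<Sum>j\<in>K. g i j)" by (rule sum.swap)
  ultimately show ?thesis unfolding expand by (simp add: eq_neg_iff_add_eq_0)
qed

text \<open>The cone with apex \<open>j\<close> is a contracting homotopy.\<close>

lemma cone_homotopy:
  fixes c :: "nat set \<Rightarrow> complex"
  assumes I: "finite I"
    and cyc: "j \<notin> I \<Longrightarrow> (\<Sum>i\<in>insert j I. simplex_sign (insert j I) i * c (insert j I - {i})) = 0"
  shows "(\<Sum>i\<in>I. simplex_sign I i * (if j \<notin> I - {i} then simplex_sign (insert j (I - {i})) j * c (insert j (I - {i})) else 0)) = c I"
proof (cases "j \<in> I")
  case True
  have "(\<Sum>i\<in>I. simplex_sign I i * (if j \<notin> I - {i} then simplex_sign (insert j (I - {i})) j * c (insert j (I - {i})) else 0))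
     = (\<Sum>i\<in>I. if i = j then c I else 0)"
  proof (rule sum.cong[OF refl])
    fix i assume "i \<in> I"
    have "insert j (I - {j}) = I" using True by blast
    moreover have "simplex_sign I j * (simplex_sign I j * c I) = c I" by (simp flip: mult.assoc)
    ultimately show "simplex_sign I i * (if j \<notin> I - {i} then simplex_sign (insert j (I - {i})) j * c (insert j (I - {i})) else 0)
       = (if i = j then c I else 0)" using True by auto
  qed
  then show ?thesis using True I by simp
next
  case False
  let ?K = "insert j I"
  have "?K - {j} = I" using False by auto
  moreover have "(\<Sum>i\<in>?K. simplex_sign ?K i * c (?K - {i}))
     = simplex_sign ?K j * c (?K - {j}) + (\<Sum>i\<in>I. simplex_sign ?K i * c (?K - {i}))"
    using I False by simp
  ultimately have cI: "simplex_sign ?K j * c I = - (\<Sum>i\<in>I. simplex_sign ?K i * c (?K - {i}))"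
    using cyc[OF False] by (simp add: eq_neg_iff_add_eq_0)
  have "(\<Sum>i\<in>I. simplex_sign I i * (if j \<notin> I - {i} then simplex_sign (insert j (I - {i})) j * c (insert j (I - {i})) else 0))
     = (\<Sum>i\<in>I. - (simplex_sign ?K j * (simplex_sign ?K i * c (?K - {i}))))"
  proof (rule sum.cong[OF refl])
    fix i assume i: "i \<in> I"
    then have ij: "i \<noteq> j" and K: "insert j (I - {i}) = ?K - {i}" using False by auto
    have "simplex_sign (?K - {i}) j = simplex_sign ?K j * (if i < j then - 1 else 1)"
      using I i by (intro simplex_sign_remove) auto
    moreover have "simplex_sign ?K i = simplex_sign I i * (if j < i then - 1 else 1)"
      by (rule simplex_sign_insert[OF I False])
    ultimately show "simplex_sign I i * (if j \<notin> I - {i} then simplex_sign (insert j (I - {i})) j * c (insert j (I - {i})) else 0)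
        = - (simplex_sign ?K j * (simplex_sign ?K i * c (?K - {i})))"
      using False ij unfolding K by (cases "i < j") auto
  qed
  also have "\<dots> = simplex_sign ?K j * (simplex_sign ?K j * c I)"
    unfolding cI by (simp add: sum_negf sum_distrib_left)
  also have "\<dots> = c I" by (simp flip: mult.assoc)
  finally show ?thesis .
qed

section \<open>The Cech complex in coefficients\<close>

lemma simplicesD: "I \<in> simplices n p \<Longrightarrow> finite I" "I \<in> simplices n p \<Longrightarrow> I \<subseteq> {..n}"
  "I \<in> simplices n p \<Longrightarrow> I \<noteq> {}" "I \<in> simplices n p \<Longrightarrow> card I = Suc p"
  by (auto simp: simplices_def finite_subset)

lemma simplices_remove: "I \<in> simplices n (Suc p) \<Longrightarrow> i \<in> I \<Longrightarrow> I - {i} \<in> simplices n p"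
  by (auto simp: simplices_def)

lemma simplices_insert: "I \<in> simplices n p \<Longrightarrow> j \<notin> I \<Longrightarrow> j \<le> n \<Longrightarrow> insert j I \<in> simplices n (Suc p)"
  using finite_subset[of I "{..n}"] by (auto simp: simplices_def)

lemma finite_simplices: "finite (simplices n p)"
  by (rule finite_subset[of _ "Pow {..n}"]) (auto simp: simplices_def)

lemma simplices_large: "n < p \<Longrightarrow> simplices n p = {}"
proof (rule equals0I)
  fix I assume "n < p" "I \<in> simplices n p"
  then show False using card_mono[of "{..n}" I] by (auto simp: simplices_def)
qed

lemma chart_mono: "I \<subseteq> K \<Longrightarrow> chart n K \<subseteq> chart n I"
  by (auto simp: chart_def)

lemma torus_chart: "I \<subseteq> {..n} \<Longrightarrow> x \<in> chart n {..n} \<Longrightarrow> x \<in> chart n I"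
  by (auto simp: chart_def)

lemma coboundary_map_eq:
  "coboundary_map n p s I j x = (if I \<in> simplices n (Suc p) \<and> x \<in> chart n I
     then \<Sum>i\<in>I. simplex_sign I i * s (I - {i}) j x else 0)"
  by (simp add: coboundary_map_def restr_def simplex_sign_def)

lemma cochains_O_sum_coeffs:
  assumes "s \<in> cochains n (O_sum n a r) p"
  obtains c where "\<And>I l. I \<in> simplices n p \<Longrightarrow> l < r \<Longrightarrow> c I l \<in> lau n a I"
    "\<And>I l x. I \<in> simplices n p \<Longrightarrow> l < r \<Longrightarrow> x \<in> chart n I \<Longrightarrow> s I l x = leval n (c I l) x"
proof -
  have "\<exists>c. I \<in> simplices n p \<and> l < r \<longrightarrow> c \<in> lau n a I \<and> (\<forall>x\<in>chart n I. s I l x = leval n c x)" for I l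
  proof (cases "I \<in> simplices n p \<and> l < r")
    case True
    then have "s I l \<in> O_sections n a (chart n I)" using assms by (auto simp: cochains_def O_sum_def)
    then show ?thesis using O_sections_laurent[of I n "s I l" a] simplicesD[of I n p] True by blast
  qed blast
  then have "\<exists>c. \<forall>I l. I \<in> simplices n p \<and> l < r \<longrightarrow> c I l \<in> lau n a I \<and> (\<forall>x\<in>chart n I. s I l x = leval n (c I l) x)"
    by (intro choice allI)
  then show thesis using that by metis
qed

lemma cochains_O_sum_outside:
  assumes "s \<in> cochains n (O_sum n a r) p"
  shows "I \<notin> simplices n p \<or> r \<le> l \<or> x \<notin> chart n I \<Longrightarrow> s I l x = 0"
  using assms O_sections_outside[of "s I l" n a "chart n I" x]
  by (cases "I \<in> simplices n p"; cases "l < r") (auto simp: cochains_def O_sum_def)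

definition laurent_cochain :: "nat \<Rightarrow> nat \<Rightarrow> nat \<Rightarrow> (nat set \<Rightarrow> nat \<Rightarrow> (nat \<Rightarrow> int) \<Rightarrow> complex) \<Rightarrow> cochain" where
  "laurent_cochain n r p c = (\<lambda>I l x. if I \<in> simplices n p \<and> l < r \<and> x \<in> chart n I then leval n (c I l) x else 0)"

lemma laurent_cochain:
  assumes "\<And>I l. I \<in> simplices n p \<Longrightarrow> l < r \<Longrightarrow> c I l \<in> lau n a I"
  shows "laurent_cochain n r p c \<in> cochains n (O_sum n a r) p"
  unfolding cochains_def
proof (intro CollectI conjI ballI allI impI)
  fix I assume I: "I \<in> simplices n p"
  show "laurent_cochain n r p c I \<in> O_sum n a r (chart n I)"
    unfolding O_sum_def
  proof (intro CollectI conjI allI impI)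
    fix l assume l: "l < r"
    have "laurent_cochain n r p c I l = (\<lambda>x. if x \<in> chart n I then leval n (c I l) x else 0)"
      using I l by (simp add: laurent_cochain_def)
    then show "laurent_cochain n r p c I l \<in> O_sections n a (chart n I)"
      using laurent_section[OF simplicesD(2,3)[OF I] assms[OF I l]] by simp
  qed (simp add: laurent_cochain_def)
qed (simp add: laurent_cochain_def)

lemma leval_lincomb:
  assumes "finite S" "\<And>s. s \<in> S \<Longrightarrow> finite {e. c s e \<noteq> 0}"
  shows "leval n (\<lambda>e. \<Sum>s\<in>S. b s * c s e) x = (\<Sum>s\<in>S. b s * leval n (c s) x)"
proof -
  have "finite {e. b s * c s e \<noteq> 0}" if "s \<in> S" for s
    by (rule finite_subset[OF _ assms(2)[OF that]]) auto
  then show ?thesis using leval_sum[OF assms(1), of "\<lambda>s e. b s * c s e" n x] by (simp add: leval_scale)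
qed

text \<open>The cocycle condition holds separately for each exponent, because a Laurent polynomial
  vanishing on the torus has zero coefficients. The complex thus splits by exponent.\<close>

lemma cocycle_coeffs:
  assumes s: "s \<in> cocycles n (O_sum n a r) p"
    and c: "\<And>I l. I \<in> simplices n p \<Longrightarrow> l < r \<Longrightarrow> c I l \<in> lau n a I"
      "\<And>I l x. I \<in> simplices n p \<Longrightarrow> l < r \<Longrightarrow> x \<in> chart n I \<Longrightarrow> s I l x = leval n (c I l) x"
    and K: "K \<in> simplices n (Suc p)" and l: "l < r"
  shows "(\<Sum>i\<in>K. simplex_sign K i * c (K - {i}) l e) = 0"
proof (rule leval_zero_imp[where n = n and c = "\<lambda>e. \<Sum>i\<in>K. simplex_sign K i * c (K - {i}) l e"])
  have finK: "finite K" using simplicesD(1)[OF K] .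
  have cK: "c (K - {i}) l \<in> lau n a (K - {i})" if "i \<in> K" for i
    using c(1)[OF simplices_remove[OF K that] l] .
  have supp: "\<exists>i\<in>K. c (K - {i}) l e \<noteq> 0" if nz: "(\<Sum>i\<in>K. simplex_sign K i * c (K - {i}) l e) \<noteq> 0" for e
  proof (rule ccontr)
    assume "\<not> (\<exists>i\<in>K. c (K - {i}) l e \<noteq> 0)"
    then have "(\<Sum>i\<in>K. simplex_sign K i * c (K - {i}) l e) = 0" by (intro sum.neutral) auto
    then show False using nz by simp
  qed
  show "finite {e. (\<Sum>i\<in>K. simplex_sign K i * c (K - {i}) l e) \<noteq> 0}"
    by (rule finite_subset[of _ "\<Union>i\<in>K. {e. c (K - {i}) l e \<noteq> 0}"]) (use supp finK lauD(1)[OF cK] in auto)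
  show "e i = 0" if "(\<Sum>i\<in>K. simplex_sign K i * c (K - {i}) l e) \<noteq> 0" "n < i" for e i
    using supp[OF that(1)] lauD(4)[OF cK _ that(2)] by blast
  fix x assume x: "x \<in> chart n {..n}"
  have "leval n (\<lambda>e. \<Sum>i\<in>K. simplex_sign K i * c (K - {i}) l e) x = (\<Sum>i\<in>K. simplex_sign K i * leval n (c (K - {i}) l) x)"
    by (rule leval_lincomb[OF finK lauD(1)[OF cK]])
  also have "\<dots> = (\<Sum>i\<in>K. simplex_sign K i * s (K - {i}) l x)"
  proof (rule sum.cong[OF refl])
    fix i assume i: "i \<in> K"
    have "s (K - {i}) l x = leval n (c (K - {i}) l) x"
      using c(2)[OF simplices_remove[OF K i] l torus_chart[OF _ x]] simplicesD(2)[OF K] by blast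
    then show "simplex_sign K i * leval n (c (K - {i}) l) x = simplex_sign K i * s (K - {i}) l x" by simp
  qed
  also have "\<dots> = coboundary_map n p s K l x"
    using K torus_chart[OF simplicesD(2)[OF K] x] by (simp add: coboundary_map_eq)
  also have "\<dots> = 0" using s by (simp add: cocycles_def)
  finally show "leval n (\<lambda>e. \<Sum>i\<in>K. simplex_sign K i * c (K - {i}) l e) x = 0" .
qed

text \<open>For a fixed exponent \<open>e\<close> only simplices containing all indices with
  negative entry occur. If some entry is nonnegative, its index serves as the apex of a cone and the
  part is contractible. If all are negative, the simplex is everything, which happens only in
  cohomological degree \<open>n\<close> and for degree at most \<open>- n - 1\<close>.\<close>

lemma O_sum_cohomology:
  assumes s: "s \<in> cocycles n (O_sum n a r) (Suc p)" and cond: "Suc p < n \<or> - int n \<le> a"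
  shows "\<exists>t\<in>cochains n (O_sum n a r) p. s = coboundary_map n p t"
proof -
  have sc: "s \<in> cochains n (O_sum n a r) (Suc p)" using s by (simp add: cocycles_def)
  obtain c where c: "\<And>I l. I \<in> simplices n (Suc p) \<Longrightarrow> l < r \<Longrightarrow> c I l \<in> lau n a I"
    "\<And>I l x. I \<in> simplices n (Suc p) \<Longrightarrow> l < r \<Longrightarrow> x \<in> chart n I \<Longrightarrow> s I l x = leval n (c I l) x"
    using cochains_O_sum_coeffs[OF sc] by blast
  define apex where "apex e = (LEAST j. j \<le> n \<and> 0 \<le> e j)" for e :: "nat \<Rightarrow> int"
  have apex: "apex e \<le> n \<and> 0 \<le> e (apex e)" if I: "I \<in> simplices n (Suc p)" and l: "l < r" and nz: "c I l e \<noteq> 0" for I l e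
  proof -
    have "\<exists>j\<le>n. 0 \<le> e j"
    proof (rule ccontr)
      assume neg: "\<not> (\<exists>j\<le>n. 0 \<le> e j)"
      then have "{..n} \<subseteq> I" using lauD(3)[OF c(1)[OF I l] nz] by force
      then have "I = {..n}" using simplicesD(2)[OF I] by blast
      then have "Suc p = n" using simplicesD(4)[OF I] by simp
      moreover have "(\<Sum>i\<le>n. e i) \<le> (\<Sum>i\<le>n. - 1)" using neg by (intro sum_mono) force
      then have "a \<le> - int n - 1" using lauD(2)[OF c(1)[OF I l] nz] by (simp add: exps_def)
      ultimately show False using cond by simp
    qed
    then show ?thesis unfolding apex_def by (rule LeastI_ex)
  qed
  \<comment> \<open>The apex depends on the exponent, so the homotopy is applied coefficient by
    coefficient.\<close>
  define d where "d J l e = (if apex e \<le> n \<and> 0 \<le> e (apex e) \<and> apex e \<notin> J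
     then simplex_sign (insert (apex e) J) (apex e) * c (insert (apex e) J) l e else 0)" for J l e
  have dl: "d J l \<in> lau n a J" if J: "J \<in> simplices n p" and l: "l < r" for J l
  proof -
    have K: "insert (apex e) J \<in> simplices n (Suc p) \<and> c (insert (apex e) J) l e \<noteq> 0 \<and> 0 \<le> e (apex e)" if "d J l e \<noteq> 0" for e
      using that simplices_insert[OF J] by (auto simp: d_def split: if_splits)
    have "{e. d J l e \<noteq> 0} \<subseteq> (\<Union>K\<in>simplices n (Suc p). {e. c K l e \<noteq> 0})" using K by blast
    then have "finite {e. d J l e \<noteq> 0}"
      using finite_simplices lauD(1)[OF c(1)[OF _ l]] by (rule_tac finite_subset) auto
    moreover have "e \<in> exps n a" if "d J l e \<noteq> 0" for e
      using K[OF that] lauD(2)[OF c(1)[OF _ l]] by blast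
    moreover have "0 \<le> e i" if nz: "d J l e \<noteq> 0" and i: "i \<notin> J" for e i
    proof (cases "i = apex e")
      case True
      then show ?thesis using K[OF nz] by simp
    next
      case False
      then show ?thesis using K[OF nz] lauD(3)[OF c(1)[OF _ l], of "insert (apex e) J" e i] i by blast
    qed
    ultimately show ?thesis by (auto simp: lau_def)
  qed
  have hom: "(\<Sum>i\<in>I. simplex_sign I i * d (I - {i}) l e) = c I l e" if I: "I \<in> simplices n (Suc p)" and l: "l < r" for I l e
  proof (cases "apex e \<le> n \<and> 0 \<le> e (apex e)")
    case True
    have "(\<Sum>i\<in>I. simplex_sign I i * d (I - {i}) l e) =
      (\<Sum>i\<in>I. simplex_sign I i * (if apex e \<notin> I - {i} then simplex_sign (insert (apex e) (I - {i})) (apex e) * c (insert (apex e) (I - {i})) l e else 0))"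
      using True by (intro sum.cong) (auto simp: d_def)
    also have "\<dots> = c I l e"
    proof (rule cone_homotopy[where c = "\<lambda>I. c I l e", OF simplicesD(1)[OF I]])
      assume "apex e \<notin> I"
      then have K: "insert (apex e) I \<in> simplices n (Suc (Suc p))" using True by (intro simplices_insert[OF I]) auto
      show "(\<Sum>i\<in>insert (apex e) I. simplex_sign (insert (apex e) I) i * c (insert (apex e) I - {i}) l e) = 0"
        by (rule cocycle_coeffs[OF s c K l])
    qed
    finally show ?thesis .
  next
    case False
    then have "c I l e = 0" using apex[OF I l] by blast
    moreover have "d J l e = 0" for J using False by (auto simp: d_def)
    ultimately show ?thesis by simp
  qed
  let ?t = "laurent_cochain n r p d"
  have "s I l x = coboundary_map n p ?t I l x" for I l x
  proof (cases "I \<in> simplices n (Suc p) \<and> l < r \<and> x \<in> chart n I")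
    case True
    then have I: "I \<in> simplices n (Suc p)" and l: "l < r" and x: "x \<in> chart n I" by auto
    have sub: "x \<in> chart n (I - {i})" for i using x by (auto simp: chart_def)
    have "coboundary_map n p ?t I l x = (\<Sum>i\<in>I. simplex_sign I i * leval n (d (I - {i}) l) x)"
      using True sub by (auto simp: coboundary_map_eq laurent_cochain_def simplices_remove intro!: sum.cong)
    also have "\<dots> = leval n (\<lambda>e. \<Sum>i\<in>I. simplex_sign I i * d (I - {i}) l e) x"
      by (rule leval_lincomb[symmetric]) (use simplicesD(1)[OF I] lauD(1)[OF dl] simplices_remove[OF I] l in auto)
    also have "\<dots> = s I l x" using c(2)[OF I l x] by (simp add: hom[OF I l])
    finally show ?thesis by simp
  next
    case False
    have "s I l x = 0" using False by (intro cochains_O_sum_outside[OF sc]) auto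
    moreover have "coboundary_map n p ?t I l x = 0"
      using False by (auto simp: coboundary_map_eq laurent_cochain_def)
    ultimately show ?thesis by simp
  qed
  then have eq: "s = coboundary_map n p ?t" by (intro ext)
  show ?thesis
  proof (rule bexI[of _ ?t])
    show "s = coboundary_map n p ?t" by (rule eq)
    show "?t \<in> cochains n (O_sum n a r) p" by (rule laurent_cochain[OF dl])
  qed
qed

text \<open>The coefficients over the charts of single variables coincide. Each exponent may be
  negative only at the index of its chart, and two different charts exclude even that; hence
  \<open>n\<close> at least 1.\<close>

lemma O_sum_global_sections:
  assumes s: "s \<in> cocycles n (O_sum n a r) 0" and n: "1 \<le> n"
  shows "\<exists>u\<in>cvec n r a. s = laurent_cochain n r 0 (\<lambda>_. u)"
proof -
  have sc: "s \<in> cochains n (O_sum n a r) 0" using s by (simp add: cocycles_def)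
  obtain c where c: "\<And>I l. I \<in> simplices n 0 \<Longrightarrow> l < r \<Longrightarrow> c I l \<in> lau n a I"
    "\<And>I l x. I \<in> simplices n 0 \<Longrightarrow> l < r \<Longrightarrow> x \<in> chart n I \<Longrightarrow> s I l x = leval n (c I l) x"
    using cochains_O_sum_coeffs[OF sc] by blast
  have single: "{i} \<in> simplices n 0" if "i \<le> n" for i using that by (simp add: simplices_def)
  have simp0: "\<exists>i\<le>n. I = {i}" if "I \<in> simplices n 0" for I
    using that by (auto simp: simplices_def card_1_singleton_iff)
  have less: "c {i} l e = c {j} l e" if ij: "i < j" "j \<le> n" and l: "l < r" for i j l e
  proof -
    have K: "{i, j} \<in> simplices n (Suc 0)" using ij by (auto simp: simplices_def)
    have sets: "{i' \<in> {i, j}. i' < i} = {}" "{i' \<in> {i, j}. i' < j} = {i}" using ij by auto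
    have sg: "simplex_sign {i, j} i = 1" "simplex_sign {i, j} j = - 1" unfolding simplex_sign_def sets by simp_all
    have rm: "{i, j} - {i} = {j}" "{i, j} - {j} = {i}" using ij by auto
    have "(\<Sum>k\<in>{i, j}. simplex_sign {i, j} k * c ({i, j} - {k}) l e) = 0"
      by (rule cocycle_coeffs[OF s c K l])
    moreover have "(\<Sum>k\<in>{i, j}. simplex_sign {i, j} k * c ({i, j} - {k}) l e) = c {j} l e - c {i} l e"
      using ij(1) by (subst sum.insert) (auto simp: sg rm)
    ultimately show ?thesis by simp
  qed
  have eq: "c {i} l e = c {0} l e" if "i \<le> n" "l < r" for i l e
    using less[of 0 i l e] that by (cases "i = 0") auto
  define u where "u l e = (if l < r then c {0} l e else 0)" for l e
  have "u l e \<noteq> 0 \<Longrightarrow> l < r \<and> e \<in> mons n a" for l e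
  proof -
    assume nz: "u l e \<noteq> 0"
    then have l: "l < r" and c0: "c {0} l e \<noteq> 0" by (auto simp: u_def split: if_splits)
    \<comment> \<open>The chart with index 1 is the second one, ruling out a negative exponent at
      index 0.\<close>
    have c1: "c {1} l e \<noteq> 0" using eq[OF n l] c0 by simp
    have "0 \<le> e i" for i
      using lauD(3)[OF c(1)[OF single l] c0, of i] lauD(3)[OF c(1)[OF single[OF n] l] c1, of i] by (cases "i = 0") auto
    then show ?thesis using l lauD(2)[OF c(1)[OF single l] c0] by (simp add: mons_def)
  qed
  then have "u \<in> cvec n r a" by (auto simp: cvec_def)
  moreover have "s I l x = laurent_cochain n r 0 (\<lambda>_. u) I l x" for I l x
  proof (cases "I \<in> simplices n 0 \<and> l < r \<and> x \<in> chart n I")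
    case True
    then obtain i where i: "i \<le> n" "I = {i}" using simp0 by blast
    have "c I l = u l" using eq[OF i(1)] True by (auto simp: u_def i(2))
    then show ?thesis using True c(2)[of I l x] by (simp add: laurent_cochain_def)
  next
    case False
    then have "s I l x = 0" by (intro cochains_O_sum_outside[OF sc]) auto
    then show ?thesis using False by (auto simp: laurent_cochain_def)
  qed
  then have "s = laurent_cochain n r 0 (\<lambda>_. u)" by (intro ext)
  ultimately show ?thesis by blast
qed

section \<open>Cohomology of the kernel\<close>

lemma cvec_lau:
  assumes "u \<in> cvec n q a" shows "u l \<in> lau n a I"
proof -
  have "finite {e. u l e \<noteq> 0}" by (rule finite_subset[OF _ finite_mons[of n a]]) (use cvecD[OF assms] in auto)
  moreover have "e \<in> mons n a" if "u l e \<noteq> 0" for e using that cvecD[OF assms, of l e] by blast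
  ultimately show ?thesis by (auto simp: lau_def mons_def)
qed

text \<open>The link between the sheaf map on functions and \<open>act\<close> on
  coefficients.\<close>

lemma apply_laurent:
  assumes u: "\<And>j. j < q \<Longrightarrow> u j \<in> lau n a I" and x: "x \<in> chart n I"
  shows "(\<Sum>j<q. (\<Sum>i\<le>n. A (k, j, i) * x i) * leval n (u j) x) = leval n (act n q A u k) x"
proof -
  let ?S = "{..<q} \<times> {..n}"
  have fin: "finite {e. u (fst s) (dn (snd s) e) \<noteq> 0}" if "s \<in> ?S" for s
    using lauD(1)[OF lau_shift[OF u]] that by auto
  have "leval n (act n q A u k) x = leval n (\<lambda>e. \<Sum>s\<in>?S. A (k, fst s, snd s) * u (fst s) (dn (snd s) e)) x"
    by (simp add: act_def[abs_def] sum_Times)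
  also have "\<dots> = (\<Sum>s\<in>?S. A (k, fst s, snd s) * leval n (\<lambda>e. u (fst s) (dn (snd s) e)) x)"
    by (rule leval_lincomb) (use fin in auto)
  also have "\<dots> = (\<Sum>j<q. \<Sum>i\<le>n. A (k, j, i) * (x i * leval n (u j) x))"
    unfolding sum_Times using leval_shift[OF u _ x] by (intro sum.cong) auto
  finally show ?thesis by (simp add: sum_distrib_right mult.assoc)
qed

definition apply_cochain :: "nat \<Rightarrow> nat \<Rightarrow> nat \<Rightarrow> lin_matrix \<Rightarrow> cochain \<Rightarrow> cochain" where
  "apply_cochain n q p A s = (\<lambda>I. apply_map n q p A (s I))"

lemma apply_map_zero: "apply_map n q p A (\<lambda>_ _. 0) = (\<lambda>_ _. 0)"
  by (simp add: apply_map_def fun_eq_iff)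

lemma apply_map_O_sum:
  assumes U: "proj_open n U" and v: "v \<in> O_sum n a q U"
  shows "apply_map n q p A v \<in> O_sum n (a + 1) p U"
  unfolding O_sum_def
proof (intro CollectI conjI allI impI)
  fix k assume k: "k < p"
  have "(\<lambda>x. \<Sum>j<q. (\<Sum>i\<le>n. A (k, j, i) * x i) * v j x) \<in> O_sections n (a + 1) U"
  proof (rule O_sections_sum[OF U])
    fix j assume "j \<in> {..<q}"
    then have vj: "v j \<in> O_sections n a U" using v by (simp add: O_sum_def)
    have "hom_poly n 1 (\<lambda>x. \<Sum>i\<le>n. A (k, j, i) * x i)"
      by (intro hom_poly_sum hom_poly_scale hom_poly_coord) auto
    from O_sections_hom_mult[OF U this vj]
    show "(\<lambda>x. (\<Sum>i\<le>n. A (k, j, i) * x i) * v j x) \<in> O_sections n (a + 1) U" by simp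
  qed
  then show "apply_map n q p A v k \<in> O_sections n (a + 1) U" using k by (simp add: apply_map_def)
qed (simp add: apply_map_def fun_eq_iff)

lemma O_sum_outside: "v \<in> O_sum n a r U \<Longrightarrow> x \<notin> U \<or> r \<le> l \<Longrightarrow> v l x = 0"
  using O_sections_outside[of "v l" n a U x] by (cases "l < r") (auto simp: O_sum_def)

lemma simplices_chart_open: "I \<in> simplices n c \<Longrightarrow> proj_open n (chart n I)"
  by (rule chart_open) (rule simplicesD)

lemma apply_cochain_cochains:
  assumes "s \<in> cochains n (O_sum n a q) c"
  shows "apply_cochain n q p A s \<in> cochains n (O_sum n (a + 1) p) c"
  using assms apply_map_O_sum[OF simplices_chart_open]
  by (auto simp: cochains_def apply_cochain_def apply_map_zero)

lemma kernel_cochains: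
  "s \<in> cochains n (kernel_sheaf n q p A a) c \<longleftrightarrow>
     s \<in> cochains n (O_sum n a q) c \<and> apply_cochain n q p A s = (\<lambda>_ _ _. 0)"
proof
  assume s: "s \<in> cochains n (kernel_sheaf n q p A a) c"
  have "apply_map n q p A (s I) = (\<lambda>_ _. 0)" for I
    using s by (cases "I \<in> simplices n c") (auto simp: cochains_def kernel_sheaf_def apply_map_zero)
  then show "s \<in> cochains n (O_sum n a q) c \<and> apply_cochain n q p A s = (\<lambda>_ _ _. 0)"
    using s by (auto simp: cochains_def kernel_sheaf_def apply_cochain_def)
next
  assume s: "s \<in> cochains n (O_sum n a q) c \<and> apply_cochain n q p A s = (\<lambda>_ _ _. 0)"
  have "apply_map n q p A (s I) = (\<lambda>_ _. 0)" for I
  proof -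
    have "apply_cochain n q p A s I = (\<lambda>_ _. 0)" using s by simp
    then show ?thesis by (simp only: apply_cochain_def)
  qed
  then show "s \<in> cochains n (kernel_sheaf n q p A a) c"
    using s by (auto simp: cochains_def kernel_sheaf_def)
qed

lemma coboundary_apply:
  "coboundary_map n c (apply_cochain n q p A s) = apply_cochain n q p A (coboundary_map n c s)"
proof (intro ext)
  fix I k x
  show "coboundary_map n c (apply_cochain n q p A s) I k x = apply_cochain n q p A (coboundary_map n c s) I k x"
  proof (cases "I \<in> simplices n (Suc c) \<and> x \<in> chart n I \<and> k < p")
    case True
    have "(\<Sum>i\<in>I. simplex_sign I i * (\<Sum>j<q. (\<Sum>i\<le>n. A (k, j, i) * x i) * s (I - {i}) j x))
       = (\<Sum>j<q. (\<Sum>i\<le>n. A (k, j, i) * x i) * (\<Sum>i\<in>I. simplex_sign I i * s (I - {i}) j x))"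
      unfolding sum_distrib_left[where A = "{..<q}"] sum_distrib_left[where A = I]
      by (subst sum.swap) (simp add: mult_ac)
    then show ?thesis using True by (simp add: coboundary_map_eq apply_cochain_def apply_map_def)
  next
    case False
    then show ?thesis by (auto simp: coboundary_map_eq apply_cochain_def apply_map_def)
  qed
qed

lemma coboundary_cochains:
  assumes s: "s \<in> cochains n (O_sum n a r) c"
  shows "coboundary_map n c s \<in> cochains n (O_sum n a r) (Suc c)"
  unfolding cochains_def
proof (intro CollectI conjI ballI allI impI)
  fix I assume I: "I \<in> simplices n (Suc c)"
  show "coboundary_map n c s I \<in> O_sum n a r (chart n I)"
    unfolding O_sum_def
  proof (intro CollectI conjI allI impI)
    fix l assume l: "l < r"
    have "(\<lambda>x. \<Sum>i\<in>I. simplex_sign I i * (if x \<in> chart n I then s (I - {i}) l x else 0)) \<in> O_sections n a (chart n I)"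
    proof (intro O_sections_sum[OF simplices_chart_open[OF I]] O_sections_scale[OF simplices_chart_open[OF I]])
      fix i assume i: "i \<in> I"
      have "s (I - {i}) l \<in> O_sections n a (chart n (I - {i}))"
        using s simplices_remove[OF I i] l by (auto simp: cochains_def O_sum_def)
      then show "(\<lambda>x. if x \<in> chart n I then s (I - {i}) l x else 0) \<in> O_sections n a (chart n I)"
        by (rule O_sections_restr[OF _ simplices_chart_open[OF I]]) (auto simp: chart_def)
    qed
    also have "(\<lambda>x. \<Sum>i\<in>I. simplex_sign I i * (if x \<in> chart n I then s (I - {i}) l x else 0)) = coboundary_map n c s I l"
      using I by (auto simp: coboundary_map_eq fun_eq_iff)
    finally show "coboundary_map n c s I l \<in> O_sections n a (chart n I)" .
  next
    fix l assume "r \<le> l"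
    then show "coboundary_map n c s I l = (\<lambda>_. 0)"
      using cochains_O_sum_outside[OF s] by (auto simp: coboundary_map_eq fun_eq_iff)
  qed
qed (simp add: coboundary_map_eq fun_eq_iff)

lemma coboundary_coboundary: "coboundary_map n (Suc c) (coboundary_map n c s) = (\<lambda>_ _ _. 0)"
proof (intro ext)
  fix I l x
  show "coboundary_map n (Suc c) (coboundary_map n c s) I l x = 0"
  proof (cases "I \<in> simplices n (Suc (Suc c)) \<and> x \<in> chart n I")
    case True
    then have I: "I \<in> simplices n (Suc (Suc c))" and x: "x \<in> chart n I" by auto
    have "coboundary_map n (Suc c) (coboundary_map n c s) I l x
      = (\<Sum>i\<in>I. simplex_sign I i * (\<Sum>j\<in>I - {i}. simplex_sign (I - {i}) j * s (I - {i} - {j}) l x))"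
    proof -
      have "coboundary_map n c s (I - {i}) l x = (\<Sum>j\<in>I - {i}. simplex_sign (I - {i}) j * s (I - {i} - {j}) l x)" if "i \<in> I" for i
        using simplices_remove[OF I that] x chart_mono[of "I - {i}" I n] by (auto simp: coboundary_map_eq)
      then show ?thesis using True by (simp add: coboundary_map_eq[of n "Suc c"])
    qed
    also have "\<dots> = 0" by (rule alternating_double_sum[OF simplicesD(1)[OF I], of "\<lambda>J. s J l x"])
    finally show ?thesis .
  qed (auto simp: coboundary_map_eq)
qed

lemma coboundary_diff:
  "coboundary_map n c (\<lambda>I l x. s I l x - t I l x) = (\<lambda>I l x. coboundary_map n c s I l x - coboundary_map n c t I l x)"
  by (auto simp: coboundary_map_eq fun_eq_iff right_diff_distrib sum_subtractf)

lemma apply_cochain_diff: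
  "apply_cochain n q p A (\<lambda>I l x. s I l x - t I l x) = (\<lambda>I k x. apply_cochain n q p A s I k x - apply_cochain n q p A t I k x)"
  by (auto simp: apply_cochain_def apply_map_def fun_eq_iff right_diff_distrib sum_subtractf)

lemma cochains_diff:
  assumes s: "s \<in> cochains n (O_sum n a r) c" and t: "t \<in> cochains n (O_sum n a r) c"
  shows "(\<lambda>I l x. s I l x - t I l x) \<in> cochains n (O_sum n a r) c"
proof -
  have "(\<lambda>x. s I l x + (- 1) * t I l x) \<in> O_sections n a (chart n I)" if "I \<in> simplices n c" "l < r" for I l
    using s t that by (intro O_sections_add O_sections_scale simplices_chart_open[OF that(1)]) (auto simp: cochains_def O_sum_def)
  then show ?thesis using s t by (auto simp: cochains_def O_sum_def)
qed

lemma zero_cochain: "(\<lambda>_ _ _. 0) \<in> cochains n (O_sum n a r) c"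
  using O_sections_zero[OF simplices_chart_open] by (auto simp: cochains_def O_sum_def)

lemma coboundary_zero: "coboundary_map n c (\<lambda>_ _ _. 0) = (\<lambda>_ _ _. 0)"
  by (auto simp: coboundary_map_eq fun_eq_iff)

lemma coboundaries_subset_cocycles:
  "coboundaries n (kernel_sheaf n q p A a) c \<subseteq> cocycles n (kernel_sheaf n q p A a) c"
proof (cases c)
  case 0
  have "apply_cochain n q p A (\<lambda>_ _ _. 0) = (\<lambda>_ _ _. 0)" by (simp add: apply_cochain_def apply_map_zero)
  then show ?thesis
    using 0 zero_cochain[of n a q c] by (auto simp: coboundaries_def cocycles_def kernel_cochains coboundary_zero)
next
  case (Suc c')
  show ?thesis
  proof
    fix s assume "s \<in> coboundaries n (kernel_sheaf n q p A a) c"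
    then obtain t where t: "t \<in> cochains n (kernel_sheaf n q p A a) c'" "s = coboundary_map n c' t"
      using Suc by (auto simp: coboundaries_def)
    have "apply_cochain n q p A s = coboundary_map n c' (apply_cochain n q p A t)"
      unfolding t(2) by (rule coboundary_apply[symmetric])
    also have "\<dots> = (\<lambda>_ _ _. 0)" using t(1) by (simp add: kernel_cochains coboundary_zero)
    finally have "s \<in> cochains n (kernel_sheaf n q p A a) c"
      using coboundary_cochains[of t n a q c'] t Suc by (simp add: kernel_cochains)
    then show "s \<in> cocycles n (kernel_sheaf n q p A a) c"
      using coboundary_coboundary[of n c' t] t(2) Suc by (simp add: cocycles_def)
  qed
qed

lemma cohomology_vanishesI:
  assumes "\<And>s. s \<in> cocycles n (kernel_sheaf n q p A a) c \<Longrightarrow> s \<in> coboundaries n (kernel_sheaf n q p A a) c"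
  shows "cohomology_vanishes n (kernel_sheaf n q p A a) c"
  using assms coboundaries_subset_cocycles unfolding cohomology_vanishes_def by blast

lemma cohomology_vanishes_large:
  assumes "n < c" shows "cohomology_vanishes n (kernel_sheaf n q p A a) c"
proof (rule cohomology_vanishesI)
  fix s assume "s \<in> cocycles n (kernel_sheaf n q p A a) c"
  then have "s = (\<lambda>_ _ _. 0)"
    using simplices_large[OF assms] by (auto simp: cocycles_def cochains_def fun_eq_iff)
  moreover obtain c' where c': "c = Suc c'" using assms by (cases c) auto
  have "(\<lambda>_ _ _. 0) \<in> cochains n (kernel_sheaf n q p A a) c'"
    using zero_cochain by (simp add: kernel_cochains apply_cochain_def apply_map_zero)
  ultimately show "s \<in> coboundaries n (kernel_sheaf n q p A a) c"
    using coboundary_zero[of n c'] by (auto simp: coboundaries_def c' image_iff intro!: bexI[of _ "\<lambda>_ _ _. 0"])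
qed

text \<open>The part of the long exact sequence around the connecting map. A kernel cocycle is the
  coboundary of some \<open>u\<close> in the middle term; the image of \<open>u\<close> is a
  cocycle, and if that lifts to a cocycle \<open>v\<close>, then \<open>u - v\<close> lies in the
  kernel and still bounds.\<close>

lemma kernel_chase:
  assumes s: "s \<in> cocycles n (kernel_sheaf n q p A a) (Suc c)"
    and cond: "Suc c < n \<or> - int n \<le> a"
    and lift: "\<And>y. y \<in> cocycles n (O_sum n (a + 1) p) c \<Longrightarrow>
       \<exists>v\<in>cochains n (O_sum n a q) c. apply_cochain n q p A v = y \<and> coboundary_map n c v = (\<lambda>_ _ _. 0)"
  shows "s \<in> coboundaries n (kernel_sheaf n q p A a) (Suc c)"
proof -
  have sk: "s \<in> cochains n (O_sum n a q) (Suc c)" "apply_cochain n q p A s = (\<lambda>_ _ _. 0)"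
    "coboundary_map n (Suc c) s = (\<lambda>_ _ _. 0)"
    using s by (auto simp: cocycles_def kernel_cochains)
  then have "s \<in> cocycles n (O_sum n a q) (Suc c)" by (simp add: cocycles_def)
  then obtain u where u: "u \<in> cochains n (O_sum n a q) c" "s = coboundary_map n c u"
    using O_sum_cohomology cond by blast
  have "coboundary_map n c (apply_cochain n q p A u) = (\<lambda>_ _ _. 0)"
    using sk(2) by (simp add: coboundary_apply u(2))
  then have "apply_cochain n q p A u \<in> cocycles n (O_sum n (a + 1) p) c"
    using apply_cochain_cochains[OF u(1)] by (simp add: cocycles_def)
  then obtain v where v: "v \<in> cochains n (O_sum n a q) c" "apply_cochain n q p A v = apply_cochain n q p A u"
    "coboundary_map n c v = (\<lambda>_ _ _. 0)" using lift by blast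
  let ?w = "\<lambda>I l x. u I l x - v I l x"
  have "?w \<in> cochains n (kernel_sheaf n q p A a) c"
    using cochains_diff[OF u(1) v(1)] by (simp add: kernel_cochains apply_cochain_diff v(2))
  moreover have "s = coboundary_map n c ?w" by (simp add: coboundary_diff v(3) u(2))
  ultimately show ?thesis by (auto simp: coboundaries_def)
qed

text \<open>Global sections of the twisted kernel are the kernel of the graded map in degree
  \<open>a\<close>.\<close>

lemma kernel_H0:
  assumes n: "1 \<le> n" and inj: "inj_deg n q p a A"
  shows "cohomology_vanishes n (kernel_sheaf n q p A a) 0"
proof (rule cohomology_vanishesI)
  fix s assume s: "s \<in> cocycles n (kernel_sheaf n q p A a) 0"
  then have sk: "s \<in> cochains n (O_sum n a q) 0" "apply_cochain n q p A s = (\<lambda>_ _ _. 0)"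
    by (auto simp: cocycles_def kernel_cochains)
  have "s \<in> cocycles n (O_sum n a q) 0" using s sk by (simp add: cocycles_def)
  then obtain u where u: "u \<in> cvec n q a" "s = laurent_cochain n q 0 (\<lambda>_. u)"
    using O_sum_global_sections[OF _ n] by blast
  have "act n q A u k e = 0" if k: "k < p" for k e
  proof (rule leval_zero_imp[where n = n and c = "act n q A u k"])
    show "finite {e. act n q A u k e \<noteq> 0}"
      by (rule finite_subset[OF _ finite_mons[of n "a + 1"]]) (use act_outside[OF u(1)] in auto)
    show "e i = 0" if "act n q A u k e \<noteq> 0" "n < i" for e i
      using act_outside[OF u(1), of e A k] that by (auto simp: mons_def exps_def)
    fix x assume x: "x \<in> chart n {..n}"
    have x0: "x \<in> chart n {0}" using x by (auto simp: chart_def)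
    have s0: "{0} \<in> simplices n 0" by (simp add: simplices_def)
    have "leval n (act n q A u k) x = (\<Sum>j<q. (\<Sum>i\<le>n. A (k, j, i) * x i) * leval n (u j) x)"
      by (rule apply_laurent[OF cvec_lau[OF u(1)] x0, symmetric])
    also have "\<dots> = apply_cochain n q p A s {0} k x"
      using k x0 s0 by (simp add: apply_cochain_def apply_map_def u(2) laurent_cochain_def)
    finally show "leval n (act n q A u k) x = 0" by (simp add: sk(2))
  qed
  then have "u = (\<lambda>_ _. 0)" using inj u(1) unfolding inj_deg_def by blast
  then have "s = (\<lambda>_ _ _. 0)" by (auto simp: u(2) laurent_cochain_def leval_def fun_eq_iff)
  then show "s \<in> coboundaries n (kernel_sheaf n q p A a) 0" by (simp add: coboundaries_def)
qed

lemma sur_deg_trivial: "a + 1 < 0 \<Longrightarrow> sur_deg n q p a A"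
  by (simp add: sur_deg_unitv mons_neg)

text \<open>Once the middle term has no first cohomology, which is what \<open>cond\<close> ensures,
  the obstruction is the cokernel of the graded map in degree \<open>a\<close>.\<close>

lemma kernel_H1:
  assumes n: "1 \<le> n" and sur: "sur_deg n q p a A" and cond: "1 < n \<or> - int n \<le> a"
  shows "cohomology_vanishes n (kernel_sheaf n q p A a) 1"
proof (rule cohomology_vanishesI)
  fix s assume s: "s \<in> cocycles n (kernel_sheaf n q p A a) 1"
  show "s \<in> coboundaries n (kernel_sheaf n q p A a) 1"
    unfolding One_nat_def
  proof (rule kernel_chase)
    show "s \<in> cocycles n (kernel_sheaf n q p A a) (Suc 0)" using s by simp
    show "Suc 0 < n \<or> - int n \<le> a" using cond by simp
    fix y assume "y \<in> cocycles n (O_sum n (a + 1) p) 0"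
    then obtain w where w: "w \<in> cvec n p (a + 1)" "y = laurent_cochain n p 0 (\<lambda>_. w)"
      using O_sum_global_sections[OF _ n] by blast
    obtain u where u: "u \<in> cvec n q a" "\<And>k e. k < p \<Longrightarrow> act n q A u k e = w k e"
      using sur w(1) unfolding sur_deg_def in_image_def by blast
    let ?v = "laurent_cochain n q 0 (\<lambda>_. u)"
    have "?v \<in> cochains n (O_sum n a q) 0" by (intro laurent_cochain cvec_lau[OF u(1)])
    moreover have "apply_cochain n q p A ?v = y"
    proof (intro ext)
      fix I k x
      show "apply_cochain n q p A ?v I k x = y I k x"
      proof (cases "I \<in> simplices n 0 \<and> k < p \<and> x \<in> chart n I")
        case True
        then have "(\<Sum>j<q. (\<Sum>i\<le>n. A (k, j, i) * x i) * leval n (u j) x) = leval n (act n q A u k) x"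
          by (intro apply_laurent[OF cvec_lau[OF u(1)]]) auto
        also have "act n q A u k = w k" using u(2) True by auto
        finally show ?thesis using True by (simp add: apply_cochain_def apply_map_def w(2) laurent_cochain_def)
      next
        case False
        then show ?thesis by (auto simp: apply_cochain_def apply_map_def w(2) laurent_cochain_def)
      qed
    qed
    \<comment> \<open>Global polynomials have the same value on every chart, and the two signs of an
      edge cancel.\<close>
    moreover have "coboundary_map n 0 ?v = (\<lambda>_ _ _. 0)"
    proof (intro ext)
      fix I l x
      show "coboundary_map n 0 ?v I l x = 0"
      proof (cases "I \<in> simplices n (Suc 0) \<and> x \<in> chart n I \<and> l < q")
        case True
        then have I: "I \<in> simplices n (Suc 0)" by blast
        have sub: "x \<in> chart n (I - {i})" for i using True by (auto simp: chart_def)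
        have "coboundary_map n 0 ?v I l x = (\<Sum>i\<in>I. simplex_sign I i) * leval n (u l) x"
          using True sub
          by (auto simp: coboundary_map_eq laurent_cochain_def simplices_remove[OF I] sum_distrib_right intro!: sum.cong)
        also have "(\<Sum>i\<in>I. simplex_sign I i) = 0"
        proof -
          obtain i j where ij: "I = {i, j}" "i \<noteq> j" using simplicesD(4)[OF I] by (auto simp: card_2_iff numeral_2_eq_2[symmetric])
          have "simplex_sign {i, j} i + simplex_sign {i, j} j = 0"
            using ij(2) simplex_sign_insert[of "{j}" i i] simplex_sign_insert[of "{j}" i j]
              simplex_sign_insert[of "{}" j i] simplex_sign_insert[of "{}" j j]
            by (cases "i < j") (auto simp: simplex_sign_def)
          then show ?thesis using ij by simp
        qed
        finally show ?thesis by simp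
      next
        case False
        then show ?thesis by (auto simp: coboundary_map_eq laurent_cochain_def)
      qed
    qed
    ultimately show "\<exists>v\<in>cochains n (O_sum n a q) 0. apply_cochain n q p A v = y \<and> coboundary_map n 0 v = (\<lambda>_ _ _. 0)"
      by blast
  qed
qed

text \<open>A lift of \<open>x\<^sub>i\<^sup>d\<^sup>+\<^sup>1\<close> times each basis vector gives a right inverse where \<open>x\<^sub>i\<close> is invertible.\<close>

lemma local_right_inverse:
  assumes d: "0 \<le> d" and sur: "sur_deg n q p d A" and i: "i \<le> n"
    and U: "proj_open n U" "U \<subseteq> chart n {i}" and w: "w \<in> O_sum n (a + 1) p U"
  shows "\<exists>v\<in>O_sum n a q U. apply_map n q p A v = w"
proof -
  define m where "m = nat (d + 1)"
  define e0 where "e0 = (\<lambda>j. if j = i then d + 1 else 0 :: int)"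
  have e0: "e0 \<in> mons n (d + 1)" using d i by (auto simp: e0_def mons_def exps_def)
  have lm: "lmon n e0 x = x i ^ m" for x
  proof -
    have "lmon n e0 x = (\<Prod>j\<le>n. if j = i then x i ^ m else 1)"
      unfolding lmon_def e0_def m_def using d by (intro prod.cong) (auto simp: power_int_nonneg_exp)
    then show ?thesis using i by simp
  qed
  have "\<forall>k. \<exists>u. k < p \<longrightarrow> u \<in> cvec n q d \<and> (\<forall>k'<p. \<forall>e. act n q A u k' e = unitv k e0 k' e)"
    using sur e0 unfolding sur_deg_unitv in_image_def by blast
  then obtain u where u: "\<And>k. k < p \<Longrightarrow> u k \<in> cvec n q d"
    "\<And>k k' e. k < p \<Longrightarrow> k' < p \<Longrightarrow> act n q A (u k) k' e = unitv k e0 k' e" by metis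
  define r where "r k j x = (if x \<in> U then leval n (u k j) x else 0)" for k j and x :: point
  have r: "r k j \<in> O_sections n d U" if "k < p" for k j
  proof -
    have "(\<lambda>x. if x \<in> chart n {i} then leval n (u k j) x else 0) \<in> O_sections n d (chart n {i})"
      using i by (intro laurent_section cvec_lau[OF u(1)[OF that]]) auto
    from O_sections_restr[OF this U]
    have "(\<lambda>x. if x \<in> U then if x \<in> chart n {i} then leval n (u k j) x else 0 else 0) \<in> O_sections n d U" .
    also have "(\<lambda>x. if x \<in> U then if x \<in> chart n {i} then leval n (u k j) x else 0 else 0) = r k j"
      using U(2) by (auto simp: r_def fun_eq_iff)
    finally show ?thesis .
  qed
  have xi: "x i \<noteq> 0" if "x \<in> U" for x using that U(2) by (auto simp: chart_def)
  have inv: "(\<lambda>x. if x \<in> U then 1 / x i ^ m else 0) \<in> O_sections n (- (d + 1)) U"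
    using hom_poly_pow[OF hom_poly_coord[OF i], of m] hom_poly_const[of n 1] d xi
    by (intro O_sections_quot[OF U(1)]) (auto simp: m_def)
  \<comment> \<open>The degrees add up to \<open>(a + 1) + d - (d + 1) = a\<close>: a section of the
    target, an entry of the polynomial lift, and the inverse of the power of the coordinate.\<close>
  define v where "v j x = (if j < q then \<Sum>k<p. w k x * (r k j x * (if x \<in> U then 1 / x i ^ m else 0)) else 0)" for j x
  have "v \<in> O_sum n a q U"
    unfolding O_sum_def
  proof (intro CollectI conjI allI impI)
    fix j assume j: "j < q"
    have "(\<lambda>x. \<Sum>k<p. w k x * (r k j x * (if x \<in> U then 1 / x i ^ m else 0))) \<in> O_sections n a U"
    proof (rule O_sections_sum[OF U(1)])
      fix k assume "k \<in> {..<p}"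
      then have k: "k < p" by simp
      have "w k \<in> O_sections n (a + 1) U" using w k by (simp add: O_sum_def)
      from O_sections_mult[OF this O_sections_mult[OF r[OF k] inv]]
      show "(\<lambda>x. w k x * (r k j x * (if x \<in> U then 1 / x i ^ m else 0))) \<in> O_sections n a U" by simp
    qed
    then show "v j \<in> O_sections n a U" using j by (simp add: v_def[abs_def])
  qed (simp add: v_def fun_eq_iff)
  moreover have "apply_map n q p A v k x = w k x" for k x
  proof (cases "k < p \<and> x \<in> U")
    case True
    then have k: "k < p" and x: "x \<in> U" by auto
    have xc: "x \<in> chart n {i}" using x U(2) by blast
    have key: "(\<Sum>j<q. (\<Sum>i\<le>n. A (k, j, i) * x i) * leval n (u k' j) x) = (if k' = k then x i ^ m else 0)" if k': "k' < p" for k'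
    proof -
      have "(\<Sum>j<q. (\<Sum>i\<le>n. A (k, j, i) * x i) * leval n (u k' j) x) = leval n (act n q A (u k') k) x"
        by (rule apply_laurent[OF cvec_lau[OF u(1)[OF k']] xc])
      also have "act n q A (u k') k = (\<lambda>e. if e = e0 then (if k' = k then 1 else 0) else 0)"
        using u(2)[OF k' k] by (auto simp: unitv_def fun_eq_iff)
      finally show ?thesis by (simp add: leval_single lm)
    qed
    have "apply_map n q p A v k x = (\<Sum>j<q. (\<Sum>i\<le>n. A (k, j, i) * x i) * (\<Sum>k'<p. w k' x / x i ^ m * leval n (u k' j) x))"
      using k x by (simp add: apply_map_def v_def r_def)
    also have "\<dots> = (\<Sum>k'<p. w k' x / x i ^ m * (\<Sum>j<q. (\<Sum>i\<le>n. A (k, j, i) * x i) * leval n (u k' j) x))"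
      unfolding sum_distrib_left[where A = "{..<p}"] sum_distrib_left[where A = "{..<q}"]
      by (subst sum.swap) (simp add: mult_ac)
    also have "\<dots> = (\<Sum>k'<p. if k' = k then w k x else 0)"
      using xi[OF x] by (intro sum.cong refl) (auto simp: key)
    also have "\<dots> = w k x" using k by simp
    finally show ?thesis .
  next
    case False
    then have "w k x = 0" using O_sum_outside[OF w] by auto
    moreover have "apply_map n q p A v k x = 0"
    proof (cases "k < p")
      case True
      then have "v j x = 0" for j using False by (simp add: v_def)
      then show ?thesis by (simp add: apply_map_def)
    qed (simp add: apply_map_def)
    ultimately show ?thesis by simp
  qed
  then have "apply_map n q p A v = w" by (intro ext)
  ultimately show ?thesis by blast
qed

text \<open>Here the cocycle to be lifted is itself a coboundary, since \<open>Suc c < n\<close>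
  kills the intermediate cohomology in every twist. Its bounding cochain lifts chart by chart
  through the local right inverse, and the coboundary of that lift is automatically a
  cocycle.\<close>

lemma kernel_H_ge2:
  assumes d: "0 \<le> d" and sur: "sur_deg n q p d A" and cond: "Suc (Suc c) < n \<or> - int n \<le> a" and c: "Suc (Suc c) \<le> n"
  shows "cohomology_vanishes n (kernel_sheaf n q p A a) (Suc (Suc c))"
proof (rule cohomology_vanishesI, rule kernel_chase)
  show "Suc (Suc c) < n \<or> - int n \<le> a" by (rule cond)
  fix y assume "y \<in> cocycles n (O_sum n (a + 1) p) (Suc c)"
  then obtain w where w: "w \<in> cochains n (O_sum n (a + 1) p) c" "y = coboundary_map n c w"
    using O_sum_cohomology[of y n "a + 1" p c] c by auto
  have "\<forall>I. \<exists>v. (I \<in> simplices n c \<longrightarrow> v \<in> O_sum n a q (chart n I) \<and> apply_map n q p A v = w I) \<and>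
      (I \<notin> simplices n c \<longrightarrow> v = (\<lambda>_ _. 0))"
  proof
    fix I
    show "\<exists>v. (I \<in> simplices n c \<longrightarrow> v \<in> O_sum n a q (chart n I) \<and> apply_map n q p A v = w I) \<and>
      (I \<notin> simplices n c \<longrightarrow> v = (\<lambda>_ _. 0))"
    proof (cases "I \<in> simplices n c")
      case True
      then obtain i where i: "i \<in> I" "i \<le> n" using simplicesD(2,3)[OF True] by blast
      have "w I \<in> O_sum n (a + 1) p (chart n I)" using w(1) True by (simp add: cochains_def)
      from local_right_inverse[OF d sur i(2) simplices_chart_open[OF True] _ this]
      show ?thesis using True i(1) chart_mono[of "{i}" I n] by auto
    qed auto
  qed
  then obtain v where v: "\<And>I. I \<in> simplices n c \<Longrightarrow> v I \<in> O_sum n a q (chart n I)"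
    "\<And>I. I \<in> simplices n c \<Longrightarrow> apply_map n q p A (v I) = w I" "\<And>I. I \<notin> simplices n c \<Longrightarrow> v I = (\<lambda>_ _. 0)"
    by metis
  have vc: "v \<in> cochains n (O_sum n a q) c" using v by (simp add: cochains_def)
  have "apply_cochain n q p A v = w"
  proof (rule ext)
    fix I
    show "apply_cochain n q p A v I = w I"
      using v w(1) by (cases "I \<in> simplices n c") (auto simp: apply_cochain_def apply_map_zero cochains_def)
  qed
  then have "apply_cochain n q p A (coboundary_map n c v) = y"
    using coboundary_apply[of n c q p A v] w(2) by simp
  then show "\<exists>v\<in>cochains n (O_sum n a q) (Suc c). apply_cochain n q p A v = y \<and> coboundary_map n (Suc c) v = (\<lambda>_ _ _. 0)"
    using coboundary_cochains[OF vc] coboundary_coboundary by blast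
qed

text \<open>The twists fall into three ranges with at most one surviving group each: degree 0 for
  \<open>a\<close> at least \<open>d\<close>, degree 1 for \<open>a\<close> from -1 to
  \<open>d - 1\<close>, and degree \<open>n\<close> for \<open>a\<close> at most -2.\<close>

lemma kernel_natural_cohomology:
  assumes n: "1 \<le> n" and d: "0 \<le> d" and inj: "inj_deg n q p (d - 1) A" and sur: "sur_deg n q p d A"
  shows "natural_cohomology n (kernel_sheaf n q p A)"
proof -
  let ?V = "\<lambda>a c. cohomology_vanishes n (kernel_sheaf n q p A a) c"
  have ge2: "?V a c" if c2: "2 \<le> c" and cond: "c < n \<or> - int n \<le> a" for a c
  proof (cases "c \<le> n")
    case True
    obtain c' where "c = 2 + c'" using le_Suc_ex[OF c2] by blast
    then show ?thesis using kernel_H_ge2[OF d sur, of c' a] cond True by simp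
  qed (simp add: cohomology_vanishes_large)
  have H0: "?V a 0" if "a \<le> d - 1" for a
    using kernel_H0[OF n inj_deg_mono[OF inj that]] .
  have "\<exists>i. \<forall>c. c \<noteq> i \<longrightarrow> ?V a c" for a
  proof -
    \<comment> \<open>Below -1 the target of the graded map is zero, so surjectivity is automatic
      and first cohomology vanishes unless \<open>n = 1\<close>. From -1 on, \<open>a\<close> is at
      least \<open>- n\<close>, which removes the top cohomology.\<close>
    consider "d \<le> a" | "- 1 \<le> a" "a < d" | "a \<le> - 2" by linarith
    then show ?thesis
    proof cases
      case 1
      then have "?V a 1" using d n by (intro kernel_H1 sur_deg_mono[OF sur]) auto
      moreover have "?V a c" if "2 \<le> c" for c using ge2[OF that, of a] 1 d by simp
      ultimately have "?V a c" if "c \<noteq> 0" for c using that by (cases "c = 1") auto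
      then show ?thesis by blast
    next
      case 2
      have "?V a c" if "2 \<le> c" for c using ge2[OF that, of a] 2 n by simp
      moreover have "?V a 0" using H0[of a] 2 by simp
      ultimately have "?V a c" if "c \<noteq> 1" for c using that by (cases "c = 0") auto
      then show ?thesis by blast
    next
      case 3
      have v0: "?V a 0" using H0[of a] 3 d by simp
      have "?V a c" if c: "c \<noteq> n" for c
      proof (cases "n < c")
        case True
        then show ?thesis by (rule cohomology_vanishes_large)
      next
        case False
        then have cn: "c < n" using c by simp
        consider "c = 0" | "c = 1" | "2 \<le> c" by linarith
        then show ?thesis
        proof cases
          case 1
          then show ?thesis using v0 by simp
        next
          case 2
          have "?V a 1" using 3 cn 2 n by (intro kernel_H1 sur_deg_trivial) auto
          then show ?thesis using 2 by simp
        next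
          case 3
          then show ?thesis using ge2 cn by blast
        qed
      qed
      then show ?thesis by blast
    qed
  qed
  then show ?thesis unfolding natural_cohomology_def Uniq_def by (metis (no_types))
qed

lemma kernel_surjective_map:
  assumes d: "0 \<le> d" and sur: "sur_deg n q p d A"
  shows "surjective_map n q p A"
  unfolding surjective_map_def
proof (intro allI impI ballI)
  fix U w x assume U: "proj_open n U" and w: "w \<in> O_sum n 1 p U" and x: "x \<in> U"
  obtain i where i: "i \<le> n" "x i \<noteq> 0" using ex_coord_nonzero proj_open_subset[OF U] x by blast
  let ?W = "U \<inter> chart n {i}"
  have W: "proj_open n ?W" using U i by (intro proj_open_Int chart_open) auto
  have xW: "x \<in> ?W" using x i proj_open_subset[OF U] by (auto simp: chart_def)
  have "restr ?W w \<in> O_sum n (0 + 1) p ?W"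
    unfolding O_sum_def
  proof (intro CollectI conjI allI impI)
    fix k assume "k < p"
    then have "w k \<in> O_sections n (0 + 1) U" using w by (simp add: O_sum_def)
    from O_sections_restr[OF this W]
    show "restr ?W w k \<in> O_sections n (0 + 1) ?W" by (simp add: restr_def)
  next
    fix k assume "p \<le> k"
    then show "restr ?W w k = (\<lambda>_. 0)" using w by (auto simp: restr_def O_sum_def fun_eq_iff)
  qed
  from local_right_inverse[OF d sur i(1) W _ this]
  show "\<exists>W. proj_open n W \<and> x \<in> W \<and> W \<subseteq> U \<and> (\<exists>v\<in>O_sum n 0 q W. apply_map n q p A v = restr W w)"
    using W xW by (intro exI[of _ ?W]) auto
qed

section \<open>Local freeness of the kernel\<close>

definition rows_indep :: "nat \<Rightarrow> nat \<Rightarrow> (nat \<Rightarrow> nat \<Rightarrow> complex) \<Rightarrow> bool" where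
  "rows_indep m q R \<longleftrightarrow> (\<forall>y. (\<forall>j<q. (\<Sum>k<m. y k * R k j) = 0) \<longrightarrow> (\<forall>k<m. y k = 0))"

text \<open>Some unit vector lies outside the span of fewer than \<open>q\<close> rows: otherwise
  the identity would factor through \<open>m\<close> rows.\<close>

lemma rows_indep_extend_one:
  assumes R: "rows_indep m q R" and m: "m < q"
  shows "\<exists>v. rows_indep (Suc m) q (R(m := v))"
proof -
  have "\<exists>j<q. \<forall>y. \<exists>j'<q. (\<Sum>k<m. y k * R k j') \<noteq> (if j' = j then 1 else 0)"
  proof (rule ccontr)
    assume "\<not> ?thesis"
    then have "\<forall>j. \<exists>y. j < q \<longrightarrow> (\<forall>j'<q. (\<Sum>k<m. y k * R k j') = (if j' = j then 1 else 0))" by blast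
    then obtain C where C: "\<And>j j'. j < q \<Longrightarrow> j' < q \<Longrightarrow> (\<Sum>k<m. C j k * R k j') = (if j' = j then 1 else 0)"
      by metis
    \<comment> \<open>The coefficients are padded with zero columns to a square matrix; column
      \<open>m\<close> is then zero, which contradicts the nonzero determinant.\<close>
    let ?C = "\<lambda>j k. if k < m then C j k else 0"
    have "fdet {..<q} (\<lambda>j j'. \<Sum>k\<in>{..<q}. ?C j k * R k j') = 1"
    proof (rule fdet_one)
      fix j j' assume j: "j \<in> {..<q}" "j' \<in> {..<q}"
      have "(\<Sum>k\<in>{..<q}. ?C j k * R k j') = (\<Sum>k<m. C j k * R k j')"
        using m by (intro sum.mono_neutral_cong_right) auto
      then show "(\<Sum>k\<in>{..<q}. ?C j k * R k j') = (if j = j' then 1 else 0)" using C j by auto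
    qed simp
    then have "fdet {..<q} ?C \<noteq> 0" by (subst (asm) fdet_mult) auto
    moreover have "\<forall>x\<in>{..<q}. (\<Sum>y\<in>{..<q}. ?C x y * (if y = m then 1 else 0)) = 0"
      by (auto intro!: sum.neutral)
    then have "fdet {..<q} ?C = 0"
      using m by (subst fdet_zero_iff) (auto intro!: exI[of _ "\<lambda>y. if y = m then 1 else 0"])
    ultimately show False by simp
  qed
  then obtain j where j: "j < q" "\<And>y. \<exists>j'<q. (\<Sum>k<m. y k * R k j') \<noteq> (if j' = j then 1 else 0)" by blast
  let ?v = "\<lambda>j'. if j' = j then 1 else 0 :: complex"
  have "rows_indep (Suc m) q (R(m := ?v))"
    unfolding rows_indep_def
  proof (intro allI impI)
    fix y k assume z: "\<forall>j'<q. (\<Sum>k<Suc m. y k * (R(m := ?v)) k j') = 0" and k: "k < Suc m"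
    have z': "(\<Sum>k<m. y k * R k j') + y m * ?v j' = 0" if "j' < q" for j'
      using z that by simp
    have ym: "y m = 0"
    proof (rule ccontr)
      assume ym: "y m \<noteq> 0"
      obtain j' where j': "j' < q" "(\<Sum>k<m. (- y k / y m) * R k j') \<noteq> ?v j'" using j(2)[of "\<lambda>k. - y k / y m"] by blast
      have "(\<Sum>k<m. (- y k / y m) * R k j') = - (\<Sum>k<m. y k * R k j') / y m"
        by (simp add: sum_divide_distrib sum_negf)
      also have "\<dots> = ?v j'" using z'[OF j'(1)] ym by (simp add: eq_neg_iff_add_eq_0[symmetric] field_simps add_eq_0_iff split: if_splits)
      finally show False using j'(2) by simp
    qed
    then have "\<forall>j'<q. (\<Sum>k<m. y k * R k j') = 0" using z' by simp
    then show "y k = 0" using R k ym unfolding rows_indep_def by (cases "k = m") auto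
  qed
  then show ?thesis by blast
qed

lemma rows_indep_extend:
  assumes "rows_indep m q R" "m \<le> q"
  shows "\<exists>R'. (\<forall>k<m. R' k = R k) \<and> rows_indep q q R'"
  using assms
proof (induction "q - m" arbitrary: m R)
  case 0
  then show ?case by (intro exI[of _ R]) auto
next
  case (Suc l)
  then have "m < q" by simp
  then obtain v where v: "rows_indep (Suc m) q (R(m := v))"
    using rows_indep_extend_one[OF Suc.prems(1)] by blast
  obtain R' where "\<forall>k<Suc m. R' k = (R(m := v)) k" "rows_indep q q R'"
  proof -
    have "l = q - Suc m" "Suc m \<le> q" using Suc.hyps(2) by simp_all
    then show thesis using Suc.hyps(1)[OF _ v] that by blast
  qed
  then have "\<forall>k<m. R' k = R k" by simp
  then show ?case using \<open>rows_indep q q R'\<close> by blast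
qed

lemma rows_indep_det:
  assumes "rows_indep q q R"
  shows "det (mat q q (\<lambda>(k, j). R k j)) \<noteq> 0"
proof
  let ?G = "mat q q (\<lambda>(k, j). R k j)"
  assume "det ?G = 0"
  then have "det (transpose_mat ?G) = 0" by (subst det_transpose[of _ q]) auto
  then obtain v where v: "v \<in> carrier_vec q" "v \<noteq> 0\<^sub>v q" "transpose_mat ?G *\<^sub>v v = 0\<^sub>v q"
    using det_0_iff_vec_prod_zero_field[of "transpose_mat ?G" q] by auto
  have "(\<Sum>k<q. v $ k * R k j) = 0" if j: "j < q" for j
  proof -
    have "(transpose_mat ?G *\<^sub>v v) $ j = (\<Sum>k<q. v $ k * R k j)"
      using j v(1) by (auto simp: scalar_prod_def atLeast0LessThan mult.commute intro!: sum.cong)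
    then show ?thesis using v(3) j by simp
  qed
  then have "\<forall>k<q. v $ k = 0" using assms unfolding rows_indep_def by blast
  then have "v = 0\<^sub>v q" using v(1) by (intro eq_vecI) auto
  then show False using v(2) by simp
qed

lemma hom_poly_det:
  assumes "\<And>i j. i < N \<Longrightarrow> j < N \<Longrightarrow> hom_poly n (d i) (\<lambda>x. M x (i, j))"
  shows "hom_poly n (\<Sum>i<N. d i) (\<lambda>x. det (mat N N (M x)))"
proof -
  have eq: "(\<lambda>x. det (mat N N (M x)))
      = (\<lambda>x. \<Sum>p\<in>{p. p permutes {0..<N}}. signof p * (\<Prod>i\<in>{..<N}. M x (i, p i)))"
    by (auto simp: det_def permutes_in_image atLeast0LessThan intro!: sum.cong prod.cong ext)
  show ?thesis
    unfolding eq
  proof (intro hom_poly_sum hom_poly_scale hom_poly_prod)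
    fix p i assume p: "p \<in> {p. p permutes {0..<N}}" and i: "i \<in> {..<N}"
    then have "p i < N" using permutes_in_image[of p "{0..<N}" i] by auto
    then show "hom_poly n (d i) (\<lambda>x. M x (i, p i))" using assms i by simp
  qed simp
qed

lemma sum_degrees: "p \<le> N \<Longrightarrow> (\<Sum>i<N. if i < p then 1 else 0 :: nat) = p"
proof -
  assume "p \<le> N"
  then have "(\<Sum>i<N. if i < p then 1 else 0 :: nat) = (\<Sum>i<p. 1)" by (intro sum.mono_neutral_cong_right) auto
  then show ?thesis by simp
qed

text \<open>Surjectivity has full rank at every point: pairing a linear relation between the rows at
  \<open>x\<close> with a local lift of a multiple of a basis vector isolates one
  coefficient.\<close>

lemma sur_deg_rows_indep:
  assumes d: "0 \<le> d" and sur: "sur_deg n q p d A" and x: "x \<in> proj_space n"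
  shows "rows_indep p q (\<lambda>k j. \<Sum>i\<le>n. A (k, j, i) * x i)"
  unfolding rows_indep_def
proof (intro allI impI)
  fix y k assume z: "\<forall>j<q. (\<Sum>k<p. y k * (\<Sum>i\<le>n. A (k, j, i) * x i)) = 0" and k: "k < p"
  obtain i where i: "i \<le> n" "x i \<noteq> 0" using ex_coord_nonzero[OF x] by blast
  let ?U = "chart n {i}"
  have U: "proj_open n ?U" using i by (intro chart_open) auto
  have xU: "x \<in> ?U" using x i by (auto simp: chart_def)
  define w where "w = (\<lambda>k'. if k' = k then (\<lambda>x. if x \<in> ?U then x i / 1 else 0) else (\<lambda>_. 0 :: complex))"
  have "(\<lambda>x. if x \<in> ?U then x i / 1 else 0) \<in> O_sections n (0 + 1) ?U"
    by (rule O_sections_quot[OF U hom_poly_coord[OF i(1)] hom_poly_const]) auto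
  then have "w \<in> O_sum n (0 + 1) p ?U"
    using k O_sections_zero[OF U] by (simp add: O_sum_def w_def)
  from local_right_inverse[OF d sur i(1) U _ this]
  obtain v where v: "apply_map n q p A v = w" by auto
  have "(\<Sum>j<q. (\<Sum>k'<p. y k' * (\<Sum>i\<le>n. A (k', j, i) * x i)) * v j x) = (\<Sum>k'<p. y k' * (\<Sum>j<q. (\<Sum>i\<le>n. A (k', j, i) * x i) * v j x))"
    unfolding sum_distrib_right[where A = "{..<p}"] sum_distrib_left[where A = "{..<q}"]
    by (subst sum.swap) (simp add: mult.assoc)
  also have "\<dots> = (\<Sum>k'<p. y k' * w k' x)"
    unfolding v[symmetric] by (intro sum.cong) (auto simp: apply_map_def)
  also have "\<dots> = (\<Sum>k'<p. if k' = k then y k * x i else 0)"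
    using xU by (intro sum.cong) (auto simp: w_def)
  also have "\<dots> = y k * x i" using k by simp
  finally have "y k * x i = 0" using z by simp
  then show "y k = 0" using i(2) by simp
qed

text \<open>Adding constant rows makes the matrix invertible near the given point; the last columns of
  the inverse are a frame of the kernel.\<close>

lemma kernel_vector_bundle:
  assumes d: "0 \<le> d" and sur: "sur_deg n (r + p) p d A"
  shows "vector_bundle n r (kernel_sheaf n (r + p) p A 0)"
  unfolding vector_bundle_def
proof
  fix x0 assume x0: "x0 \<in> proj_space n"
  define q where "q = p + r"
  have qq: "r + p = q" by (simp add: q_def)
  define L where "L = (\<lambda>x k j. \<Sum>i\<le>n. A (k, j, i) * x i)"
  have "rows_indep p q (L x0)"
    using sur_deg_rows_indep[OF d sur x0] unfolding L_def qq .
  then obtain R where R: "\<forall>k<p. R k = L x0 k" "rows_indep q q R"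
    using rows_indep_extend[of p q "L x0"] by (auto simp: q_def)
  define G where "G = (\<lambda>x. mat q q (\<lambda>(k, j). if k < p then L x k j else R k j))"
  have Gc: "G x \<in> carrier_mat q q" for x by (simp add: G_def)
  have "G x0 = mat q q (\<lambda>(k, j). R k j)" using R(1) by (intro eq_matI) (auto simp: G_def)
  then have det0: "det (G x0) \<noteq> 0" using rows_indep_det[OF R(2)] by simp
  have hL: "hom_poly n (if k < p then 1 else 0) (\<lambda>x. if k < p then L x k j else R k j)" for k j
    unfolding L_def by (auto intro!: hom_poly_sum hom_poly_scale hom_poly_coord[unfolded One_nat_def] hom_poly_const)
  \<comment> \<open>The \<open>p\<close> rows of linear forms have degree 1 and the added constant
    rows degree 0.\<close>
  have hdet: "hom_poly n p (\<lambda>x. det (G x))"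
    using hom_poly_det[of q n "\<lambda>k. if k < p then 1 else 0" "\<lambda>x (k, j). if k < p then L x k j else R k j"] hL
      sum_degrees[of p q] by (simp add: G_def q_def)
  define W where "W = {x \<in> proj_space n. det (G x) \<noteq> 0}"
  have W: "proj_open n W" unfolding W_def by (rule proj_open_nonvanishing[OF hdet])
  define adj where "adj = (\<lambda>x j k. adj_mat (G x) $$ (j, k))"
  \<comment> \<open>These cofactors delete one of the constant rows and keep all \<open>p\<close>
    linear ones, so they have the degree of the determinant and the frame consists of sections of
    degree 0.\<close>
  have hadj: "hom_poly n p (\<lambda>x. adj x j (p + l))" if "j < q" "l < r" for j l
  proof -
    let ?M = "\<lambda>x (k', j'). let k = (if k' < p + l then k' else Suc k'); j'' = (if j' < j then j' else Suc j') in
        if k < p then L x k j'' else R k j''"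
    have "hom_poly n (\<Sum>k<q - 1. if k < p then 1 else 0) (\<lambda>x. det (mat (q - 1) (q - 1) (?M x)))"
    proof (rule hom_poly_det)
      fix k' j'
      have "(if k' < p then 1 else 0 :: nat) = (if (if k' < p + l then k' else Suc k') < p then 1 else 0)" by auto
      then show "hom_poly n (if k' < p then 1 else 0) (\<lambda>x. ?M x (k', j'))"
        using hL[of "if k' < p + l then k' else Suc k'"] by (simp add: Let_def)
    qed
    moreover have "(\<Sum>k<q - 1. if k < p then 1 else 0 :: nat) = p"
      using that by (intro sum_degrees) (auto simp: q_def)
    moreover have "mat (q - 1) (q - 1) (?M x) = mat_delete (G x) (p + l) j" for x
      using that by (intro eq_matI) (auto simp: mat_delete_def G_def Let_def q_def)
    ultimately have "hom_poly n p (\<lambda>x. (- 1) ^ (p + l + j) * det (mat_delete (G x) (p + l) j))"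
      by (intro hom_poly_scale) simp
    also have "(\<lambda>x. (- 1) ^ (p + l + j) * det (mat_delete (G x) (p + l) j)) = (\<lambda>x. adj x j (p + l))"
      using that by (auto simp: adj_def adj_mat_def cofactor_def G_def q_def)
    finally show ?thesis .
  qed
  have inv1: "(\<Sum>j<q. G x $$ (k, j) * adj x j k') = (if k = k' then det (G x) else 0)" if "k < q" "k' < q" for x k k'
  proof -
    have "(G x * adj_mat (G x)) $$ (k, k') = (det (G x) \<cdot>\<^sub>m 1\<^sub>m q) $$ (k, k')" using adj_mat(2)[OF Gc] by simp
    moreover have "(G x * adj_mat (G x)) $$ (k, k') = (\<Sum>j<q. G x $$ (k, j) * adj x j k')"
      using that adj_mat(1)[OF Gc, of x] Gc[of x] by (auto simp: scalar_prod_def adj_def atLeast0LessThan intro!: sum.cong)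
    ultimately show ?thesis using that by simp
  qed
  have inv2: "(\<Sum>k<q. adj x j k * G x $$ (k, j')) = (if j = j' then det (G x) else 0)" if "j < q" "j' < q" for x j j'
  proof -
    have "(adj_mat (G x) * G x) $$ (j, j') = (det (G x) \<cdot>\<^sub>m 1\<^sub>m q) $$ (j, j')" using adj_mat(3)[OF Gc] by simp
    moreover have "(adj_mat (G x) * G x) $$ (j, j') = (\<Sum>k<q. adj x j k * G x $$ (k, j'))"
      using that adj_mat(1)[OF Gc, of x] Gc[of x] by (auto simp: scalar_prod_def adj_def atLeast0LessThan intro!: sum.cong)
    ultimately show ?thesis using that by simp
  qed
  define e where "e = (\<lambda>l j x. if j < q then adj x j (p + l) / det (G x) else 0)"
  have dual: "(\<Sum>j<q. G x $$ (k, j) * e l j x) = (if k = p + l then 1 else 0)" if "x \<in> W" "k < q" "l < r" for x k l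
  proof -
    have "(\<Sum>j<q. G x $$ (k, j) * e l j x) = (\<Sum>j<q. G x $$ (k, j) * adj x j (p + l)) / det (G x)"
      unfolding sum_divide_distrib by (intro sum.cong) (auto simp: e_def)
    then show ?thesis using inv1[of k "p + l" x] that by (auto simp: W_def q_def)
  qed
  \<comment> \<open>The coordinates of a kernel section in the frame are read off by the added rows,
    since the first \<open>p\<close> rows of \<open>G\<close> annihilate it.\<close>
  have "bij_betw (\<lambda>c j y. \<Sum>l<r. c l y * e l j y) (O_sum n 0 r U) (kernel_sheaf n q p A 0 U)"
    if U: "proj_open n U" "U \<subseteq> W" for U
  proof (rule bij_betwI[where g = "\<lambda>v l y. if l < r then \<Sum>j<q. R (p + l) j * v j y else 0"])
    let ?\<Phi> = "\<lambda>c j y. \<Sum>l<r. c l y * e l j y" and ?\<Psi> = "\<lambda>v l y. if l < r then \<Sum>j<q. R (p + l) j * v j y else 0"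
    have GL: "G y $$ (k, j) = L y k j" if "k < p" "j < q" for y k j using that by (simp add: G_def q_def)
    have GR: "G y $$ (p + l, j) = R (p + l) j" if "l < r" "j < q" for y l j using that by (simp add: G_def q_def)
    have exch: "(\<Sum>j<q. a j * ?\<Phi> c j y) = (\<Sum>l<r. c l y * (\<Sum>j<q. a j * e l j y))" for a c y
      unfolding sum_distrib_left by (subst sum.swap) (simp add: mult_ac)
    show "?\<Phi> \<in> O_sum n 0 r U \<rightarrow> kernel_sheaf n q p A 0 U"
    proof
      fix c assume c: "c \<in> O_sum n 0 r U"
      have c0: "c l y = 0" if "y \<notin> U" for l y using O_sum_outside[OF c] that by blast
      have "?\<Phi> c \<in> O_sum n 0 q U"
        unfolding O_sum_def
      proof (intro CollectI conjI allI impI)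
        fix j assume j: "j < q"
        show "?\<Phi> c j \<in> O_sections n 0 U"
        proof (rule O_sections_sum[OF U(1)])
          fix l assume "l \<in> {..<r}"
          then have l: "l < r" by simp
          have cl: "c l \<in> O_sections n 0 U" using c l by (simp add: O_sum_def)
          have "(\<lambda>y. if y \<in> U then adj y j (p + l) / det (G y) else 0) \<in> O_sections n 0 U"
            by (rule O_sections_quot[OF U(1) hadj[OF j l] hdet]) (use U(2) in \<open>auto simp: W_def\<close>)
          from O_sections_mult[OF cl this]
          have "(\<lambda>y. c l y * (if y \<in> U then adj y j (p + l) / det (G y) else 0)) \<in> O_sections n 0 U" by simp
          also have "(\<lambda>y. c l y * (if y \<in> U then adj y j (p + l) / det (G y) else 0)) = (\<lambda>y. c l y * e l j y)"
            using j c0 by (auto simp: e_def fun_eq_iff)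
          finally show "(\<lambda>y. c l y * e l j y) \<in> O_sections n 0 U" .
        qed
      qed (simp add: e_def fun_eq_iff)
      moreover have "apply_map n q p A (?\<Phi> c) k y = 0" for k y
      proof (cases "k < p \<and> y \<in> U")
        case True
        then have k: "k < p" and y: "y \<in> W" using U(2) by auto
        have "apply_map n q p A (?\<Phi> c) k y = (\<Sum>l<r. c l y * (\<Sum>j<q. L y k j * e l j y))"
          using k unfolding exch[symmetric] by (simp add: apply_map_def L_def)
        also have "\<dots> = (\<Sum>l<r. c l y * (\<Sum>j<q. G y $$ (k, j) * e l j y))" using k by (simp add: GL)
        also have "\<dots> = 0" using dual[OF y, of k] k by (intro sum.neutral) (auto simp: q_def)
        finally show ?thesis .
      next
        case False
        then show ?thesis using c0 by (auto simp: apply_map_def)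
      qed
      ultimately show "?\<Phi> c \<in> kernel_sheaf n q p A 0 U" by (auto simp: kernel_sheaf_def fun_eq_iff)
    qed
    show "?\<Psi> \<in> kernel_sheaf n q p A 0 U \<rightarrow> O_sum n 0 r U"
    proof
      fix v assume "v \<in> kernel_sheaf n q p A 0 U"
      then have v: "v \<in> O_sum n 0 q U" by (simp add: kernel_sheaf_def)
      have "(\<lambda>y. \<Sum>j<q. R (p + l) j * v j y) \<in> O_sections n 0 U" for l
        using v by (intro O_sections_sum[OF U(1)] O_sections_scale[OF U(1)]) (auto simp: O_sum_def)
      then show "?\<Psi> v \<in> O_sum n 0 r U" by (auto simp: O_sum_def fun_eq_iff)
    qed
    show "?\<Psi> (?\<Phi> c) = c" if c: "c \<in> O_sum n 0 r U" for c
    proof (intro ext)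
      fix l y
      show "?\<Psi> (?\<Phi> c) l y = c l y"
      proof (cases "l < r \<and> y \<in> U")
        case True
        then have l: "l < r" and y: "y \<in> W" using U(2) by auto
        have "?\<Psi> (?\<Phi> c) l y = (\<Sum>l'<r. c l' y * (\<Sum>j<q. R (p + l) j * e l' j y))"
          using l unfolding exch by simp
        also have "\<dots> = (\<Sum>l'<r. c l' y * (\<Sum>j<q. G y $$ (p + l, j) * e l' j y))" using l by (simp add: GR)
        also have "\<dots> = (\<Sum>l'<r. if l' = l then c l y else 0)"
          using dual[OF y, of "p + l"] l by (intro sum.cong) (auto simp: q_def)
        also have "\<dots> = c l y" using l by simp
        finally show ?thesis .
      next
        case False
        then have "c l y = 0" using O_sum_outside[OF c] by (meson not_le)
        moreover have "?\<Psi> (?\<Phi> c) l y = 0" using False O_sum_outside[OF c, of y] by auto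
        ultimately show ?thesis by simp
      qed
    qed
    show "?\<Phi> (?\<Psi> v) = v" if v: "v \<in> kernel_sheaf n q p A 0 U" for v
    proof (intro ext)
      fix j y
      have vO: "v \<in> O_sum n 0 q U" and vk: "apply_map n q p A v = (\<lambda>_ _. 0)" using v by (auto simp: kernel_sheaf_def)
      show "?\<Phi> (?\<Psi> v) j y = v j y"
      proof (cases "j < q \<and> y \<in> U")
        case True
        then have j: "j < q" and y: "det (G y) \<noteq> 0" using U(2) by (auto simp: W_def)
        let ?t = "\<lambda>k. \<Sum>j<q. G y $$ (k, j) * v j y"
        have t0: "?t k = 0" if "k < p" for k
        proof -
          have "?t k = apply_map n q p A v k y" using that by (simp add: apply_map_def GL L_def)
          then show ?thesis by (simp add: vk)
        qed
        have "(\<Sum>k<q. adj y j k * ?t k) = (\<Sum>j'<q. (\<Sum>k<q. adj y j k * G y $$ (k, j')) * v j' y)"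
          unfolding sum_distrib_left sum_distrib_right by (subst sum.swap) (simp add: mult.assoc)
        also have "\<dots> = (\<Sum>j'<q. if j' = j then det (G y) * v j y else 0)"
          using inv2[OF j] by (intro sum.cong) auto
        also have "\<dots> = det (G y) * v j y" using j by simp
        finally have "det (G y) * v j y = (\<Sum>k<p + r. adj y j k * ?t k)" by (simp add: q_def)
        also have "\<dots> = (\<Sum>l<r. adj y j (p + l) * ?t (p + l))"
          unfolding sum_lessThan_add using t0 by simp
        finally have "v j y = (\<Sum>l<r. adj y j (p + l) * ?t (p + l)) / det (G y)" using y by (simp add: field_simps)
        also have "\<dots> = ?\<Phi> (?\<Psi> v) j y"
          unfolding sum_divide_distrib using j by (intro sum.cong) (auto simp: e_def GR mult.commute)
        finally show ?thesis by simp
      next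
        case False
        then have "v j y = 0" using O_sum_outside[OF vO] by (meson not_le)
        moreover have "?\<Phi> (?\<Psi> v) j y = 0" using False O_sum_outside[OF vO, of y] by (auto simp: e_def intro!: sum.neutral)
        ultimately show ?thesis by simp
      qed
    qed
  qed
  then show "\<exists>W. proj_open n W \<and> x0 \<in> W \<and> (\<exists>e. \<forall>U. proj_open n U \<and> U \<subseteq> W \<longrightarrow>
      bij_betw (\<lambda>c j y. \<Sum>l<r. c l y * e l j y) (O_sum n 0 r U) (kernel_sheaf n (r + p) p A 0 U))"
    unfolding qq using W x0 det0 by (intro exI[of _ W] conjI exI[of _ e]) (auto simp: W_def)
qed

section \<open>Existence of good maps\<close>

lemma general_kernel_natural:
  assumes n: "1 \<le> n" and inj: "inj_deg n (r + p) p (int b - 1) (A :: lin_matrix)"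
    and sur: "sur_deg n (r + p) p (int b) (B :: lin_matrix)"
  shows "for_general_map n (r + p) p (\<lambda>A. surjective_map n (r + p) p A \<and>
    vector_bundle n r (kernel_sheaf n (r + p) p A 0) \<and> natural_cohomology n (kernel_sheaf n (r + p) p A))"
proof (rule for_general_map_degs[OF inj sur], intro conjI)
  fix C :: lin_matrix
  assume C: "inj_deg n (r + p) p (int b - 1) C" "sur_deg n (r + p) p (int b) C"
  have b: "0 \<le> int b" by simp
  show "surjective_map n (r + p) p C" by (rule kernel_surjective_map[OF b C(2)])
  show "vector_bundle n r (kernel_sheaf n (r + p) p C 0)" by (rule kernel_vector_bundle[OF b C(2)])
  show "natural_cohomology n (kernel_sheaf n (r + p) p C)" by (rule kernel_natural_cohomology[OF n b C])
qed

text \<open>With rank \<open>k * n\<close> the threshold reads \<open>k * b\<close> against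
  \<open>p\<close>, so \<open>b = p div k\<close> is the largest degree count for which injectivity
  is expected. Exactly \<open>k\<close> blocks give both maps, with no rounding of the rank.\<close>

lemma general_kernel_divisible:
  assumes n: "1 \<le> n" and k: "1 \<le> k"
  shows "for_general_map n (k * n + p) p (\<lambda>A. surjective_map n (k * n + p) p A \<and>
    vector_bundle n (k * n) (kernel_sheaf n (k * n + p) p A 0) \<and> natural_cohomology n (kernel_sheaf n (k * n + p) p A))"
proof -
  let ?b = "p div k"
  have "k * ?b \<le> p" by (rule times_div_less_eq_dividend)
  then obtain A :: lin_matrix where A: "inj_deg n (k * n + p) p (int ?b - 1) A"
    using ex_inj_deg[of k ?b p "k * n" n] by auto
  have "p < k * (?b + 1)" using k dividend_less_div_times[of k p] by (simp add: algebra_simps)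
  then obtain B :: lin_matrix where "sur_deg n (k * n + p) p (int (?b + 1) - 1) B"
    using ex_sur_deg[of p k "?b + 1" n "k * n"] by auto
  then show ?thesis using general_kernel_natural[OF n A, of B] by simp
qed

text \<open>Rounding the rank down to a multiple of \<open>n\<close> loses fewer than
  \<open>n\<close> columns, that is less than \<open>n * b\<close> in the comparison, while the
  strict inequality gains at least \<open>m\<close>.\<close>

lemma ex_sur_deg_large:
  assumes strict: "n * t < \<delta> * b" and b: "1 \<le> b" and n: "1 \<le> n" and m: "n * b \<le> m"
  shows "\<exists>B :: lin_matrix. sur_deg n (m * \<delta> + m * t) (m * t) (int b - 1) B"
proof -
  define k where "k = (m * \<delta>) div n"
  have k: "k * n \<le> m * \<delta>" by (simp add: k_def)
  have "m * \<delta> < k * n + n" using n dividend_less_div_times[of n "m * \<delta>"] by (simp add: k_def add.commute)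
  then have "m * \<delta> * b \<le> (k * n + n) * b" by (intro mult_right_mono) auto
  moreover have "m * (n * t + 1) \<le> m * (\<delta> * b)" using strict by (intro mult_left_mono) auto
  ultimately have "m * (n * t) + m \<le> n * (k * b) + n * b" by (simp add: algebra_simps)
  then have "m * (n * t) \<le> n * (k * b)" using m by linarith
  then have "n * (m * t) \<le> n * (k * b)" by (simp only: mult.left_commute[of n m t])
  then have "m * t \<le> k * b" using n by simp
  then show ?thesis using ex_sur_deg[of "m * t" k b n "m * \<delta>"] k b by blast
qed

text \<open>Here the rows are cut into blocks of \<open>b\<close>; fewer than \<open>b\<close> rows
  are left over, a loss below \<open>n * b\<close> against a gain of at least
  \<open>m\<close>.\<close>

lemma ex_inj_deg_large:
  assumes strict: "\<delta> * b < n * t" and b: "1 \<le> b" and m: "n * b \<le> m"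
  shows "\<exists>A :: lin_matrix. inj_deg n (m * \<delta> + m * t) (m * t) (int b - 1) A"
proof -
  define k where "k = (m * t) div b"
  have k: "k * b \<le> m * t" by (simp add: k_def)
  have "m * t < k * b + b" using b dividend_less_div_times[of b "m * t"] by (simp add: k_def add.commute)
  then have "n * (m * t) \<le> n * (k * b + b)" by (intro mult_left_mono) auto
  moreover have "m * (\<delta> * b + 1) \<le> m * (n * t)" using strict by (intro mult_left_mono) auto
  ultimately have "m * (\<delta> * b) + m \<le> b * (k * n) + n * b" by (simp add: algebra_simps)
  then have "m * (\<delta> * b) \<le> b * (k * n)" using m by linarith
  moreover have "m * (\<delta> * b) = b * (m * \<delta>)" by (simp only: mult_ac)
  ultimately have "b * (m * \<delta>) \<le> b * (k * n)" by simp
  then have "m * \<delta> \<le> k * n" using b by simp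
  then show ?thesis using ex_inj_deg[of k b "m * t" "m * \<delta>" n] k by blast
qed

text \<open>The counting argument in degree \<open>b - 1\<close>; the bound on \<open>m\<close> is
  its size condition, with \<open>D\<close> the number of monomials.\<close>

lemma ex_inj_deg_critical_large:
  fixes n t \<delta> b m :: nat
  defines "D \<equiv> card (mons n (int b - 1))"
  assumes crit: "\<delta> * b = n * t" and b: "1 \<le> b" and t: "1 \<le> t" and m: "b * (D * D + D) \<le> m"
  shows "\<exists>A :: lin_matrix. inj_deg n (m * \<delta> + m * t) (m * t) (int b - 1) A"
proof (rule ex_inj_deg_critical)
  show "0 \<le> int b - 1" using b by simp
  have "(m * \<delta> + m * t) * b = m * (\<delta> * b) + m * t * b" by (simp add: algebra_simps)
  also have "\<dots> = m * t * (b + n)" unfolding crit by (simp add: algebra_simps)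
  finally show "int (m * \<delta> + m * t) * (int b - 1 + 1) = int (m * t) * (int b - 1 + 1 + int n)"
    by (metis (no_types, opaque_lifting) diff_add_cancel of_nat_add of_nat_mult)
  have "b * (D * D + D) \<le> m * t" using m t by (metis le_trans mult.right_neutral mult_le_mono2)
  then show "(int b - 1 + 1) * int (card (mons n (int b - 1)) * card (mons n (int b - 1)) + card (mons n (int b - 1))) \<le> int (m * t)"
    unfolding D_def[symmetric] by (metis diff_add_cancel of_nat_le_iff of_nat_mult)
qed

theorem theorem1p6:
  fixes n s t :: nat
  assumes "n \<ge> 1" and "t \<ge> 1" and "s > t"
  shows
    "(\<exists>m0. \<forall>m\<ge>m0. m > 0 \<and> m * (s - t) \<ge> n \<longrightarrow>
        for_general_map n (m * s) (m * t) (\<lambda>A.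
          surjective_map n (m * s) (m * t) A \<and>
          vector_bundle n (m * s - m * t) (kernel_sheaf n (m * s) (m * t) A 0) \<and>
          natural_cohomology n (kernel_sheaf n (m * s) (m * t) A)))
     \<and>
     (\<forall>m. m > 0 \<and> m * (s - t) \<ge> n \<and> n dvd (m * s - m * t) \<longrightarrow>
        for_general_map n (m * s) (m * t) (\<lambda>A.
          surjective_map n (m * s) (m * t) A \<and>
          vector_bundle n (m * s - m * t) (kernel_sheaf n (m * s) (m * t) A 0) \<and>
          natural_cohomology n (kernel_sheaf n (m * s) (m * t) A)))"
proof
  define \<delta> where "\<delta> = s - t"
  have \<delta>: "1 \<le> \<delta>" "m * s = m * \<delta> + m * t" "m * s - m * t = m * \<delta>" for m
    using assms(3) by (auto simp: \<delta>_def simp flip: distrib_left diff_mult_distrib2)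
  \<comment> \<open>The largest \<open>b\<close> with \<delta> b \<le> n t: injectivity is expected
    up to degree \<open>b - 1\<close> and surjectivity from degree \<open>b\<close> on,
    independently of \<open>m\<close>.\<close>
  define b where "b = (n * t) div \<delta>"
  define D where "D = card (mons n (int b - 1))"
  have b: "\<delta> * b \<le> n * t" "n * t < \<delta> * (b + 1)"
    using \<delta>(1) dividend_less_div_times[of \<delta> "n * t"] by (auto simp: b_def algebra_simps)
  \<comment> \<open>The threshold combines the strict surjectivity in degree \<open>b\<close>, which
    needs \<open>n * (b + 1)\<close> and also covers strict injectivity, with the size condition of
    the critical case. For \<open>b = 0\<close> injectivity is asked only in degree -1, where the
    source is zero.\<close>
  have large: "for_general_map n (m * \<delta> + m * t) (m * t) (\<lambda>A.
          surjective_map n (m * \<delta> + m * t) (m * t) A \<and>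
          vector_bundle n (m * \<delta>) (kernel_sheaf n (m * \<delta> + m * t) (m * t) A 0) \<and>
          natural_cohomology n (kernel_sheaf n (m * \<delta> + m * t) (m * t) A))"
    if m: "n * (b + 1) + b * (D * D + D) \<le> m" for m
  proof -
    obtain B :: lin_matrix where B: "sur_deg n (m * \<delta> + m * t) (m * t) (int (b + 1) - 1) B"
      using ex_sur_deg_large[OF b(2) _ assms(1), of m] m by auto
    have "\<exists>A :: lin_matrix. inj_deg n (m * \<delta> + m * t) (m * t) (int b - 1) A"
    proof (cases "b = 0")
      case True
      then show ?thesis by (simp add: inj_deg_neg)
    next
      case False
      then have b1: "1 \<le> b" by simp
      show ?thesis
      proof (cases "\<delta> * b = n * t")
        case True
        have "b * (D * D + D) \<le> m" using m by simp
        then show ?thesis using ex_inj_deg_critical_large[OF True b1 assms(2)] unfolding D_def by blast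
      next
        case False
        then have "\<delta> * b < n * t" using b(1) by simp
        moreover have "n * b \<le> m" using m by simp
        ultimately show ?thesis using ex_inj_deg_large b1 by blast
      qed
    qed
    then obtain A :: lin_matrix where A: "inj_deg n (m * \<delta> + m * t) (m * t) (int b - 1) A" by blast
    show ?thesis using general_kernel_natural[OF assms(1) A, of B] B by simp
  qed
  show "\<exists>m0. \<forall>m\<ge>m0. m > 0 \<and> m * (s - t) \<ge> n \<longrightarrow>
        for_general_map n (m * s) (m * t) (\<lambda>A.
          surjective_map n (m * s) (m * t) A \<and>
          vector_bundle n (m * s - m * t) (kernel_sheaf n (m * s) (m * t) A 0) \<and>
          natural_cohomology n (kernel_sheaf n (m * s) (m * t) A))"
    unfolding \<delta>(2) add_diff_cancel_right'
    by (intro exI[of _ "n * (b + 1) + b * (D * D + D)"] allI impI) (rule large)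
  show "\<forall>m. m > 0 \<and> m * (s - t) \<ge> n \<and> n dvd (m * s - m * t) \<longrightarrow>
        for_general_map n (m * s) (m * t) (\<lambda>A.
          surjective_map n (m * s) (m * t) A \<and>
          vector_bundle n (m * s - m * t) (kernel_sheaf n (m * s) (m * t) A 0) \<and>
          natural_cohomology n (kernel_sheaf n (m * s) (m * t) A))"
  proof (intro allI impI)
    fix m assume m: "m > 0 \<and> m * (s - t) \<ge> n \<and> n dvd (m * s - m * t)"
    then have "n dvd m * \<delta>" by (simp only: \<delta>(3))
    then obtain k where "m * \<delta> = n * k" by (rule dvdE)
    then have k: "m * \<delta> = k * n" by (simp only: mult.commute)
    have "0 < m * \<delta>" using m \<delta>(1) by simp
    then have "k \<noteq> 0" unfolding k by (cases k) auto
    then show "for_general_map n (m * s) (m * t) (\<lambda>A.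
          surjective_map n (m * s) (m * t) A \<and>
          vector_bundle n (m * s - m * t) (kernel_sheaf n (m * s) (m * t) A 0) \<and>
          natural_cohomology n (kernel_sheaf n (m * s) (m * t) A))"
      unfolding \<delta>(3) \<delta>(2) k using general_kernel_divisible[OF assms(1), of k "m * t"] by simp
  qed
qed

end
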